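(* The set of real numbers $\xi$ whose (classical) Lagrange value $\mu(\xi)$ equals $3$ has Hausdorff dimension zero. More generally, let $a,b,c$ be positive real numbers with $a^2+b^2+c^2=abc$ and $2<a\le b\le c<ab/2$, and let $\Gamma$ be the corresponding Fuchsian group described in the context. Then the set of real numbers $\xi$ that are not parabolic fixed points of $\Gamma$ and satisfy $\mu_\Gamma(\xi)=a$ has Hausdorff dimension zero.
   Context: The classical Lagrange value of an irrational $\xi$ is $\mu(\xi)=\sup\{h : |\xi-p/q|<1/(hq^2)$ for infinitely many $p/q\in\mathbb Q\}$. Fricke groups: for positive reals $a,b,c$ with $a^2+b^2+c^2=abc$ and $2<a\le b\le c<ab/2$, let $\Gamma\subset \mathrm{PSL}_2(\mathbb R)$ be the group generated by \[T_0=\begin{pmatrix}0&-a/c\\ c/a&0\end{pmatrix},\quad T_1=\begin{pmatrix}a/c&*\\ b/a&-a/c\end{pmatrix},\quad T_2=\begin{pmatrix}a-b/c&*\\ 1&-a+b/c\end{pmatrix},\] where $*$ denotes the entry making the determinant $1$. Then $\Gamma$ is a Fuchsian group of signature $(0;2,2,2;\infty)$, i.e. it uniformizes a hyperbolic genus-zero orbifold with one cusp and three cone points of order two, and $T_2T_1T_0=S^a: z\mapsto z+a$ is its fundamental translation. These triples give a full set of representatives of the Teichmüller space of such orbifolds. When $a=b=c=3$, $\Gamma$ is the group $\Gamma^3$ generated by the cubes of elements of $\mathrm{PSL}_2(\mathbb Z)$. For a zonal Fuchsian group $\Gamma$ (one having $\infty$ as a parabolic fixed point) and $\xi$ in its limit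 set not a parabolic fixed point, the Lagrange value of $\xi$ with respect to $\Gamma$ is \[\mu_\Gamma(\xi)=\sup\{h : \text{there exists an infinite sequence } \{V_j\}\subset\Gamma \text{ such that } |V_j(\infty)-V_j(\xi)| \text{ converges to } h\}.\] *)

theory Defs
  imports "HOL-Analysis.Analysis" "HOL-Algebra.Coset" "HOL-Algebra.Generated_Groups"
begin

section \<open>Hausdorff measure and dimension\<close>

text \<open>The exponent \<open>s\<close> is meant to be positive, so the value of \<open>0 powr 0\<close> is irrelevant. The
  boundedness requirement is needed because \<^const>\<open>diameter\<close> is meaningful for bounded sets only.\<close>

definition hausdorff_content :: "real \<Rightarrow> real \<Rightarrow> 'a::metric_space set \<Rightarrow> ennreal" where
  "hausdorff_content s \<delta> E =
     (INF U \<in> {U :: nat \<Rightarrow> 'a set. E \<subseteq> (\<Union>i. U i) \<and> (\<forall>i. bounded (U i) \<and> diameter (U i) \<le> \<delta>)}.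
        \<Sum>i. ennreal (diameter (U i) powr s))"

definition hausdorff_measure :: "real \<Rightarrow> 'a::metric_space set \<Rightarrow> ennreal" where
  "hausdorff_measure s E = (SUP \<delta> \<in> {0<..}. hausdorff_content s \<delta> E)"

definition hausdorff_dim :: "'a::metric_space set \<Rightarrow> ereal" where
  "hausdorff_dim E = Inf (ereal ` {s. 0 < s \<and> hausdorff_measure s E = 0})"

section \<open>The classical Lagrange value\<close>

definition lagrange_value :: "real \<Rightarrow> ereal" where
  "lagrange_value \<xi> =
     Sup (ereal ` {h. infinite {x. \<exists>p q :: int. q > 0 \<and> x = real_of_int p / real_of_int q \<and>
                                   \<bar>\<xi> - x\<bar> < 1 / (h * (real_of_int q)\<^sup>2)}})"

section \<open>The group \<open>PSL\<^sub>2(\<real>)\<close> and its action on the real projective line\<close>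

definition mat2 :: "real \<Rightarrow> real \<Rightarrow> real \<Rightarrow> real \<Rightarrow> real^2^2" where
  "mat2 p q r s = vector [vector [p, q], vector [r, s]]"

definition SL2 :: "(real^2^2) monoid" where
  "SL2 = \<lparr>carrier = {A. det A = 1}, mult = (**), one = mat 1\<rparr>"

definition PSL2 :: "(real^2^2) set monoid" where
  "PSL2 = SL2 Mod {mat 1, - mat 1}"

text \<open>The image of a matrix in \<^const>\<open>PSL2\<close>, i.e. \<open>{A, -A}\<close>; see \<open>psl_eq\<close> below.\<close>

definition psl :: "real^2^2 \<Rightarrow> (real^2^2) set" where
  "psl A = {mat 1, - mat 1} #>\<^bsub>SL2\<^esub> A"

text \<open>Points of the projective line are of type \<^typ>\<open>real option\<close>; \<^const>\<open>None\<close> is the point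
  at infinity.\<close>

definition moebius :: "real^2^2 \<Rightarrow> real option \<Rightarrow> real option" where
  "moebius A z =
     (case z of
        None \<Rightarrow> if A$2$1 = 0 then None else Some (A$1$1 / A$2$1)
      | Some x \<Rightarrow> if A$2$1 * x + A$2$2 = 0 then None
                  else Some ((A$1$1 * x + A$1$2) / (A$2$1 * x + A$2$2)))"

text \<open>The choice of representative is immaterial, see \<open>psl_act_psl\<close> below.\<close>

definition psl_act :: "(real^2^2) set \<Rightarrow> real option \<Rightarrow> real option" where
  "psl_act V z = moebius (SOME A. A \<in> V) z"

definition parabolic :: "(real^2^2) set \<Rightarrow> bool" where
  "parabolic V \<longleftrightarrow> V \<in> carrier PSL2 \<and> V \<noteq> \<one>\<^bsub>PSL2\<^esub> \<and> (\<exists>A\<in>V. \<bar>trace A\<bar> = 2)"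

definition parabolic_fixed_point :: "(real^2^2) set set \<Rightarrow> real option \<Rightarrow> bool" where
  "parabolic_fixed_point \<Gamma> z \<longleftrightarrow> (\<exists>V\<in>\<Gamma>. parabolic V \<and> psl_act V z = z)"

section \<open>The Lagrange value with respect to a group\<close>

fun ext_dist :: "real option \<Rightarrow> real option \<Rightarrow> ereal" where
  "ext_dist (Some x) (Some y) = ereal \<bar>x - y\<bar>"
| "ext_dist _ _ = \<infinity>"

text \<open>The sequence \<open>V\<close> has to be infinite modulo the stabilizer of \<open>\<infinity>\<close>, i.e. the points
  \<open>V\<^sub>j\<inverse>(\<infinity>)\<close> are pairwise distinct: left multiplication by a translation does not change
  \<open>\<bar>V\<^sub>j(\<infinity>) - V\<^sub>j(\<xi>)\<bar>\<close>, so mere distinctness of the \<open>V\<^sub>j\<close> would count every individual value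
  as a limit. In the classical case this says that there are infinitely many \<open>p/q\<close>, since
  \<open>\<bar>V(\<infinity>) - V(\<xi>)\<bar> = 1 / (q\<^sup>2 \<bar>\<xi> - p/q\<bar>)\<close> if \<open>V\<^sup>-\<^sup>1(\<infinity>) = p/q\<close>.
  The limit \<open>h = \<infinity>\<close> is admitted, so the value is infinite if some such sequence diverges
  to infinity.\<close>

definition lagrange_value_wrt :: "(real^2^2) set set \<Rightarrow> real \<Rightarrow> ereal" where
  "lagrange_value_wrt \<Gamma> \<xi> =
     Sup {h. \<exists>V :: nat \<Rightarrow> (real^2^2) set.
            range V \<subseteq> \<Gamma> \<and>
            inj (\<lambda>j. psl_act (inv\<^bsub>PSL2\<^esub> (V j)) None) \<and>
            (\<lambda>j. ext_dist (psl_act (V j) None) (psl_act (V j) (Some \<xi>))) \<longlonglongrightarrow> h}"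

section \<open>Fricke groups\<close>

text \<open>The upper right entries of \<open>T1\<close> and \<open>T2\<close> are the ones making the determinant 1.\<close>

definition T0 :: "real \<Rightarrow> real \<Rightarrow> real \<Rightarrow> real^2^2" where
  "T0 a b c = mat2 0 (- a / c) (c / a) 0"

definition T1 :: "real \<Rightarrow> real \<Rightarrow> real \<Rightarrow> real^2^2" where
  "T1 a b c = mat2 (a / c) (- (1 + (a / c)\<^sup>2) * a / b) (b / a) (- a / c)"

definition T2 :: "real \<Rightarrow> real \<Rightarrow> real \<Rightarrow> real^2^2" where
  "T2 a b c = mat2 (a - b / c) (- (1 + (a - b / c)\<^sup>2)) 1 (- a + b / c)"

definition fricke_group :: "real \<Rightarrow> real \<Rightarrow> real \<Rightarrow> (real^2^2) set set" where
  "fricke_group a b c = generate PSL2 {psl (T0 a b c), psl (T1 a b c), psl (T2 a b c)}"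

section \<open>Basic facts\<close>

lemma mat2_nth [simp]:
  "mat2 p q r s $ 1 $ 1 = p" "mat2 p q r s $ 1 $ 2 = q"
  "mat2 p q r s $ 2 $ 1 = r" "mat2 p q r s $ 2 $ 2 = s"
  by (simp_all add: mat2_def)

lemma mat2_mult: "mat2 p q r s ** mat2 p' q' r' s' =
    mat2 (p * p' + q * r') (p * q' + q * s') (r * p' + s * r') (r * q' + s * s')"
  by (simp add: vec_eq_iff matrix_matrix_mult_def forall_2 sum_2)

lemma det_mat2: "det (mat2 p q r s) = p * s - q * r"
  by (simp add: det_2)

lemma group_SL2: "group SL2"
proof (rule groupI)
  fix A assume A: "A \<in> carrier SL2"
  define B where "B = mat2 (A$2$2) (- A$1$2) (- A$2$1) (A$1$1)"
  have "B \<in> carrier SL2" "B \<otimes>\<^bsub>SL2\<^esub> A = \<one>\<^bsub>SL2\<^esub>"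
    using A by (auto simp: SL2_def B_def det_2 vec_eq_iff matrix_matrix_mult_def forall_2 sum_2
        mat_def algebra_simps)
  then show "\<exists>B\<in>carrier SL2. B \<otimes>\<^bsub>SL2\<^esub> A = \<one>\<^bsub>SL2\<^esub>"
    by blast
qed (auto simp: SL2_def det_mul matrix_mul_assoc)

lemma neg_mat_mult: "(- A) ** B = - (A ** B)" "A ** (- B) = - (A ** B)" for A B :: "real^2^2"
  by (simp_all add: vec_eq_iff matrix_matrix_mult_def forall_2 sum_2)

lemma psl_eq: "psl A = {A, - A}"
  by (auto simp: psl_def r_coset_def SL2_def neg_mat_mult)

lemma normal_pm1: "{mat 1, - mat 1} \<lhd> SL2"
proof -
  interpret group SL2 by (rule group_SL2)
  have "subgroup {mat 1, - mat 1} SL2"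
  proof (rule subgroupI)
    fix A assume "A \<in> {mat 1, - mat 1 :: real^2^2}"
    moreover have "inv\<^bsub>SL2\<^esub> (mat 1) = mat 1" "inv\<^bsub>SL2\<^esub> (- mat 1) = - mat 1"
      by (rule inv_equality; simp add: SL2_def neg_mat_mult; simp add: det_2 mat_def)+
    ultimately show "inv\<^bsub>SL2\<^esub> A \<in> {mat 1, - mat 1}" by auto
  qed (auto simp: SL2_def neg_mat_mult det_2, auto simp: mat_def)
  then show ?thesis
    by (rule normalI) (auto simp: r_coset_def l_coset_def SL2_def neg_mat_mult)
qed

lemma group_PSL2: "group PSL2"
  unfolding PSL2_def by (rule normal.factorgroup_is_group[OF normal_pm1])

lemma psl_in_PSL2: "det A = 1 \<Longrightarrow> psl A \<in> carrier PSL2"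
  by (auto simp: PSL2_def FactGroup_def RCOSETS_def psl_def SL2_def)

lemma psl_act_psl: "psl_act (psl A) z = moebius A z"
proof -
  have "(SOME B. B \<in> psl A) \<in> psl A" by (rule someI[of _ A]) (simp add: psl_eq)
  then have "(SOME B. B \<in> psl A) = A \<or> (SOME B. B \<in> psl A) = - A" by (simp add: psl_eq)
  moreover have "moebius (- A) z = moebius A z"
  proof (cases z)
    case (Some x)
    have "(- A)$2$1 * x + (- A)$2$2 = - (A$2$1 * x + A$2$2)"
         "(- A)$1$1 * x + (- A)$1$2 = - (A$1$1 * x + A$1$2)" by simp_all
    then show ?thesis
      unfolding moebius_def Some option.case by (simp only: neg_equal_0_iff_equal minus_divide_divide)
  qed (simp add: moebius_def)
  ultimately show ?thesis by (auto simp: psl_act_def)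
qed

lemma det_T:
  assumes "a > 0" "b > 0" "c > 0"
  shows "det (T0 a b c) = 1" "det (T1 a b c) = 1" "det (T2 a b c) = 1"
  using assms by (simp_all add: T0_def T1_def T2_def det_mat2 power2_eq_square field_simps)

lemma T2_T1_T0:
  assumes "a > 0" "b > 0" "c > 0" "a\<^sup>2 + b\<^sup>2 + c\<^sup>2 = a * b * c"
  shows "T2 a b c ** T1 a b c ** T0 a b c = mat2 1 a 0 1"
proof -
  define k where "k = a - b / c"
  define u where "u = - (1 + (a / c)\<^sup>2) * a / b"
  have u: "u * (c / a) = - k"
  proof -
    have "u * (c / a) = - (a\<^sup>2 + c\<^sup>2) / (b * c)"
      using assms(1-3) by (simp add: u_def power2_eq_square field_simps)
    also have "a\<^sup>2 + c\<^sup>2 = a * b * c - b\<^sup>2" using assms(4) by simp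
    also have "- (a * b * c - b\<^sup>2) / (b * c) = - k"
      using assms(1-3) by (simp add: k_def power2_eq_square field_simps)
    finally show ?thesis .
  qed
  have v: "k * (b / c) - (a / c)\<^sup>2 = 1"
  proof -
    have "k * (b / c) - (a / c)\<^sup>2 = (a * b * c - a\<^sup>2 - b\<^sup>2) / c\<^sup>2"
      using assms(1-3) by (simp add: k_def power2_eq_square field_simps)
    also have "a * b * c - a\<^sup>2 - b\<^sup>2 = c\<^sup>2" using assms(4) by simp
    finally show ?thesis using assms(3) by simp
  qed
  have T: "T1 a b c ** T0 a b c = mat2 (- k) (- ((a / c)\<^sup>2)) (- 1) (- (b / c))"
    unfolding T1_def T0_def u_def[symmetric] using assms u by (simp add: mat2_mult power2_eq_square)
  have "T2 a b c = mat2 k (- (1 + k\<^sup>2)) 1 (- k)" by (simp add: T2_def k_def)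
  then have "T2 a b c ** (T1 a b c ** T0 a b c) =
     mat2 1 (b / c + k * (k * (b / c) - (a / c)\<^sup>2)) 0 (k * (b / c) - (a / c)\<^sup>2)"
    unfolding T by (simp add: mat2_mult power2_eq_square algebra_simps)
  then show ?thesis unfolding v by (simp add: matrix_mul_assoc k_def)
qed

end

theory Submission
  imports Defs
begin

text \<open>The generators of the group are involutions attached to the sides of an ideal triangle with vertices
  \<open>0\<close>, \<open>p + q\<close> and \<open>\<infinity>\<close>. The images of the triangle tessellate the half plane, so a vertical geodesic
  ending at \<open>\<xi>\<close> is coded by the sides it crosses, equivalently by its left and right turns. The value
  \<open>\<mu>(\<xi>) = a\<close> says that the lifts of the geodesic have Euclidean diameter at most \<open>a + o(1)\<close>, where \<open>a\<close> is
  the cusp width. Comparing the two ends of such a lift with their translates by \<open>a\<close>, this forces, for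
  every \<open>L\<close>, all but finitely many windows of length \<open>L\<close> of the turning word to avoid a family of mirror
  patterns; these are the patterns that make the geodesic cross itself. A finite word without them is a
  word in two blocks up to boundary effects and a few exceptional words, and the block word satisfies
  Markov's combinatorial condition, which is inherited under the substitutions of the Euclidean algorithm.
  Hence the number of such words of length \<open>L\<close> grows subexponentially in \<open>L\<close>, whereas the cylinders shrink
  exponentially, and the set of all \<open>\<xi>\<close> has dimension zero.\<close>

section \<open>Words without mirror patterns\<close>

text \<open>A lift whose end points are at distance \<open>h\<close> crosses its translate by
  \<open>a\<close> exactly when \<open>h > a\<close>, so a crossing with overlap bounded below
  cannot recur. A mirror pattern forces such an overlap, but the bound obtained depends on the
  length of the pattern. Hence only windows of one fixed length can be controlled, and only from an
  index that depends on the point; finite words come with ragged ends and exceptions that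
  bi-infinite Markov words do not have. The count is therefore carried by weighted sums over sets of
  words: these are submultiplicative under concatenation, tolerate ambiguous factorizations, and
  under a substitution merely change the two letter weights. The pattern in
  \<open>unbalanced\<close> is the one that Markov's condition forbids for blocks; the long pattern
  in \<open>crossing\<close> is its counterpart for turns. A second obstacle is that neighbouring
  arcs share an end point, near which the maps hardly contract. Bounded height keeps the orbit away
  from these points, with constants depending on the point, so the set is split into countably many
  parts with uniform constants.\<close>

definition twin :: "bool list \<Rightarrow> nat \<Rightarrow> bool" where
  "twin w r \<longleftrightarrow> Suc r < length w \<and> w ! r = w ! Suc r"

text \<open>The word \<open>c\<close> is the common part of the expansions read from the centre \<open>[x, \<not> x]\<close> in both
  directions, up to their first difference.\<close>

definition unbalanced :: "bool list \<Rightarrow> bool" where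
  "unbalanced w \<longleftrightarrow> (\<exists>u x c v. w = u @ [x] @ rev c @ [x, \<not> x] @ c @ [\<not> x] @ v)"

text \<open>The same for turning words: reading backwards reverses and negates the turns.\<close>

definition crossing :: "bool list \<Rightarrow> bool" where
  "crossing w \<longleftrightarrow> (\<exists>u s d v. w = u @ [s, s, s] @ v \<or>
     w = u @ [s] @ rev (map Not d) @ [\<not> s, s, s, \<not> s] @ d @ [s] @ v)"

lemma list_split_at:
  assumes "i + n \<le> length w"
  shows "w = take i w @ map (\<lambda>k. w ! (i + k)) [0..<n] @ drop (i + n) w"
  using assms by (intro nth_equalityI) (auto simp: nth_append)

lemma unbalanced_I:
  assumes "i + 2 * j + 3 < length w" "w ! i = x" "w ! (i + j + 1) = x"
    "w ! (i + j + 2) = (\<not> x)" "w ! (i + 2 * j + 3) = (\<not> x)"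
    "\<And>k. k < j \<Longrightarrow> w ! (i + 1 + k) = w ! (i + 2 * j + 2 - k)"
  shows "unbalanced w"
proof -
  define c where "c = map (\<lambda>k. w ! (i + j + 3 + k)) [0..<j]"
  have "map (\<lambda>k. w ! (i + k)) [0..<2 * j + 4] = [x] @ rev c @ [x, \<not> x] @ c @ [\<not> x]"
  proof (rule nth_equalityI, goal_cases)
    case 1 then show ?case by (simp add: c_def)
  next
    case (2 k)
    then have k: "k < 2 * j + 4" by simp
    have lc: "length c = j" by (simp add: c_def)
    consider "k = 0" | "1 \<le> k" "k < j + 1" | "k = j + 1" | "k = j + 2" | "j + 3 \<le> k" "k < 2 * j + 3" | "k = 2 * j + 3"
      using k by linarith
    then show ?case
    proof cases
      case 2
      then obtain m where m: "k = Suc m" "m < j" by (cases k) auto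
      have "i + j + 3 + (j - Suc m) = i + 2 * j + 2 - m" using m by simp
      then show ?thesis using m assms(6)[of m] k lc by (simp add: nth_append rev_nth c_def)
    next
      case 5
      define m where "m = k - (j + 3)"
      have m: "k = j + 3 + m" "m < j" using 5 by (simp_all add: m_def)
      show ?thesis using m(2) lc unfolding m(1) by (simp add: nth_append c_def add.assoc)
    next
      case 1 then show ?thesis using assms(2) by simp
    next
      case 3 then show ?thesis using assms(3) lc by (simp add: nth_append)
    next
      case 4 then show ?thesis using assms(4) lc by (simp add: nth_append)
    next
      case 6 then show ?thesis using assms(5) lc by (simp add: nth_append add.assoc)
    qed
  qed
  moreover have "w = take i w @ map (\<lambda>k. w ! (i + k)) [0..<2 * j + 4] @ drop (i + (2 * j + 4)) w"
    by (rule list_split_at) (use assms(1) in simp)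
  ultimately have "w = take i w @ [x] @ rev c @ [x, \<not> x] @ c @ [\<not> x] @ drop (i + (2 * j + 4)) w"
    by (metis append.assoc)
  then show ?thesis unfolding unbalanced_def by blast
qed

lemma crossing_I3: "i + 2 < length w \<Longrightarrow> w ! i = s \<Longrightarrow> w ! (i + 1) = s \<Longrightarrow> w ! (i + 2) = s \<Longrightarrow> crossing w"
proof -
  assume a: "i + 2 < length w" "w ! i = s" "w ! (i + 1) = s" "w ! (i + 2) = s"
  have "map (\<lambda>k. w ! (i + k)) [0..<3] = [s, s, s]"
    using a by (simp add: upt_rec numeral_eq_Suc)
  moreover have "w = take i w @ map (\<lambda>k. w ! (i + k)) [0..<3] @ drop (i + 3) w"
    by (rule list_split_at) (use a in simp)
  ultimately show "crossing w" unfolding crossing_def by metis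
qed

lemma crossing_I:
  assumes "i + 2 * j + 5 < length w" "w ! i = s" "w ! (i + j + 1) = (\<not> s)" "w ! (i + j + 2) = s"
    "w ! (i + j + 3) = s" "w ! (i + j + 4) = (\<not> s)" "w ! (i + 2 * j + 5) = s"
    "\<And>k. k < j \<Longrightarrow> w ! (i + 1 + k) \<noteq> w ! (i + 2 * j + 4 - k)"
  shows "crossing w"
proof -
  define d where "d = map (\<lambda>k. w ! (i + j + 5 + k)) [0..<j]"
  have "map (\<lambda>k. w ! (i + k)) [0..<2 * j + 6] =
      [s] @ rev (map Not d) @ [\<not> s, s, s, \<not> s] @ d @ [s]"
  proof (rule nth_equalityI, goal_cases)
    case 1 then show ?case by (simp add: d_def)
  next
    case (2 k)
    then have k: "k < 2 * j + 6" by simp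
    have lc: "length d = j" by (simp add: d_def)
    consider "k = 0" | "1 \<le> k" "k < j + 1" | "k = j + 1" | "k = j + 2" | "k = j + 3" | "k = j + 4"
      | "j + 5 \<le> k" "k < 2 * j + 5" | "k = 2 * j + 5"
      using k by linarith
    then show ?case
    proof cases
      case 2
      then obtain m where m: "k = Suc m" "m < j" by (cases k) auto
      have "i + j + 5 + (j - Suc m) = i + 2 * j + 4 - m" using m by simp
      then show ?thesis using m assms(8)[of m] k lc by (simp add: nth_append rev_nth d_def)
    next
      case 7
      define m where "m = k - (j + 5)"
      have m: "k = j + 5 + m" "m < j" using 7 by (simp_all add: m_def)
      show ?thesis using m(2) lc unfolding m(1) by (simp add: nth_append d_def add.assoc)
    next
      case 1 then show ?thesis using assms(2) by simp
    next
      case 3 then show ?thesis using assms(3) lc by (simp add: nth_append)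
    next
      case 4 then show ?thesis using assms(4) lc by (simp add: nth_append)
    next
      case 5
      have "([s] @ rev (map Not d) @ [\<not> s, s, s, \<not> s] @ d @ [s]) ! k = w ! (i + k)"
        using assms(5) lc 5 by (simp add: nth_append nth_Cons eval_nat_numeral)
      then show ?thesis using k by simp
    next
      case 6
      have "([s] @ rev (map Not d) @ [\<not> s, s, s, \<not> s] @ d @ [s]) ! k = w ! (i + k)"
        using assms(6) lc 6 by (simp add: nth_append nth_Cons eval_nat_numeral)
      then show ?thesis using k by simp
    next
      case 8 then show ?thesis using assms(7) lc by (simp add: nth_append add.assoc)
    qed
  qed
  moreover have "w = take i w @ map (\<lambda>k. w ! (i + k)) [0..<2 * j + 6] @ drop (i + (2 * j + 6)) w"
    by (rule list_split_at) (use assms(1) in simp)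
  ultimately have "w = take i w @ [s] @ rev (map Not d) @ [\<not> s, s, s, \<not> s] @ d @ [s] @ drop (i + (2 * j + 6)) w"
    by (metis append.assoc)
  then show ?thesis unfolding crossing_def by blast
qed

text \<open>Reversal keeps \<open>c\<close> and exchanges \<open>x\<close> with
  \<open>\<not> x\<close>. Every statement about what follows a pair of twins thereby yields one
  about what precedes it.\<close>

lemma unbalanced_rev: "unbalanced (rev w) \<longleftrightarrow> unbalanced w"
proof -
  have *: "unbalanced w \<Longrightarrow> unbalanced (rev w)" for w
  proof -
    assume "unbalanced w"
    then obtain u x c v where "w = u @ [x] @ rev c @ [x, \<not> x] @ c @ [\<not> x] @ v" unfolding unbalanced_def by blast
    then have "rev w = rev v @ [\<not> x] @ rev c @ [\<not> x, \<not> \<not> x] @ c @ [\<not> \<not> x] @ rev u" by simp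
    then show ?thesis unfolding unbalanced_def by blast
  qed
  show ?thesis using *[of w] *[of "rev w"] by auto
qed

lemma crossing_rev: "crossing (rev w) \<longleftrightarrow> crossing w"
proof -
  have *: "crossing w \<Longrightarrow> crossing (rev w)" for w
  proof -
    assume "crossing w"
    then obtain u s d v where "w = u @ [s, s, s] @ v \<or>
       w = u @ [s] @ rev (map Not d) @ [\<not> s, s, s, \<not> s] @ d @ [s] @ v" unfolding crossing_def by blast
    then have "rev w = rev v @ [s, s, s] @ rev u \<or>
      rev w = rev v @ [s] @ rev (map Not (map Not d)) @ [\<not> s, s, s, \<not> s] @ map Not d @ [s] @ rev u"
      by (auto simp: rev_map o_def)
    then show ?thesis unfolding crossing_def by blast
  qed
  show ?thesis using *[of w] *[of "rev w"] by auto
qed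

lemma twin_rev: "twin (rev w) r \<longleftrightarrow> r + 2 \<le> length w \<and> twin w (length w - 2 - r)"
proof (cases "Suc r < length w")
  case True
  then obtain k where k: "length w = Suc (Suc r) + k" by (metis Suc_leI le_Suc_ex)
  have "rev w ! r = w ! Suc k" "rev w ! Suc r = w ! k" using k by (simp_all add: rev_nth)
  then show ?thesis using k by (auto simp: twin_def)
qed (auto simp: twin_def)

lemma alternating:
  assumes "\<And>m. a \<le> m \<Longrightarrow> m < b \<Longrightarrow> \<not> twin w m" "b < length w" "a \<le> m" "m \<le> b"
  shows "w ! m = (w ! a = even (m - a))"
  using assms(3,4)
proof (induction m rule: dec_induct)
  case (step m)
  then have "\<not> twin w m" using assms(1) by auto
  then have "w ! Suc m \<noteq> w ! m" using step assms(2) by (auto simp: twin_def)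
  then show ?case using step by (auto simp: Suc_diff_le)
qed simp

text \<open>Consecutive twins \<open>r1 < r2 < r3\<close> with different letters at \<open>r1\<close> and \<open>r2\<close>: either the change
  of letter just before \<open>r2\<close> or the one just after it is the centre of a mirror pattern.\<close>

lemma unbalanced_triple:
  assumes "r1 < r2" "r2 < r3" "twin w r1" "twin w r2" "twin w r3"
    and n12: "\<And>m. r1 < m \<Longrightarrow> m < r2 \<Longrightarrow> \<not> twin w m"
    and n23: "\<And>m. r2 < m \<Longrightarrow> m < r3 \<Longrightarrow> \<not> twin w m"
    and ne: "w ! r1 \<noteq> w ! r2"
  shows "unbalanced w"
proof -
  define a where "a = w ! r1"
  have len: "Suc r3 < length w" using assms(5) by (simp add: twin_def)
  have a1: "w ! (r1 + 1) = a" using assms(3) by (simp add: a_def twin_def)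
  have A: "w ! (r1 + 1 + k) = (a = even k)" if "r1 + 1 + k \<le> r2" for k
    using alternating[of "r1 + 1" r2 w "r1 + 1 + k"] that n12 len assms(2) a1 by auto
  have b1: "w ! (r2 + 1) = (\<not> a)" "w ! r2 = (\<not> a)" using assms(4) ne by (auto simp: a_def twin_def)
  have B: "w ! (r2 + 1 + k) = (a \<noteq> even k)" if "r2 + 1 + k \<le> r3" for k
    using alternating[of "r2 + 1" r3 w "r2 + 1 + k"] that n23 len b1 by auto
  \<comment> \<open>The alternating run from \<open>r1 + 1\<close> to \<open>r2\<close> begins with
    \<open>a\<close> and ends with \<open>\<not> a\<close>, so its even length is
    \<open>2 * m + 2\<close>.\<close>
  have "odd (r2 - r1 - 1)" using A[of "r2 - r1 - 1"] b1 assms(1) by auto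
  then obtain m where "r2 - r1 - 1 = 2 * m + 1" by (rule oddE)
  then have r2: "r2 = r1 + 2 * m + 2" by linarith
  define h where "h = r3 - r2"
  have r3: "r3 = r2 + h" "h \<ge> 1" using assms by (auto simp: h_def)
  have c1: "w ! (r3 + 1) = (a \<noteq> odd h)"
    using B[of "h - 1"] assms(5) r3 by (auto simp: twin_def)
  \<comment> \<open>The mirror extends until the nearer of the outer twins breaks the alternation.
    If \<open>r3\<close> is far, the pattern is centred just before \<open>r2\<close> and closed on
    the left by \<open>r1\<close>; if \<open>r3\<close> is near and \<open>h\<close> is odd, it has
    the same centre and is closed on the right by \<open>r3\<close>. For \<open>h\<close> even the
    letters at that end would agree, and the centre moves to the change just after
    \<open>r2\<close>.\<close>
  consider "h \<ge> 2 * m + 1" | e where "h = 2 * e + 1" "e < m" | e where "h = 2 * e + 2" "e < m"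
  proof -
    have "h - 1 = 2 * ((h - 1) div 2) \<or> h - 1 = 2 * ((h - 1) div 2) + 1" by linarith
    then have "h \<ge> 2 * m + 1 \<or> (h = 2 * ((h - 1) div 2) + 1 \<and> (h - 1) div 2 < m) \<or>
        (h = 2 * ((h - 1) div 2) + 2 \<and> (h - 1) div 2 < m)"
      using r3(2) by linarith
    then show ?thesis using that by blast
  qed
  then show ?thesis
  proof cases
    case 1
    show ?thesis
    proof (rule unbalanced_I[of r1 "2 * m" w a])
      show "r1 + 2 * (2 * m) + 3 < length w" using 1 len r2 r3 by linarith
      show "w ! r1 = a" by (simp add: a_def)
      show "w ! (r1 + 2 * m + 1) = a" using A[of "2 * m"] r2 by (simp add: add_ac)
      show "w ! (r1 + 2 * m + 2) = (\<not> a)" using b1 r2 by simp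
      have eq: "r1 + 2 * (2 * m) + 3 = r2 + 1 + 2 * m" using r2 by linarith
      show "w ! (r1 + 2 * (2 * m) + 3) = (\<not> a)" unfolding eq using B[of "2 * m"] 1 r3 by simp
      fix k assume k: "k < 2 * m"
      have i: "r1 + 2 * (2 * m) + 2 - k = r2 + 1 + (2 * m - 1 - k)" using r2 k by linarith
      have "w ! (r1 + 1 + k) = (a = even k)" using A[of k] k r2 by simp
      moreover have "w ! (r2 + 1 + (2 * m - 1 - k)) = (a \<noteq> even (2 * m - 1 - k))"
        by (rule B) (use k 1 r3 in linarith)
      moreover have "even (2 * m - 1 - k) = odd k" using k by presburger
      ultimately show "w ! (r1 + 1 + k) = w ! (r1 + 2 * (2 * m) + 2 - k)" unfolding i by blast
    qed
  next
    case (2 e)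
    define f where "f = m - e - 1"
    have m: "m = e + 1 + f" using \<open>e < m\<close> by (simp add: f_def)
    have h: "h = 2 * e + 1" using 2 by simp
    let ?i = "r1 + 1 + 2 * f"
    show ?thesis
    proof (rule unbalanced_I[of ?i "2 * e + 1" w a])
      show "?i + 2 * (2 * e + 1) + 3 < length w" using r2 r3 m h len by simp
      show "w ! (?i) = a" using A[of "2 * f"] r2 m by simp
      have eq: "?i + (2 * e + 1) + 1 = r1 + 1 + 2 * m" using m by linarith
      show "w ! (?i + (2 * e + 1) + 1) = a" unfolding eq using A[of "2 * m"] r2 by simp
      have eq: "?i + (2 * e + 1) + 2 = r2" using r2 m by linarith
      show "w ! (?i + (2 * e + 1) + 2) = (\<not> a)" unfolding eq using b1 by simp
      have eq: "?i + 2 * (2 * e + 1) + 3 = r3 + 1" using r2 r3 h m by simp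
      show "w ! (?i + 2 * (2 * e + 1) + 3) = (\<not> a)" unfolding eq using c1 h by simp
      fix k assume k: "k < 2 * e + 1"
      have i: "?i + 1 + k = r1 + 1 + (2 * f + 1 + k)"
        "?i + 2 * (2 * e + 1) + 2 - k = r2 + 1 + (2 * e - k)" using r2 k m by auto
      have "w ! (r1 + 1 + (2 * f + 1 + k)) = (a = even (2 * f + 1 + k))"
        by (rule A) (use k r2 m in simp)
      moreover have "w ! (r2 + 1 + (2 * e - k)) = (a \<noteq> even (2 * e - k))"
        by (rule B) (use k h r3 in simp)
      moreover have "even (2 * e - k) = even k" "even (2 * f + 1 + k) = odd k" using k by presburger+
      ultimately show "w ! (?i + 1 + k) = w ! (?i + 2 * (2 * e + 1) + 2 - k)"
        unfolding i by blast
    qed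
  next
    case (3 e)
    define f where "f = m - e - 1"
    have m: "m = e + 1 + f" using \<open>e < m\<close> by (simp add: f_def)
    have h: "h = 2 * e + 2" using 3 by simp
    let ?i = "r1 + 1 + (2 * f + 3)"
    show ?thesis
    proof (rule unbalanced_I[of ?i "2 * e" w "\<not> a"])
      show "?i + 2 * (2 * e) + 3 < length w" using r2 r3 m h len by simp
      show "w ! (?i) = (\<not> a)" using A[of "2 * f + 3"] r2 m by simp
      have eq: "?i + 2 * e + 1 = r2 + 1" using r2 m by linarith
      show "w ! (?i + 2 * e + 1) = (\<not> a)" unfolding eq using b1 by simp
      have eq: "?i + 2 * e + 2 = r2 + 1 + 1" using r2 m by linarith
      show "w ! (?i + 2 * e + 2) = (\<not> \<not> a)" unfolding eq using B[of 1] r3 h by simp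
      have eq: "?i + 2 * (2 * e) + 3 = r3 + 1" using r2 r3 h m by simp
      show "w ! (?i + 2 * (2 * e) + 3) = (\<not> \<not> a)" unfolding eq using c1 h by simp
      fix k assume k: "k < 2 * e"
      have i: "?i + 1 + k = r1 + 1 + (2 * f + 4 + k)"
        "?i + 2 * (2 * e) + 2 - k = r2 + 1 + (2 * e + 1 - k)" using r2 k m by auto
      have "w ! (r1 + 1 + (2 * f + 4 + k)) = (a = even (2 * f + 4 + k))"
        by (rule A) (use k r2 m in simp)
      moreover have "w ! (r2 + 1 + (2 * e + 1 - k)) = (a \<noteq> even (2 * e + 1 - k))"
        by (rule B) (use k h r3 in simp)
      moreover have "even (2 * e + 1 - k) = odd k" "even (2 * f + 4 + k) = even k" using k by presburger+
      ultimately show "w ! (?i + 1 + k) = w ! (?i + 2 * (2 * e) + 2 - k)"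
        unfolding i by blast
    qed
  qed
qed

text \<open>An odd gap means that the twins at \<open>r1\<close> and \<open>r2\<close> repeat the
  same letter \<open>s\<close>. The double at \<open>r2\<close> or the one at \<open>r3\<close> is
  then the centre of a mirror pattern, which an outer twin closes, unless three equal letters
  occur.\<close>

lemma crossing_quadruple:
  assumes "r1 < r2" "r2 < r3" "r3 < r4" "twin w r1" "twin w r2" "twin w r3" "twin w r4"
    and n12: "\<And>m. r1 < m \<Longrightarrow> m < r2 \<Longrightarrow> \<not> twin w m"
    and n23: "\<And>m. r2 < m \<Longrightarrow> m < r3 \<Longrightarrow> \<not> twin w m"
    and n34: "\<And>m. r3 < m \<Longrightarrow> m < r4 \<Longrightarrow> \<not> twin w m"
    and ne: "odd (r2 - r1)"
  shows "crossing w"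
proof -
  define s where "s = w ! r1"
  have len: "r4 + 1 < length w" using assms(7) by (simp add: twin_def)
  have s1: "w ! (r1 + 1) = s" using assms(4) by (simp add: s_def twin_def)
  obtain m where "r2 - r1 = 2 * m + 1" using ne by (rule oddE)
  then have r2: "r2 = r1 + 2 * m + 1" using assms(1) by linarith
  have A: "w ! (r1 + 1 + k) = (s = even k)" if "r1 + 1 + k \<le> r2" for k
    using alternating[of "r1 + 1" r2 w "r1 + 1 + k"] that n12 len assms(2,3) s1 by auto
  have s2: "w ! r2 = s" "w ! (r2 + 1) = s" using assms(5) A[of "2 * m"] r2 by (simp_all add: twin_def)
  have B: "w ! (r2 + 1 + k) = (s = even k)" if "r2 + 1 + k \<le> r3" for k
    using alternating[of "r2 + 1" r3 w "r2 + 1 + k"] that n23 len s2 assms(3) by auto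
  show ?thesis
  proof (cases "m = 0 \<or> r3 = r2 + 1")
    case True
    then show ?thesis
    proof
      assume "m = 0"
      then have eq: "r1 + 2 = r2 + 1" using r2 by simp
      show ?thesis
      proof (rule crossing_I3[of r1 w s])
        show "r1 + 2 < length w" unfolding eq using len assms(2,3) by simp
        show "w ! (r1 + 2) = s" unfolding eq by (rule s2)
      qed (use s1 in \<open>simp_all add: s_def\<close>)
    next
      assume "r3 = r2 + 1"
      then have "w ! (r2 + 2) = w ! (r2 + 1)" using assms(6) by (simp add: twin_def)
      then show ?thesis using crossing_I3[of r2 w s] s2 len assms(2,3) \<open>r3 = r2 + 1\<close> by simp
    qed
  next
    case False
    then have m: "m \<ge> 1" and r32: "r3 \<ge> r2 + 2" using assms(2) by linarith+
    show ?thesis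
    \<comment> \<open>If \<open>r3\<close> is further away, the double at \<open>r2\<close> is
      flanked on both sides by \<open>\<not> s\<close> and then \<open>s\<close>, which is the
      pattern with empty \<open>d\<close>. Otherwise \<open>s, s\<close> is followed at once by
      \<open>\<not> s, \<not> s\<close>.\<close>
    proof (cases "r3 = r2 + 2")
      case False
      define n where "n = r2 - 2"
      have n: "n = r1 + 1 + (2 * m - 2)" "n + 1 = r1 + 1 + (2 * m - 1)" "r2 = n + 2" using r2 m by (simp_all add: n_def)
      show ?thesis
      proof (rule crossing_I[of n 0 w s])
        show "n + 2 * 0 + 5 < length w" using n(3) r32 False len assms(3) by simp
        show "w ! n = s" unfolding n(1) using A[of "2 * m - 2"] r2 m by simp
        have eq: "n + 0 + 1 = r1 + 1 + (2 * m - 1)" using n(2) by simp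
        show "w ! (n + 0 + 1) = (\<not> s)" unfolding eq using A[of "2 * m - 1"] r2 m by simp
        have eq: "n + 0 + 2 = r2" using n by simp
        show "w ! (n + 0 + 2) = s" unfolding eq by (rule s2)
        have eq: "n + 0 + 3 = r2 + 1" using n by simp
        show "w ! (n + 0 + 3) = s" unfolding eq by (rule s2)
        have eq: "n + 0 + 4 = r2 + 1 + 1" using n by simp
        show "w ! (n + 0 + 4) = (\<not> s)" unfolding eq using B[of 1] r32 by simp
        have eq: "n + 2 * 0 + 5 = r2 + 1 + 2" using n by simp
        show "w ! (n + 2 * 0 + 5) = s" unfolding eq using B[of 2] r32 False by simp
      qed simp
    next
      case True
      then have r3: "r3 = r1 + 2 * m + 3" using r2 by simp
      have t: "w ! r3 = (\<not> s)" "w ! (r3 + 1) = (\<not> s)"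
        using B[of 1] assms(6) True by (simp_all add: twin_def)
      have C: "w ! (r3 + 1 + k) = (s = odd k)" if "r3 + 1 + k \<le> r4" for k
        using alternating[of "r3 + 1" r4 w "r3 + 1 + k"] that n34 len t by auto
      define l where "l = r4 - r3"
      have r4: "r4 = r3 + l" "l \<ge> 1" using assms by (auto simp: l_def)
      have c1: "w ! (r4 + 1) = (s = even l)"
        using C[of "l - 1"] assms(7) r4 by (auto simp: twin_def)
      \<comment> \<open>The gap \<open>l\<close> after \<open>r3\<close> competes with the run
        between \<open>r1\<close> and \<open>r2\<close>. The centre is the double at
        \<open>r2\<close>, closed by \<open>r1\<close> if \<open>l\<close> is large and by
        \<open>r4\<close> if \<open>l\<close> is small and even; for small odd \<open>l > 1\<close>
        the double at \<open>r3\<close> takes over, with \<open>s\<close> negated.\<close>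
      consider "l \<ge> 2 * m" | "l = 1" | e where "l = 2 * e" "e < m" "e \<ge> 1" | e where "l = 2 * e + 1" "e < m" "e \<ge> 1"
      proof -
        have "l = 2 * (l div 2) \<or> l = 2 * (l div 2) + 1" by linarith
        then have "l \<ge> 2 * m \<or> l = 1 \<or> (l = 2 * (l div 2) \<and> l div 2 < m \<and> l div 2 \<ge> 1) \<or>
            (l = 2 * (l div 2) + 1 \<and> l div 2 < m \<and> l div 2 \<ge> 1)"
          using r4(2) by linarith
        then show ?thesis using that by blast
      qed
      then show ?thesis
      proof cases
        case 1
        have le: "2 * (2 * m - 1) = 4 * m - 2" using m by simp
        show ?thesis
        proof (rule crossing_I[of r1 "2 * m - 1" w s])
          show "r1 + 2 * (2 * m - 1) + 5 < length w" unfolding le using 1 len r3 r4 m by simp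
          show "w ! r1 = s" by (simp add: s_def)
          have eq: "r1 + (2 * m - 1) + 1 = r1 + 1 + (2 * m - 1)" by simp
          show "w ! (r1 + (2 * m - 1) + 1) = (\<not> s)" unfolding eq using A[of "2 * m - 1"] r2 m by simp
          have eq: "r1 + (2 * m - 1) + 2 = r2" using r2 m by simp
          show "w ! (r1 + (2 * m - 1) + 2) = s" unfolding eq using s2 by simp
          have eq: "r1 + (2 * m - 1) + 3 = r2 + 1" using r2 m by simp
          show "w ! (r1 + (2 * m - 1) + 3) = s" unfolding eq using s2 by simp
          have eq: "r1 + (2 * m - 1) + 4 = r3" using r3 m by simp
          show "w ! (r1 + (2 * m - 1) + 4) = (\<not> s)" unfolding eq using t by simp
          have eq: "r1 + 2 * (2 * m - 1) + 5 = r3 + 1 + (2 * m - 1)" unfolding le using r3 m by simp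
          show "w ! (r1 + 2 * (2 * m - 1) + 5) = s" unfolding eq using C[of "2 * m - 1"] 1 r4 m by simp
          fix k assume k: "k < 2 * m - 1"
          have i: "r1 + 2 * (2 * m - 1) + 4 - k = r3 + 1 + (2 * m - 2 - k)" unfolding le using r3 k by simp
          have "w ! (r1 + 1 + k) = (s = even k)" by (rule A) (use k r2 in simp)
          moreover have "w ! (r3 + 1 + (2 * m - 2 - k)) = (s = odd (2 * m - 2 - k))"
            by (rule C) (use k 1 r4 in simp)
          moreover have "odd (2 * m - 2 - k) = odd k" using k by presburger
          ultimately show "w ! (r1 + 1 + k) \<noteq> w ! (r1 + 2 * (2 * m - 1) + 4 - k)" unfolding i by blast
        qed
      next
        case 2
        then have "w ! (r3 + 2) = (\<not> s)" using c1 r4 by simp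
        then show ?thesis using crossing_I3[of r3 w "\<not> s"] t r4 len 2 by simp
      next
        case (3 e)
        define f where "f = m - e - 1"
        have m: "m = e + 1 + f" using \<open>e < m\<close> by (simp add: f_def)
        have l: "l = 2 * e" using 3 by simp
        let ?i = "r1 + 1 + 2 * f"
        show ?thesis
        proof (rule crossing_I[of ?i "2 * e" w s])
          show "?i + 2 * (2 * e) + 5 < length w" using l len r3 r4 m by simp
          show "w ! (?i) = s" using A[of "2 * f"] r2 m by simp
          have eq: "?i + 2 * e + 1 = r1 + 1 + (2 * f + 2 * e + 1)" by simp
          show "w ! (?i + 2 * e + 1) = (\<not> s)" unfolding eq using A[of "2 * f + 2 * e + 1"] r2 m by simp
          have eq: "?i + 2 * e + 2 = r2" using r2 m by simp
          show "w ! (?i + 2 * e + 2) = s" unfolding eq using s2 by simp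
          have eq: "?i + 2 * e + 3 = r2 + 1" using r2 m by simp
          show "w ! (?i + 2 * e + 3) = s" unfolding eq using s2 by simp
          have eq: "?i + 2 * e + 4 = r3" using r3 m by simp
          show "w ! (?i + 2 * e + 4) = (\<not> s)" unfolding eq using t by simp
          have eq: "?i + 2 * (2 * e) + 5 = r4 + 1" using r3 r4 l m by simp
          show "w ! (?i + 2 * (2 * e) + 5) = s" unfolding eq using c1 l by simp
          fix k assume k: "k < 2 * e"
          have i: "?i + 1 + k = r1 + 1 + (2 * f + 1 + k)"
            "?i + 2 * (2 * e) + 4 - k = r3 + 1 + (2 * e - 1 - k)" using r3 m k by auto
          have "w ! (r1 + 1 + (2 * f + 1 + k)) = (s = even (2 * f + 1 + k))" by (rule A) (use k r2 m in simp)
          moreover have "w ! (r3 + 1 + (2 * e - 1 - k)) = (s = odd (2 * e - 1 - k))"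
            by (rule C) (use k l r4 in simp)
          moreover have "odd (2 * e - 1 - k) = even k" "even (2 * f + 1 + k) = odd k" using k by presburger+
          ultimately show "w ! (?i + 1 + k) \<noteq> w ! (?i + 2 * (2 * e) + 4 - k)"
            unfolding i by blast
        qed
      next
        case (4 e)
        define f where "f = m - e - 1"
        have m: "m = e + 1 + f" using \<open>e < m\<close> by (simp add: f_def)
        have l: "l = 2 * e + 1" and e: "e \<ge> 1" using 4 by simp_all
        have le: "2 * (2 * e - 1) = 4 * e - 2" using e by simp
        let ?i = "r1 + 1 + (2 * f + 3)"
        show ?thesis
        proof (rule crossing_I[of ?i "2 * e - 1" w "\<not> s"])
          show "?i + 2 * (2 * e - 1) + 5 < length w" unfolding le using e l len r3 r4 m by simp
          show "w ! (?i) = (\<not> s)" using A[of "2 * f + 3"] r2 m e by simp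
          have eq: "?i + (2 * e - 1) + 1 = r2 + 1" using r2 m e by simp
          show "w ! (?i + (2 * e - 1) + 1) = (\<not> \<not> s)" unfolding eq using s2 by simp
          have eq: "?i + (2 * e - 1) + 2 = r3" using r3 m e by simp
          show "w ! (?i + (2 * e - 1) + 2) = (\<not> s)" unfolding eq using t by simp
          have eq: "?i + (2 * e - 1) + 3 = r3 + 1" using r3 m e by simp
          show "w ! (?i + (2 * e - 1) + 3) = (\<not> s)" unfolding eq using t by simp
          have eq: "?i + (2 * e - 1) + 4 = r3 + 1 + 1" using r3 m e by simp
          show "w ! (?i + (2 * e - 1) + 4) = (\<not> \<not> s)" unfolding eq using C[of 1] l e r4 by simp
          have eq: "?i + 2 * (2 * e - 1) + 5 = r4 + 1" unfolding le using r3 r4 l m e by simp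
          show "w ! (?i + 2 * (2 * e - 1) + 5) = (\<not> s)" unfolding eq using c1 l by simp
          fix k assume k: "k < 2 * e - 1"
          have i: "?i + 1 + k = r1 + 1 + (2 * f + 4 + k)"
            "?i + 2 * (2 * e - 1) + 4 - k = r3 + 1 + (2 * e - k)" unfolding le using r3 m k by auto
          have "w ! (r1 + 1 + (2 * f + 4 + k)) = (s = even (2 * f + 4 + k))" by (rule A) (use k r2 m in simp)
          moreover have "w ! (r3 + 1 + (2 * e - k)) = (s = odd (2 * e - k))"
            by (rule C) (use k l r4 in simp)
          moreover have "odd (2 * e - k) = odd k" "even (2 * f + 4 + k) = even k" using k by presburger+
          ultimately show "w ! (?i + 1 + k) \<noteq> w ! (?i + 2 * (2 * e - 1) + 4 - k)"
            unfolding i by blast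
        qed
      qed
    qed
  qed
qed

lemma unbalanced_triple_rev:
  assumes "r1 < r2" "r2 < r3" "twin w r1" "twin w r2" "twin w r3"
    and n12: "\<And>m. r1 < m \<Longrightarrow> m < r2 \<Longrightarrow> \<not> twin w m"
    and n23: "\<And>m. r2 < m \<Longrightarrow> m < r3 \<Longrightarrow> \<not> twin w m"
    and ne: "w ! r2 \<noteq> w ! r3"
  shows "unbalanced w"
proof -
  define n where "n = length w - 2"
  have l: "length w = n + 2" "r3 \<le> n" using assms(5) by (auto simp: twin_def n_def)
  have d: "twin (rev w) r \<longleftrightarrow> r \<le> n \<and> twin w (n - r)" for r using twin_rev[of w r] l by auto
  have nth: "rev w ! (n - r) = w ! Suc r" if "r \<le> n" for r
    using that l by (simp add: rev_nth Suc_diff_le)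
  have "unbalanced (rev w)"
  proof (rule unbalanced_triple[of "n - r3" "n - r2" "n - r1"])
    show "rev w ! (n - r3) \<noteq> rev w ! (n - r2)" using nth assms(2,4,5) ne l by (simp add: twin_def)
    fix m assume "n - r3 < m" "m < n - r2"
    then show "\<not> twin (rev w) m" using n23[of "n - m"] d l by auto
  next
    fix m assume "n - r2 < m" "m < n - r1"
    then show "\<not> twin (rev w) m" using n12[of "n - m"] d l assms(2) by auto
  qed (use assms(1-5) l d in auto)
  then show ?thesis by (simp add: unbalanced_rev)
qed

lemma crossing_quadruple_rev:
  assumes "r1 < r2" "r2 < r3" "r3 < r4" "twin w r1" "twin w r2" "twin w r3" "twin w r4"
    and n12: "\<And>m. r1 < m \<Longrightarrow> m < r2 \<Longrightarrow> \<not> twin w m"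
    and n23: "\<And>m. r2 < m \<Longrightarrow> m < r3 \<Longrightarrow> \<not> twin w m"
    and n34: "\<And>m. r3 < m \<Longrightarrow> m < r4 \<Longrightarrow> \<not> twin w m"
    and ne: "odd (r4 - r3)"
  shows "crossing w"
proof -
  define n where "n = length w - 2"
  have l: "length w = n + 2" "r4 \<le> n" using assms(7) by (auto simp: twin_def n_def)
  have d: "twin (rev w) r \<longleftrightarrow> r \<le> n \<and> twin w (n - r)" for r using twin_rev[of w r] l by auto
  have "crossing (rev w)"
  proof (rule crossing_quadruple[of "n - r4" "n - r3" "n - r2" "n - r1"])
    have "n - r3 - (n - r4) = r4 - r3" using l assms(3) by auto
    then show "odd (n - r3 - (n - r4))" using ne by simp
    fix m assume "n - r3 < m" "m < n - r2"
    then show "\<not> twin (rev w) m" using n23[of "n - m"] d l assms(3) by auto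
  next
    fix m assume "n - r2 < m" "m < n - r1"
    then show "\<not> twin (rev w) m" using n12[of "n - m"] d l assms(2,3) by auto
  next
    fix m assume "n - r4 < m" "m < n - r3"
    then show "\<not> twin (rev w) m" using n34[of "n - m"] d l by auto
  qed (use assms(1-7) l d in auto)
  then show ?thesis by (simp add: crossing_rev)
qed

lemma consecutive_differ:
  fixes r r' :: nat
  assumes "D r" "D r'" "r < r'" "f r \<noteq> f r'"
  shows "\<exists>r1 r2. r1 < r2 \<and> D r1 \<and> D r2 \<and> f r1 \<noteq> f r2 \<and> (\<forall>m. r1 < m \<and> m < r2 \<longrightarrow> \<not> D m)"
  using assms
proof (induction "r' - r" arbitrary: r r' rule: less_induct)
  case less
  show ?case
  proof (cases "\<exists>m. r < m \<and> m < r' \<and> D m")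
    case True
    then obtain m where m: "r < m" "m < r'" "D m" by blast
    then show ?thesis
      using less.hyps[of m r] less.hyps[of r' m] less.prems by (cases "f m = f r") auto
  qed (use less.prems in blast)
qed

lemma next_element:
  fixes r r' :: nat
  assumes "D r'" "r < r'"
  shows "\<exists>m>r. D m \<and> (\<forall>k. r < k \<and> k < m \<longrightarrow> \<not> D k)"
proof -
  define m where "m = (LEAST k. r < k \<and> D k)"
  have "r < m \<and> D m" unfolding m_def by (rule LeastI) (use assms in blast)
  moreover have "\<not> D k" if "r < k" "k < m" for k using not_less_Least that unfolding m_def by blast
  ultimately show ?thesis by blast
qed

lemma previous_element:
  fixes r r' :: nat
  assumes "D r'" "r' < r"
  shows "\<exists>m<r. D m \<and> (\<forall>k. m < k \<and> k < r \<longrightarrow> \<not> D k)"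
proof -
  obtain m where m: "m < r \<and> D m" "\<And>k. k < r \<and> D k \<Longrightarrow> k \<le> m"
    using ex_has_greatest_nat[of "\<lambda>k. k < r \<and> D k" r' "\<lambda>x. x" r] assms by auto
  then show ?thesis using leD by blast
qed

text \<open>Two consecutive twins with different letters tolerate no neighbouring twin on either
  side, so in that case they are the only twins of \<open>w\<close>.\<close>

lemma balanced_structure:
  assumes "\<not> unbalanced w"
  shows "(\<exists>x. \<forall>r. twin w r \<longrightarrow> w ! r = x) \<or> card {r. twin w r} \<le> 2"
proof (rule disjCI)
  assume "\<not> card {r. twin w r} \<le> 2"
  show "\<exists>x. \<forall>r. twin w r \<longrightarrow> w ! r = x"
  proof (rule ccontr)
    assume "\<not> ?thesis"
    then obtain a b where "twin w a" "twin w b" "w ! a \<noteq> w ! b" by blast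
    then have "\<exists>a b. a < b \<and> twin w a \<and> twin w b \<and> w ! a \<noteq> w ! b"
      by (metis linorder_neqE_nat)
    then obtain a b where "a < b" "twin w a" "twin w b" "w ! a \<noteq> w ! b" by blast
    from consecutive_differ[of "twin w", OF this(2,3,1,4)] obtain r1 r2 where r: "r1 < r2" "twin w r1"
      "twin w r2" "w ! r1 \<noteq> w ! r2" "\<And>m. r1 < m \<Longrightarrow> m < r2 \<Longrightarrow> \<not> twin w m" by blast
    have "\<not> twin w m" if gt: "r2 < m" for m
    proof
      assume "twin w m"
      then obtain r3 where r3x: "r2 < r3" "twin w r3" "\<forall>k. r2 < k \<and> k < r3 \<longrightarrow> \<not> twin w k"
        using next_element[of "twin w" m r2] gt by blast
      then show False using unbalanced_triple[of r1 r2 r3 w] r r3x assms by metis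
    qed
    moreover have "\<not> twin w m" if gt: "m < r1" for m
    proof
      assume "twin w m"
      then obtain r0 where r0x: "r0 < r1" "twin w r0" "\<forall>k. r0 < k \<and> k < r1 \<longrightarrow> \<not> twin w k"
        using previous_element[of "twin w" m r1] gt by blast
      then show False using unbalanced_triple_rev[of r0 r1 r2 w] r r0x assms by metis
    qed
    ultimately have "{r. twin w r} \<subseteq> {r1, r2}" using r(5) by (metis insertCI linorder_neqE_nat mem_Collect_eq subsetI)
    then have "card {r. twin w r} \<le> card {r1, r2}" by (intro card_mono) auto
    also have "\<dots> \<le> 2" by (simp add: card_insert_if)
    finally show False using \<open>\<not> card {r. twin w r} \<le> 2\<close> by simp
  qed
qed

text \<open>Two consecutive twins at odd distance tolerate at most one further twin on either side,
  which gives the exceptional bound 2 + 1 + 1.\<close>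

lemma noncrossing_structure:
  assumes "\<not> crossing w"
  shows "(\<exists>e. \<forall>r. twin w r \<longrightarrow> even r = e) \<or> card {r. twin w r} \<le> 4"
proof (rule disjCI)
  assume "\<not> card {r. twin w r} \<le> 4"
  show "\<exists>e. \<forall>r. twin w r \<longrightarrow> even r = e"
  proof (rule ccontr)
    assume "\<not> ?thesis"
    then obtain a b where "twin w a" "twin w b" "even a \<noteq> even b" by blast
    then have "\<exists>a b. a < b \<and> twin w a \<and> twin w b \<and> even a \<noteq> even b"
      by (metis linorder_neqE_nat)
    then obtain a b where "a < b" "twin w a" "twin w b" "even a \<noteq> even b" by blast
    from consecutive_differ[of "twin w", OF this(2,3,1,4)] obtain r1 r2 where r: "r1 < r2" "twin w r1"
      "twin w r2" "even r1 \<noteq> even r2" "\<And>m. r1 < m \<Longrightarrow> m < r2 \<Longrightarrow> \<not> twin w m" by blast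
    have odd: "odd (r2 - r1)" using r(1,4) by simp
    have "\<exists>r3. \<forall>m. r2 < m \<longrightarrow> twin w m \<longrightarrow> m = r3"
    proof (cases "\<exists>m. r2 < m \<and> twin w m")
      case True
      then obtain r3 where r3: "r2 < r3" "twin w r3" "\<forall>k. r2 < k \<and> k < r3 \<longrightarrow> \<not> twin w k"
        using next_element[of "twin w" _ r2] True by blast
      have "\<not> twin w m" if gt: "r3 < m" for m
      proof
        assume "twin w m"
        then obtain r4 where r4x: "r3 < r4" "twin w r4" "\<forall>k. r3 < k \<and> k < r4 \<longrightarrow> \<not> twin w k"
          using next_element[of "twin w" m r3] gt by blast
        then show False using crossing_quadruple[of r1 r2 r3 r4 w] r r3 r4x odd assms by metis
      qed
      then show ?thesis using r3 by (metis linorder_neqE_nat)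
    qed blast
    then obtain r3 where r3: "\<And>m. r2 < m \<Longrightarrow> twin w m \<Longrightarrow> m = r3" by blast
    have "\<exists>r0. \<forall>m. m < r1 \<longrightarrow> twin w m \<longrightarrow> m = r0"
    proof (cases "\<exists>m. m < r1 \<and> twin w m")
      case True
      then obtain r0 where r0: "r0 < r1" "twin w r0" "\<forall>k. r0 < k \<and> k < r1 \<longrightarrow> \<not> twin w k"
        using previous_element[of "twin w" _ r1] True by blast
      have "\<not> twin w m" if gt: "m < r0" for m
      proof
        assume "twin w m"
        then obtain r4 where r4x: "r4 < r0" "twin w r4" "\<forall>k. r4 < k \<and> k < r0 \<longrightarrow> \<not> twin w k"
          using previous_element[of "twin w" m r0] gt by blast
        then show False using crossing_quadruple_rev[of r4 r0 r1 r2 w] r r0 r4x odd assms by metis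
      qed
      then show ?thesis using r0 by (metis linorder_neqE_nat)
    qed blast
    then obtain r0 where r0: "\<And>m. m < r1 \<Longrightarrow> twin w m \<Longrightarrow> m = r0" by blast
    have "{r. twin w r} \<subseteq> {r0, r1, r2, r3}"
      using r(5) r0 r3 by (metis insertCI linorder_neqE_nat mem_Collect_eq subsetI)
    then have "card {r. twin w r} \<le> card {r0, r1, r2, r3}" by (intro card_mono) auto
    also have "\<dots> \<le> 4" by (simp add: card_insert_if)
    finally show False using \<open>\<not> card {r. twin w r} \<le> 4\<close> by simp
  qed
qed

section \<open>Weighted word counts\<close>

definition weight :: "(bool \<Rightarrow> real) \<Rightarrow> bool list \<Rightarrow> real" where
  "weight f w = prod_list (map f w)"

text \<open>For nonnegative weights this is summability over \<open>L\<close>, phrased by finite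
  partial sums so that no enumeration of \<open>L\<close> has to be chosen.\<close>

definition weight_bounded :: "(bool \<Rightarrow> real) \<Rightarrow> bool list set \<Rightarrow> bool" where
  "weight_bounded f L \<longleftrightarrow> (\<exists>C. \<forall>F. finite F \<longrightarrow> F \<subseteq> L \<longrightarrow> sum (weight f) F \<le> C)"

definition set_append :: "bool list set \<Rightarrow> bool list set \<Rightarrow> bool list set" where
  "set_append A B = (\<lambda>(u, v). u @ v) ` (A \<times> B)"

definition alt_words :: "bool list set" where
  "alt_words = {w. \<forall>m. \<not> twin w m}"

text \<open>The exponent counts the junctions: an element of \<open>alt_pow k\<close> has
  \<open>k + 1\<close> alternating factors, and each junction can produce one twin.\<close>

fun alt_pow :: "nat \<Rightarrow> bool list set" where
  "alt_pow 0 = alt_words"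
| "alt_pow (Suc k) = set_append (alt_pow k) alt_words"

definition subst :: "(bool \<Rightarrow> bool list) \<Rightarrow> bool list \<Rightarrow> bool list" where
  "subst h w = concat (map h w)"

lemma weight_simps [simp]: "weight f [] = 1" "weight f (x # w) = f x * weight f w" "weight f (u @ v) = weight f u * weight f v"
  by (simp_all add: weight_def)

lemma weight_nonneg: "(\<And>x. 0 \<le> f x) \<Longrightarrow> 0 \<le> weight f w"
  by (induction w) auto

lemma weight_subst: "weight f (subst h w) = weight (\<lambda>x. weight f (h x)) w"
  by (induction w) (auto simp: subst_def)

lemma subst_simps [simp]: "subst h [] = []" "subst h (x # w) = h x @ subst h w"
    "subst h (u @ v) = subst h u @ subst h v"
  by (simp_all add: subst_def)

lemma weight_const: "weight (\<lambda>_. r) w = r ^ length w"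
  by (induction w) auto

lemma weight_bounded_subset: "weight_bounded f B \<Longrightarrow> A \<subseteq> B \<Longrightarrow> weight_bounded f A"
  unfolding weight_bounded_def by (meson order_trans)

lemma weight_bounded_finite:
  assumes "\<And>x. 0 \<le> f x" "finite A"
  shows "weight_bounded f A"
  unfolding weight_bounded_def using sum_mono2[OF assms(2)] weight_nonneg[of f] assms(1) by blast

lemma weight_bounded_Un:
  assumes "\<And>x. 0 \<le> f x" "weight_bounded f A" "weight_bounded f B"
  shows "weight_bounded f (A \<union> B)"
proof -
  obtain C D where C: "\<And>F. finite F \<Longrightarrow> F \<subseteq> A \<Longrightarrow> sum (weight f) F \<le> C"
    and D: "\<And>F. finite F \<Longrightarrow> F \<subseteq> B \<Longrightarrow> sum (weight f) F \<le> D"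
    using assms(2,3) unfolding weight_bounded_def by blast
  have "sum (weight f) F \<le> C + D" if F: "finite F" "F \<subseteq> A \<union> B" for F
  proof -
    have "sum (weight f) F = sum (weight f) (F \<inter> A) + sum (weight f) (F - A)"
      using F by (metis add.commute sum.Int_Diff)
    also have "\<dots> \<le> C + D" using C[of "F \<inter> A"] D[of "F - A"] F by (intro add_mono) auto
    finally show ?thesis .
  qed
  then show ?thesis unfolding weight_bounded_def by blast
qed

text \<open>A word may split in several ways, but overcounting only enlarges the sum: it is at most
  the product of the sums over the left and the right factors.\<close>

lemma weight_bounded_set_append:
  assumes f: "\<And>x. 0 \<le> f x" and "weight_bounded f A" "weight_bounded f B"
  shows "weight_bounded f (set_append A B)"
proof -
  obtain C D where C: "\<And>F. finite F \<Longrightarrow> F \<subseteq> A \<Longrightarrow> sum (weight f) F \<le> C"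
    and D: "\<And>F. finite F \<Longrightarrow> F \<subseteq> B \<Longrightarrow> sum (weight f) F \<le> D"
    using assms(2,3) unfolding weight_bounded_def by blast
  have "sum (weight f) F \<le> C * D" if F: "finite F" "F \<subseteq> set_append A B" for F
  proof -
    from finite_subset_image[OF F(1) F(2)[unfolded set_append_def]]
    obtain I where I: "I \<subseteq> A \<times> B" "finite I" "F = (\<lambda>(u, v). u @ v) ` I" by metis
    have fin: "finite (fst ` I \<times> snd ` I)" using I by auto
    have sb: "fst ` I \<subseteq> A" "snd ` I \<subseteq> B" using I(1) by force+
    have "sum (weight f) F \<le> (\<Sum>(u, v)\<in>I. weight f u * weight f v)"
      unfolding I(3) by (rule order_trans[OF sum_image_le[OF I(2)]])
        (auto simp: weight_nonneg[OF f] case_prod_unfold)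
    also have "\<dots> \<le> (\<Sum>(u, v)\<in>fst ` I \<times> snd ` I. weight f u * weight f v)"
    proof (rule sum_mono2[OF fin])
      show "I \<subseteq> fst ` I \<times> snd ` I" by force
    qed (auto simp: weight_nonneg[OF f])
    also have "\<dots> = sum (weight f) (fst ` I) * sum (weight f) (snd ` I)"
      by (simp add: sum_product sum.cartesian_product)
    also have "\<dots> \<le> C * D"
    proof (rule mult_mono)
      show "sum (weight f) (fst ` I) \<le> C" using C[of "fst ` I"] sb I(2) by auto
      show "sum (weight f) (snd ` I) \<le> D" using D[of "snd ` I"] sb I(2) by auto
      show "0 \<le> C" using C[of "{}"] by simp
    qed (auto intro: sum_nonneg weight_nonneg f)
    finally show ?thesis .
  qed
  then show ?thesis unfolding weight_bounded_def by blast
qed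

text \<open>The weight of an image word is the weight of the original word for the new letter
  weights \<open>weight f (h x)\<close>; possible failure of injectivity is again harmless.\<close>

lemma weight_bounded_subst:
  assumes f: "\<And>x. 0 \<le> f x" and "weight_bounded (\<lambda>x. weight f (h x)) A"
  shows "weight_bounded f (subst h ` A)"
proof -
  obtain C where C: "\<And>F. finite F \<Longrightarrow> F \<subseteq> A \<Longrightarrow> sum (weight (\<lambda>x. weight f (h x))) F \<le> C"
    using assms(2) unfolding weight_bounded_def by blast
  have "sum (weight f) F \<le> C" if F: "finite F" "F \<subseteq> subst h ` A" for F
  proof -
    obtain I where I: "I \<subseteq> A" "finite I" "F = subst h ` I"
      using finite_subset_image[OF F] by metis
    have "sum (weight f) F \<le> sum (weight f \<circ> subst h) I"
      unfolding I(3) by (rule sum_image_le[OF I(2)]) (simp add: weight_nonneg[OF f])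
    also have "\<dots> \<le> C" using C[OF I(2,1)] by (simp add: o_def weight_subst)
    finally show ?thesis .
  qed
  then show ?thesis unfolding weight_bounded_def by blast
qed

text \<open>The words of length \<open>n\<close> have total weight
  \<open>(f True + f False) ^ n\<close>, so the sum is dominated by a geometric series.\<close>

lemma weight_bounded_UNIV:
  assumes f: "\<And>x. 0 \<le> f x" and lt: "f True + f False < 1"
  shows "weight_bounded f UNIV"
proof -
  define q where "q = f True + f False"
  have q: "0 \<le> q" "q < 1" using f lt by (auto simp: q_def)
  have fin: "finite {w :: bool list. length w \<le> n}" for n
    using finite_lists_length_le[of "UNIV :: bool set" n] by simp
  have le: "sum (weight f) {w. length w \<le> n} \<le> 1 / (1 - q)" for n
  proof (induction n)
    case 0
    then show ?case using q by (simp add: field_simps)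
  next
    case (Suc n)
    have e: "{w. length w \<le> Suc n} = insert [] ((#) True ` {w. length w \<le> n} \<union> (#) False ` {w. length w \<le> n})"
      (is "?L = ?R")
    proof (rule Set.set_eqI)
      fix w show "w \<in> ?L \<longleftrightarrow> w \<in> ?R" by (cases w) auto
    qed
    have "sum (weight f) {w. length w \<le> Suc n} = 1 + (sum (weight f) ((#) True ` {w. length w \<le> n})
        + sum (weight f) ((#) False ` {w. length w \<le> n}))"
      unfolding e using fin by (subst sum.insert) (auto intro!: sum.union_disjoint)
    also have "\<dots> = 1 + q * sum (weight f) {w. length w \<le> n}"
      by (simp add: sum.reindex q_def sum_distrib_left[symmetric] algebra_simps)
    also have "\<dots> \<le> 1 + q * (1 / (1 - q))" using Suc q by (intro add_left_mono mult_left_mono)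
    also have "\<dots> = 1 / (1 - q)" using q by (simp add: field_simps)
    finally show ?case .
  qed
  have "sum (weight f) F \<le> 1 / (1 - q)" if F: "finite F" for F
  proof -
    have "F \<subseteq> {w. length w \<le> Max (length ` F)}" using F by auto
    then have "sum (weight f) F \<le> sum (weight f) {w. length w \<le> Max (length ` F)}"
      using fin by (intro sum_mono2) (auto simp: weight_nonneg[OF f])
    then show ?thesis using le order_trans by blast
  qed
  then show ?thesis unfolding weight_bounded_def by blast
qed

lemma weight_mono: "(\<And>x. 0 \<le> f x) \<Longrightarrow> (\<And>x. f x \<le> r) \<Longrightarrow> weight f w \<le> r ^ length w"
  by (induction w) (auto intro!: mult_mono weight_nonneg order_trans[of 0 "f _" r])

text \<open>An alternating word is determined by its first letter and its length, so there are at
  most two of each length.\<close>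

lemma weight_bounded_alt_words:
  assumes f: "\<And>x. 0 \<le> f x" and r: "\<And>x. f x \<le> r" "r < 1"
  shows "weight_bounded f alt_words"
proof -
  define A where "A = (\<lambda>(x, n). map (\<lambda>i. x = even i) [0..<n])"
  have r0: "0 \<le> r" using f r order_trans by blast
  have sub: "alt_words \<subseteq> A ` UNIV"
  proof
    fix w assume w: "w \<in> alt_words"
    have "w = A (w ! 0, length w)"
    proof (rule nth_equalityI)
      fix i assume "i < length w"
      then show "w ! i = A (w ! 0, length w) ! i"
        using alternating[of 0 i w i] w by (simp add: alt_words_def A_def)
    qed (simp add: A_def)
    then show "w \<in> A ` UNIV" by blast
  qed
  have "sum (weight f) F \<le> 2 * (1 / (1 - r))" if F: "finite F" "F \<subseteq> alt_words" for F
  proof -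
    obtain I where I: "finite I" "F = A ` I"
      using finite_subset_image[OF F(1)] F(2) sub by (metis subset_trans)
    define N where "N = Suc (Max (snd ` I))"
    have "n \<le> Max (snd ` I)" if "(x, n) \<in> I" for x n
      by (rule Max_ge) (use I(1) that in force)+
    then have IN: "I \<subseteq> UNIV \<times> {..<N}" by (auto simp: N_def less_Suc_eq_le)
    have "sum (weight f) F \<le> sum (weight f \<circ> A) I"
      unfolding I(2) by (rule sum_image_le[OF I(1)]) (simp add: weight_nonneg[OF f])
    also have "\<dots> \<le> (\<Sum>(x, n)\<in>I. r ^ n)"
    proof (rule sum_mono, clarify)
      fix x n
      show "(weight f \<circ> A) (x, n) \<le> r ^ n"
        using weight_mono[OF f r(1), where w = "A (x, n)"] by (simp add: A_def)
    qed
    also have "\<dots> \<le> (\<Sum>(x, n)\<in>(UNIV :: bool set) \<times> {..<N}. r ^ n)"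
      by (rule sum_mono2) (use IN r0 in auto)
    also have "\<dots> = 2 * (\<Sum>n<N. r ^ n)" by (simp add: sum.cartesian_product[symmetric] UNIV_bool)
    also have "(\<Sum>n<N. r ^ n) \<le> 1 / (1 - r)"
    proof -
      have "(\<Sum>n<N. r ^ n) = (1 - r ^ N) / (1 - r)" using r(2) by (simp add: sum_gp_strict)
      then show ?thesis using r(2) r0 by (simp add: divide_right_mono)
    qed
    finally show ?thesis by simp
  qed
  then show ?thesis unfolding weight_bounded_def by blast
qed

lemma weight_bounded_alt_pow:
  assumes f: "\<And>x. 0 \<le> f x" and r: "\<And>x. f x \<le> r" "r < 1"
  shows "weight_bounded f (alt_pow k)"
  by (induction k) (auto intro!: weight_bounded_set_append weight_bounded_alt_words[where r = r] assms)

lemma finite_twin: "finite {m. twin w m}"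
  by (rule finite_subset[of _ "{..<length w}"]) (auto simp: twin_def)

text \<open>Cutting between the two equal letters of the last twin removes one twin and leaves an
  alternating remainder.\<close>

lemma few_doubles_alt_pow:
  assumes "card {m. twin w m} \<le> k"
  shows "w \<in> alt_pow k"
  using assms
proof (induction k arbitrary: w)
  case 0
  then show ?case using finite_twin[of w] by (auto simp: alt_words_def)
next
  case (Suc k)
  show ?case
  proof (cases "card {m. twin w m} = Suc k")
    case False
    then have "w \<in> alt_pow k" using Suc by auto
    moreover have "[] \<in> alt_words" by (auto simp: alt_words_def twin_def)
    moreover have "w = w @ []" by simp
    ultimately show ?thesis by (auto simp: set_append_def simp del: append_Nil2 intro!: image_eqI[of _ _ "(w, [])"])
  next
    case True
    define r where "r = Max {m. twin w m}"
    have ne: "{m. twin w m} \<noteq> {}" using True by (metis card.empty nat.distinct(1))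
    have r: "twin w r" using Max_in[OF finite_twin ne] by (simp add: r_def)
    have rl: "m \<le> r" if "twin w m" for m using Max_ge[OF finite_twin, of m] that by (simp add: r_def)
    have "{m. twin (take (Suc r) w) m} \<subseteq> {m. twin w m} - {r}" by (auto simp: twin_def)
    then have "card {m. twin (take (Suc r) w) m} \<le> card ({m. twin w m} - {r})"
      by (intro card_mono) (auto simp: finite_twin)
    also have "\<dots> = k" using True r by (simp add: finite_twin)
    finally have 1: "take (Suc r) w \<in> alt_pow k" by (rule Suc.IH)
    have "\<not> twin (drop (Suc r) w) m" for m
    proof
      assume "twin (drop (Suc r) w) m"
      then have "Suc m < length w - Suc r" "w ! (Suc r + m) = w ! Suc (Suc r + m)"
        by (auto simp: twin_def)
      then have "twin w (Suc r + m)" by (simp add: twin_def less_diff_conv add_ac)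
      then show False using rl[of "Suc r + m"] by simp
    qed
    then have 2: "drop (Suc r) w \<in> alt_words" by (simp add: alt_words_def)
    have "w = (\<lambda>(u, v). u @ v) (take (Suc r) w, drop (Suc r) w)" by simp
    then show ?thesis using 1 2 unfolding alt_pow.simps set_append_def by blast
  qed
qed

text \<open>One step of the Euclidean algorithm: if only \<open>x\<close> is ever doubled, each
  \<open>\<not> x\<close> can be merged with the \<open>x\<close> before it. Both images begin with
  \<open>x\<close>.\<close>

definition dup_letter :: "bool \<Rightarrow> bool \<Rightarrow> bool list" where
  "dup_letter x y = (if y = x then [x] else [x, \<not> x])"

text \<open>If all twins sit at positions of one parity, the word splits, up to its ends, into pairs
  of unequal letters; the first letter names the pair.\<close>

definition flip_pair :: "bool \<Rightarrow> bool list" where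
  "flip_pair x = [x, \<not> x]"

text \<open>The images are not palindromes, but conjugation by \<open>x\<close> repairs this: the
  substitution commutes with reversal up to moving one \<open>x\<close> from the end to the
  front.\<close>

lemma rev_subst_dup_letter: "subst (dup_letter x) (rev c) @ [x] = [x] @ rev (subst (dup_letter x) c)"
  by (induction c) (auto simp: dup_letter_def)

lemma unbalanced_factor: "unbalanced w \<Longrightarrow> unbalanced (u @ w @ v)"
proof -
  assume "unbalanced w"
  then obtain u' x c v' where w: "w = u' @ [x] @ rev c @ [x, \<not> x] @ c @ [\<not> x] @ v'" unfolding unbalanced_def by blast
  have "u @ w @ v = (u @ u') @ [x] @ rev c @ [x, \<not> x] @ c @ [\<not> x] @ (v' @ v)" by (simp add: w)
  then show ?thesis unfolding unbalanced_def by blast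
qed

lemma crossing_factor: "crossing w \<Longrightarrow> crossing (u @ w @ v)"
proof -
  assume "crossing w"
  then obtain u' s d v' where "w = u' @ [s, s, s] @ v' \<or>
     w = u' @ [s] @ rev (map Not d) @ [\<not> s, s, s, \<not> s] @ d @ [s] @ v'" unfolding crossing_def by blast
  then have "u @ w @ v = (u @ u') @ [s, s, s] @ (v' @ v) \<or>
     u @ w @ v = (u @ u') @ [s] @ rev (map Not d) @ [\<not> s, s, s, \<not> s] @ d @ [s] @ (v' @ v)" by auto
  then show ?thesis unfolding crossing_def by blast
qed

text \<open>The pattern for \<open>c\<close> is carried to the pattern for the image of
  \<open>c\<close> followed by \<open>x\<close>. The tail \<open>t\<close> supplies the
  \<open>x\<close> that is needed when the pattern reaches the end of \<open>w\<close>.\<close>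

lemma unbalanced_subst_dup_letter:
  assumes "unbalanced w" "t = x # t'"
  shows "unbalanced (subst (dup_letter x) w @ t)"
proof -
  obtain u y c v where w: "w = u @ [y] @ rev c @ [y, \<not> y] @ c @ [\<not> y] @ v"
    using assms(1) unfolding unbalanced_def by blast
  define s where "s = subst (dup_letter x)"
  have rs: "s (rev c) @ [x] = [x] @ rev (s c)" unfolding s_def by (rule rev_subst_dup_letter)
  show ?thesis
  proof (cases "y = x")
    case True
    have "s w @ t = s u @ [x] @ (s (rev c) @ [x]) @ [x, \<not> x] @ (s c @ [x]) @ [\<not> x] @ (s v @ t)"
      unfolding w True by (simp add: s_def dup_letter_def)
    also have "\<dots> = s u @ [x] @ rev (s c @ [x]) @ [x, \<not> x] @ (s c @ [x]) @ [\<not> x] @ (s v @ t)"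
      unfolding rs by simp
    finally show ?thesis unfolding unbalanced_def s_def[symmetric] by blast
  next
    case False
    then have y: "y = (\<not> x)" by simp
    \<comment> \<open>The image of the closing letter \<open>\<not> y = x\<close> is used up by the
      extended \<open>c\<close>; the new closing letter is the first letter of what follows.\<close>
    have "\<exists>z. s v @ t = x # z"
      using assms(2) by (cases v) (auto simp: s_def dup_letter_def)
    then obtain z where z: "s v @ t = x # z" by blast
    have "s w @ t = s u @ [x, \<not> x] @ (s (rev c) @ [x]) @ [\<not> x, x] @ s c @ [x] @ (s v @ t)"
      unfolding w y by (simp add: s_def dup_letter_def)
    also have "\<dots> = (s u @ [x]) @ [\<not> x] @ rev (s c @ [x]) @ [\<not> x, \<not> \<not> x] @ (s c @ [x]) @ [\<not> \<not> x] @ z"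
      unfolding rs z by simp
    finally show ?thesis unfolding unbalanced_def s_def[symmetric] by blast
  qed
qed

lemma rev_subst_flip_pair: "rev (subst flip_pair (rev c)) = map Not (subst flip_pair c)"
  by (induction c) (auto simp: flip_pair_def)

text \<open>The centre \<open>x, \<not> x\<close> becomes \<open>x, \<not> x, \<not> x, x\<close>,
  so \<open>\<not> x\<close> is the doubled letter. Reversing a pair negates it, which turns the
  mirror rule for blocks into the one for turns.\<close>

lemma crossing_subst_flip_pair:
  assumes "unbalanced w"
  shows "crossing (subst flip_pair w)"
proof -
  obtain u x c v where w: "w = u @ [x] @ rev c @ [x, \<not> x] @ c @ [\<not> x] @ v"
    using assms unfolding unbalanced_def by blast
  define s where "s = subst flip_pair"
  have rs: "s (rev c) = rev (map Not (s c))" unfolding s_def rev_subst_flip_pair[symmetric] by simp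
  have "s w = (s u @ [x]) @ [\<not> x] @ s (rev c) @ [\<not> \<not> x, \<not> x, \<not> x, \<not> \<not> x] @ s c @ [\<not> x] @ (x # s v)"
    unfolding w by (simp add: s_def flip_pair_def)
  then show ?thesis unfolding rs crossing_def s_def[symmetric] by blast
qed

definition short_words :: "nat \<Rightarrow> bool list set" where
  "short_words k = {w. length w \<le> k}"

lemma finite_short_words: "finite (short_words k)"
  using finite_lists_length_le[of "UNIV :: bool set" k] by (simp add: short_words_def)

lemma twin_Cons: "twin (x # w) (Suc r) \<longleftrightarrow> twin w r"
  by (simp add: twin_def)

text \<open>A last \<open>x\<close> is kept outside the image on purpose: it makes the tail start
  with \<open>x\<close>, as \<open>unbalanced_subst_dup_letter\<close> requires.\<close>

lemma parse_dup_letter: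
  assumes "\<And>r. twin w r \<Longrightarrow> w ! r = x" "w \<noteq> []" "hd w = x"
  shows "\<exists>w' t. w = subst (dup_letter x) w' @ x # t \<and> length t \<le> 1"
  using assms
proof (induction "length w" arbitrary: w rule: less_induct)
  case less
  then obtain w1 where w: "w = x # w1" by (cases w) auto
  show ?case
  proof (cases w1)
    case Nil
    then show ?thesis using w by (intro exI[of _ "[]"] exI[of _ "[]"]) simp
  next
    case (Cons y w2)
    show ?thesis
    proof (cases "y = x")
      case True
      have "\<exists>w' t. w1 = subst (dup_letter x) w' @ x # t \<and> length t \<le> 1"
      proof (rule less.hyps)
        fix r assume "twin w1 r"
        then show "w1 ! r = x" using less.prems(1)[of "Suc r"] by (simp add: w twin_Cons)
      qed (use True Cons w in auto)
      then obtain w' t where "w1 = subst (dup_letter x) w' @ x # t" "length t \<le> 1" by blast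
      then show ?thesis using w by (intro exI[of _ "x # w'"] exI[of _ t]) (simp add: dup_letter_def)
    next
      case False
      show ?thesis
      proof (cases w2)
        case Nil
        then show ?thesis using w Cons by (intro exI[of _ "[]"] exI[of _ "[y]"]) simp
      next
        case c: (Cons z w3)
        have z: "z = x"
          using less.prems(1)[of 1] False by (auto simp: w Cons c twin_def)
        have "\<exists>w' t. w2 = subst (dup_letter x) w' @ x # t \<and> length t \<le> 1"
        proof (rule less.hyps)
          fix r assume "twin w2 r"
          then show "w2 ! r = x" using less.prems(1)[of "Suc (Suc r)"] by (simp add: w Cons twin_Cons)
        qed (use Cons w c z in auto)
        then obtain w' t where "w2 = subst (dup_letter x) w' @ x # t" "length t \<le> 1" by blast
        moreover have "y = (\<not> x)" using False by simp
        ultimately show ?thesis using w Cons by (intro exI[of _ "(\<not> x) # w'"] exI[of _ t]) (simp add: dup_letter_def)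
      qed
    qed
  qed
qed

lemma parse_flip_pair:
  assumes "\<And>r. even r \<Longrightarrow> \<not> twin w r"
  shows "\<exists>w' t. w = subst flip_pair w' @ t \<and> length t \<le> 1"
  using assms
proof (induction w rule: induct_list012)
  case (3 x y w)
  have "\<exists>w' t. w = subst flip_pair w' @ t \<and> length t \<le> 1"
  proof (rule 3(1))
    fix r assume "even (r :: nat)"
    then show "\<not> twin w r" using 3(3)[of "Suc (Suc r)"] by (simp add: twin_Cons)
  qed
  then obtain w' t where "w = subst flip_pair w' @ t" "length t \<le> 1" by blast
  moreover have "y = (\<not> x)" using 3(3)[of 0] by (auto simp: twin_def)
  ultimately show ?case by (intro exI[of _ "x # w'"] exI[of _ t]) (simp add: flip_pair_def[of x])
next
  case 1 then show ?case by (intro exI[of _ "[]"] exI[of _ "[]"]) simp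
next
  case (2 x) then show ?case by (intro exI[of _ "[]"] exI[of _ "[x]"]) simp
qed

text \<open>Renormalization with boundary terms: at most one letter precedes the first
  \<open>x\<close>, and a tail of at most two letters remains. The preimage is again free of the
  pattern.\<close>

lemma balanced_parse:
  assumes "\<not> unbalanced w" "\<And>r. twin w r \<Longrightarrow> w ! r = x"
  shows "w \<in> short_words 1 \<union> set_append (short_words 1) (set_append (subst (dup_letter x) ` {w. \<not> unbalanced w}) (short_words 2))"
proof (cases "w \<in> short_words 1")
  case False
  then obtain y z w2 where w: "w = y # z # w2"
    by (cases w; cases "tl w") (auto simp: short_words_def)
  obtain u w1 where w1: "w = u @ w1" "length u \<le> 1" "w1 \<noteq> []" "hd w1 = x"
  proof (cases "y = x")
    case True
    then show ?thesis using that[of "[]" w] w by simp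
  next
    case False
    then have "z = x" using assms(2)[of 0] w by (auto simp: twin_def)
    then show ?thesis using that[of "[y]" "z # w2"] w by simp
  qed
  have "\<exists>w' t. w1 = subst (dup_letter x) w' @ x # t \<and> length t \<le> 1"
  proof (rule parse_dup_letter)
    fix r assume "twin w1 r"
    then have "twin w (length u + r)" by (auto simp: twin_def w1 nth_append)
    then have "w ! (length u + r) = x" by (rule assms(2))
    then show "w1 ! r = x" by (simp add: w1(1))
  qed (use w1 in auto)
  then obtain w' t where w': "w1 = subst (dup_letter x) w' @ x # t" "length t \<le> 1" by blast
  have "\<not> unbalanced w'"
  proof
    assume "unbalanced w'"
    then have "unbalanced (subst (dup_letter x) w' @ x # t)" by (rule unbalanced_subst_dup_letter) simp
    then have "unbalanced (u @ w1 @ [])" unfolding w'(1) by (rule unbalanced_factor)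
    then show False using assms(1) w1(1) by simp
  qed
  moreover have "w = u @ (subst (dup_letter x) w' @ (x # t))" by (simp add: w1(1) w'(1))
  moreover have "u \<in> short_words 1" "x # t \<in> short_words 2" using w1(2) w'(2) by (auto simp: short_words_def)
  ultimately show ?thesis unfolding set_append_def by force
qed simp

lemma noncrossing_parse:
  assumes "\<not> crossing w" "\<And>r. twin w r \<Longrightarrow> even r = e"
  shows "w \<in> set_append (short_words 1) (set_append (subst flip_pair ` {w. \<not> unbalanced w}) (short_words 1))"
proof -
  obtain u w1 where w1: "w = u @ w1" "length u \<le> 1" "\<And>r. even r \<Longrightarrow> \<not> twin w1 r"
  \<comment> \<open>Pairs must not straddle a twin, so the first letter is dropped when the twins
    sit at even positions.\<close>
  proof (cases e)
    case False
    then have "\<not> twin w r" if "even r" for r using assms(2)[of r] that by auto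
    then show ?thesis using that[of "[]" w] by simp
  next
    case True
    show ?thesis
    proof (cases w)
      case Nil
      then show ?thesis using that[of "[]" "[]"] by (simp add: twin_def)
    next
      case (Cons y w1)
      have "\<not> twin w1 r" if "even r" for r
        using assms(2)[of "Suc r"] that True by (auto simp: Cons twin_Cons)
      then show ?thesis using that[of "[y]" w1] Cons by simp
    qed
  qed
  obtain w' t where w': "w1 = subst flip_pair w' @ t" "length t \<le> 1"
    using parse_flip_pair[of w1] w1(3) by blast
  have "\<not> unbalanced w'"
  proof
    assume "unbalanced w'"
    then have "crossing (subst flip_pair w')" by (rule crossing_subst_flip_pair)
    then have "crossing (u @ subst flip_pair w' @ t)" by (rule crossing_factor)
    then show False using assms(1) w1(1) w'(1) by simp
  qed
  moreover have "w = u @ (subst flip_pair w' @ t)" by (simp add: w1(1) w'(1))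
  moreover have "u \<in> short_words 1" "t \<in> short_words 1" using w1(2) w'(2) by (auto simp: short_words_def)
  ultimately show ?thesis unfolding set_append_def by force
qed

text \<open>Induction on \<open>p + q\<close> downwards: desubstituting one letter replaces \<open>(p, q)\<close> by \<open>(p, p + q)\<close> or
  \<open>(p + q, q)\<close>, and once \<open>p + q\<close> is large even the sum over all words converges.\<close>

lemma weight_bounded_balanced:
  fixes r :: real
  assumes r: "0 < r" "r < 1" and "1 \<le> p" "1 \<le> q"
  shows "weight_bounded (\<lambda>x. if x then r ^ p else r ^ q) {w. \<not> unbalanced w}"
proof -
  \<comment> \<open>Once \<open>p + q \<ge> 2 * J\<close> one exponent is at least \<open>J\<close>;
    the other letter weighs at most \<open>r\<close>, so the two weights sum to less than 1.\<close>
  obtain J where J: "r ^ J < 1 - r" using real_arch_pow_inv[of "1 - r" r] r by auto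
  show ?thesis using assms(3,4)
  proof (induction "2 * J - (p + q)" arbitrary: p q rule: less_induct)
    case less
    define f where "f = (\<lambda>x. if x then r ^ p else r ^ q)"
    have f0: "0 \<le> f x" for x using r by (simp add: f_def)
    have f1: "f x \<le> r" for x
      using r less.prems power_decreasing[of 1 p r] power_decreasing[of 1 q r] by (simp add: f_def)
    show ?case
    proof (cases "p + q \<ge> 2 * J")
      case True
      then have "p \<ge> J \<or> q \<ge> J" by linarith
      then have "r ^ p \<le> r ^ J \<or> r ^ q \<le> r ^ J" using r by (auto intro: power_decreasing)
      then have "f True + f False < 1" using J f1[of True] f1[of False] by (auto simp: f_def)
      then show ?thesis using weight_bounded_UNIV[of f] f0 weight_bounded_subset unfolding f_def[symmetric] by blast
    next
      case False
      define S where "S x = short_words 1 \<union> set_append (short_words 1) (set_append (subst (dup_letter x) ` {w. \<not> unbalanced w}) (short_words 2))" for x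
      have sub: "{w. \<not> unbalanced w} \<subseteq> alt_pow 2 \<union> (S True \<union> S False)"
      proof
        fix w assume "w \<in> {w. \<not> unbalanced w}"
        then have w: "\<not> unbalanced w" by simp
        show "w \<in> alt_pow 2 \<union> (S True \<union> S False)"
          using balanced_structure[OF w]
        proof
          assume "\<exists>x. \<forall>r. twin w r \<longrightarrow> w ! r = x"
          then obtain x where "\<And>r. twin w r \<Longrightarrow> w ! r = x" by blast
          from balanced_parse[OF w this] have "w \<in> S x" by (simp add: S_def)
          then show ?thesis by (cases x) auto
        next
          assume "card {r. twin w r} \<le> 2"
          from few_doubles_alt_pow[OF this] show ?thesis by blast
        qed
      qed
      have "weight_bounded (\<lambda>x. if x then r ^ p else r ^ (p + q)) {w. \<not> unbalanced w}"
        by (rule less.hyps) (use False less.prems in auto)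
      moreover have "(\<lambda>x. weight f (dup_letter True x)) = (\<lambda>x. if x then r ^ p else r ^ (p + q))"
        by (auto simp: fun_eq_iff dup_letter_def f_def power_add)
      ultimately have T: "weight_bounded f (subst (dup_letter True) ` {w. \<not> unbalanced w})"
        by (intro weight_bounded_subst f0) simp
      have "weight_bounded (\<lambda>x. if x then r ^ (p + q) else r ^ q) {w. \<not> unbalanced w}"
        by (rule less.hyps) (use False less.prems in auto)
      moreover have "(\<lambda>x. weight f (dup_letter False x)) = (\<lambda>x. if x then r ^ (p + q) else r ^ q)"
        by (auto simp: fun_eq_iff dup_letter_def f_def power_add)
      ultimately have F: "weight_bounded f (subst (dup_letter False) ` {w. \<not> unbalanced w})"
        by (intro weight_bounded_subst f0) simp
      have "weight_bounded f (alt_pow 2 \<union> (S True \<union> S False))"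
        unfolding S_def
        by (intro weight_bounded_Un weight_bounded_set_append weight_bounded_finite finite_short_words
            weight_bounded_alt_pow[OF f0 f1 r(2)] T F f0)
      then show ?thesis unfolding f_def[symmetric] using sub by (rule weight_bounded_subset)
    qed
  qed
qed

text \<open>A single use of \<open>flip_pair\<close> leads to words without the pattern of
  \<open>unbalanced\<close>; both blocks have length 2, hence weight \<open>r ^ 2\<close>.\<close>

lemma weight_bounded_noncrossing:
  fixes r :: real
  assumes r: "0 < r" "r < 1"
  shows "weight_bounded (\<lambda>_. r) {w. \<not> crossing w}"
proof -
  have sub: "{w. \<not> crossing w} \<subseteq> alt_pow 4 \<union> set_append (short_words 1) (set_append (subst flip_pair ` {w. \<not> unbalanced w}) (short_words 1))"
  proof
    fix w assume "w \<in> {w. \<not> crossing w}"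
    then have w: "\<not> crossing w" by simp
    show "w \<in> alt_pow 4 \<union> set_append (short_words 1) (set_append (subst flip_pair ` {w. \<not> unbalanced w}) (short_words 1))"
      using noncrossing_structure[OF w]
    proof
      assume "\<exists>e. \<forall>r. twin w r \<longrightarrow> even r = e"
      then obtain e where "\<And>r. twin w r \<Longrightarrow> even r = e" by blast
      from noncrossing_parse[OF w this] show ?thesis by blast
    next
      assume "card {r. twin w r} \<le> 4"
      from few_doubles_alt_pow[OF this] show ?thesis by blast
    qed
  qed
  have "weight_bounded (\<lambda>x. if x then r ^ 2 else r ^ 2) {w. \<not> unbalanced w}"
    by (rule weight_bounded_balanced[OF r]) auto
  moreover have "(\<lambda>x. weight (\<lambda>_. r) (flip_pair x)) = (\<lambda>x. if x then r ^ 2 else r ^ 2)"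
    by (auto simp: fun_eq_iff flip_pair_def power2_eq_square)
  ultimately have F: "weight_bounded (\<lambda>_. r) (subst flip_pair ` {w. \<not> unbalanced w})"
    using r by (intro weight_bounded_subst) simp_all
  have "weight_bounded (\<lambda>_. r) (alt_pow 4 \<union> set_append (short_words 1) (set_append (subst flip_pair ` {w. \<not> unbalanced w}) (short_words 1)))"
    by (intro weight_bounded_Un weight_bounded_set_append weight_bounded_finite finite_short_words weight_bounded_alt_pow[where r = r] F) (use r in auto)
  then show ?thesis using sub by (rule weight_bounded_subset)
qed

text \<open>Subexponential growth, since \<open>r\<close> may be taken arbitrarily close to 1: one
  term of a bounded sum is bounded.\<close>

lemma card_noncrossing:
  fixes r :: real
  assumes r: "0 < r" "r < 1"
  shows "\<exists>C. \<forall>L. card {w. \<not> crossing w \<and> length w = L} * r ^ L \<le> C"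
proof -
  obtain C where C: "\<And>F. finite F \<Longrightarrow> F \<subseteq> {w. \<not> crossing w} \<Longrightarrow> sum (weight (\<lambda>_. r)) F \<le> C"
    using weight_bounded_noncrossing[OF r] unfolding weight_bounded_def by blast
  have "card {w. \<not> crossing w \<and> length w = L} * r ^ L \<le> C" for L
  proof -
    have "finite {w. \<not> crossing w \<and> length w = L}"
      by (rule finite_subset[OF _ finite_short_words[of L]]) (auto simp: short_words_def)
    from C[OF this] have "sum (weight (\<lambda>_. r)) {w. \<not> crossing w \<and> length w = L} \<le> C" by blast
    also have "sum (weight (\<lambda>_. r)) {w. \<not> crossing w \<and> length w = L} = (\<Sum>w\<in>{w. \<not> crossing w \<and> length w = L}. r ^ L)"
      by (intro sum.cong) (auto simp: weight_const)
    finally show ?thesis by simp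
  qed
  then show ?thesis by blast
qed

section \<open>Null sets of Hausdorff measures\<close>

lemma hausdorff_content_0D:
  fixes E :: "'a::metric_space set"
  assumes "hausdorff_content s \<delta> E = 0" "\<epsilon> > 0"
  shows "\<exists>U :: nat \<Rightarrow> 'a set. E \<subseteq> (\<Union>i. U i) \<and> (\<forall>i. bounded (U i) \<and> diameter (U i) \<le> \<delta>) \<and>
      (\<Sum>i. ennreal (diameter (U i) powr s)) < \<epsilon>"
proof -
  have "hausdorff_content s \<delta> E < \<epsilon>" using assms by simp
  then show ?thesis unfolding hausdorff_content_def INF_less_iff by auto
qed

lemma hausdorff_content_le:
  fixes U :: "nat \<Rightarrow> 'a::metric_space set"
  assumes "E \<subseteq> (\<Union>i. U i)" "\<And>i. bounded (U i)" "\<And>i. diameter (U i) \<le> \<delta>"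
  shows "hausdorff_content s \<delta> E \<le> (\<Sum>i. ennreal (diameter (U i) powr s))"
  unfolding hausdorff_content_def by (rule INF_lower) (use assms in auto)

lemma hausdorff_measure_eq_0_iff:
  "hausdorff_measure s E = 0 \<longleftrightarrow> (\<forall>\<delta>>0. hausdorff_content s \<delta> E = 0)"
  unfolding hausdorff_measure_def by (auto simp: SUP_eq_iff bot_ennreal[symmetric] simp del: bot_ennreal)

lemma hausdorff_measure_0_mono:
  assumes "hausdorff_measure s F = 0" "E \<subseteq> F"
  shows "hausdorff_measure s E = 0"
proof -
  have "hausdorff_content s \<delta> E \<le> hausdorff_content s \<delta> F" for \<delta>
    unfolding hausdorff_content_def by (rule INF_superset_mono) (use assms(2) in auto)
  then show ?thesis using assms(1) unfolding hausdorff_measure_eq_0_iff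
    by (metis le_zero_eq)
qed

lemma hausdorff_measure_0_UN:
  fixes E :: "nat \<Rightarrow> 'a::metric_space set"
  assumes "\<And>n. hausdorff_measure s (E n) = 0"
  shows "hausdorff_measure s (\<Union>n. E n) = 0"
  unfolding hausdorff_measure_eq_0_iff
proof (intro allI impI)
  fix \<delta> :: real assume \<delta>: "\<delta> > 0"
  have "hausdorff_content s \<delta> (\<Union>n. E n) \<le> ennreal \<epsilon>" if \<epsilon>: "\<epsilon> > 0" for \<epsilon> :: real
  proof -
    have "\<exists>U. E n \<subseteq> (\<Union>i. U i) \<and> (\<forall>i. bounded (U i) \<and> diameter (U i) \<le> \<delta>) \<and>
        (\<Sum>i. ennreal (diameter (U i) powr s)) < ennreal (\<epsilon> * (1/2) ^ Suc n)" for n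
      by (rule hausdorff_content_0D) (use assms[of n] \<delta> \<epsilon> in \<open>auto simp: hausdorff_measure_eq_0_iff\<close>)
    then obtain U where U: "\<And>n. E n \<subseteq> (\<Union>i. U n i)" "\<And>n i. bounded (U n i)"
        "\<And>n i. diameter (U n i) \<le> \<delta>"
        "\<And>n. (\<Sum>i. ennreal (diameter (U n i) powr s)) < ennreal (\<epsilon> * (1/2) ^ Suc n)"
      by metis
    define V where "V k = U (fst (prod_decode k)) (snd (prod_decode k))" for k
    have "(\<Union>n. E n) \<subseteq> (\<Union>k. V k)"
    proof
      fix x assume "x \<in> (\<Union>n. E n)"
      then obtain n i where "x \<in> U n i" using U(1) by blast
      then have "x \<in> V (prod_encode (n, i))" by (simp add: V_def)
      then show "x \<in> (\<Union>k. V k)" by blast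
    qed
    then have "hausdorff_content s \<delta> (\<Union>n. E n) \<le> (\<Sum>k. ennreal (diameter (V k) powr s))"
      by (rule hausdorff_content_le) (simp_all add: V_def U)
    also have "\<dots> = (\<Sum>n. \<Sum>i. ennreal (diameter (U n i) powr s))"
    proof -
      have "(\<Sum>k. (\<lambda>p. ennreal (diameter (U (fst p) (snd p)) powr s)) (prod_decode k)) =
          (\<Sum>n. \<Sum>i. ennreal (diameter (U n i) powr s))"
        by (rule suminf_ennreal_2dimen) simp
      then show ?thesis unfolding V_def .
    qed
    also have "\<dots> \<le> (\<Sum>n. ennreal (\<epsilon> * (1/2) ^ Suc n))"
      by (intro suminf_le less_imp_le U(4)) auto
    also have "\<dots> = ennreal \<epsilon>"
    proof (rule suminf_ennreal_eq)
      show "(\<lambda>n. \<epsilon> * (1/2) ^ Suc n) sums \<epsilon>"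
        using sums_mult[OF power_half_series, of \<epsilon>] by simp
    qed (use \<epsilon> in auto)
    finally show ?thesis .
  qed
  note le = this
  have "hausdorff_content s \<delta> (\<Union>n. E n) \<le> 0"
  proof (rule ennreal_le_epsilon)
    fix e :: real assume "0 < e"
    then show "hausdorff_content s \<delta> (\<Union>n. E n) \<le> 0 + ennreal e" using le[of e] by simp
  qed
  then show "hausdorff_content s \<delta> (\<Union>n. E n) = 0" by simp
qed

text \<open>A finite cover is padded by empty sets to a sequence; these contribute nothing to the
  sum.\<close>

lemma hausdorff_measure_0_if_finite_covers:
  fixes E :: "'a::metric_space set"
  assumes s: "s > 0"
    and cov: "\<And>\<epsilon>. \<epsilon> > 0 \<Longrightarrow> \<exists>\<U> d. finite \<U> \<and> E \<subseteq> \<Union>\<U> \<and>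
      (\<forall>U\<in>\<U>. bounded U \<and> diameter U \<le> d) \<and> d \<le> \<epsilon> \<and> real (card \<U>) * d powr s \<le> \<epsilon>"
  shows "hausdorff_measure s E = 0"
  unfolding hausdorff_measure_eq_0_iff
proof (intro allI impI)
  fix \<delta> :: real assume \<delta>: "\<delta> > 0"
  have "hausdorff_content s \<delta> E \<le> ennreal \<epsilon>" if \<epsilon>: "\<epsilon> > 0" for \<epsilon> :: real
  proof -
    obtain \<U> d where U: "finite \<U>" "E \<subseteq> \<Union>\<U>" "\<And>U. U \<in> \<U> \<Longrightarrow> bounded U" "\<And>U. U \<in> \<U> \<Longrightarrow> diameter U \<le> d"
      "d \<le> min \<epsilon> \<delta>" "real (card \<U>) * d powr s \<le> min \<epsilon> \<delta>"
      using cov[of "min \<epsilon> \<delta>"] \<epsilon> \<delta> by auto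
    obtain xs where xs: "set xs = \<U>" "distinct xs" using finite_distinct_list[OF U(1)] by blast
    define V where "V i = (if i < length xs then xs ! i else {})" for i
    have V: "V i \<in> \<U> \<or> V i = {}" for i using xs by (auto simp: V_def)
    have "E \<subseteq> (\<Union>i. V i)"
    proof
      fix x assume "x \<in> E"
      then obtain X where "X \<in> set xs" "x \<in> X" using U(2) xs by blast
      then obtain i where "i < length xs" "x \<in> xs ! i" by (metis in_set_conv_nth)
      then have "x \<in> V i" by (simp add: V_def)
      then show "x \<in> (\<Union>i. V i)" by blast
    qed
    moreover have "bounded (V i)" for i using V[of i] U(3) by auto
    moreover have "diameter (V i) \<le> \<delta>" for i using V[of i] U(4)[of "V i"] U(5) \<delta> by auto
    ultimately have "hausdorff_content s \<delta> E \<le> (\<Sum>i. ennreal (diameter (V i) powr s))"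
      by (rule hausdorff_content_le)
    also have "\<dots> = (\<Sum>i<length xs. ennreal (diameter (V i) powr s))"
      by (rule suminf_finite) (auto simp: V_def)
    also have "\<dots> = ennreal (\<Sum>i<length xs. diameter (V i) powr s)"
      by (rule sum_ennreal) simp
    also have "(\<Sum>i<length xs. diameter (V i) powr s) \<le> (\<Sum>i<length xs. d powr s)"
    proof (intro sum_mono powr_mono2)
      fix i assume "i \<in> {..<length xs}"
      then have "V i \<in> \<U>" using xs by (auto simp: V_def)
      then show "diameter (V i) \<le> d" "0 \<le> diameter (V i)" using U(3,4) diameter_ge_0 by auto
    qed (use s in simp)
    then have "ennreal (\<Sum>i<length xs. diameter (V i) powr s) \<le> ennreal (\<Sum>i<length xs. d powr s)"
      by (rule ennreal_leI)
    also have "(\<Sum>i<length xs. d powr s) = real (card \<U>) * d powr s"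
      using distinct_card[OF xs(2)] xs(1) by simp
    also have "ennreal \<dots> \<le> ennreal \<epsilon>" using U(6) by (intro ennreal_leI) simp
    finally show ?thesis .
  qed
  note le = this
  have "hausdorff_content s \<delta> E \<le> 0"
  proof (rule ennreal_le_epsilon)
    fix e :: real assume "0 < e"
    then show "hausdorff_content s \<delta> E \<le> 0 + ennreal e" using le[of e] by simp
  qed
  then show "hausdorff_content s \<delta> E = 0" by simp
qed

lemma hausdorff_dim_eq_0:
  assumes "\<And>s. s > 0 \<Longrightarrow> hausdorff_measure s E = 0"
  shows "hausdorff_dim E = 0"
proof -
  have "hausdorff_dim E = Inf (ereal ` {0<..})"
    unfolding hausdorff_dim_def using assms by (intro arg_cong[where f = Inf] arg_cong[where f = "image ereal"]) auto
  also have "\<dots> = 0"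
  proof (rule antisym)
    show "Inf (ereal ` {0<..}) \<le> 0"
    proof (rule ccontr)
      assume "\<not> Inf (ereal ` {0<..}) \<le> 0"
      then obtain e where e: "0 < ereal e" "ereal e < Inf (ereal ` {0<..})"
        using ereal_dense2[of 0 "Inf (ereal ` {0<..})"] by (auto simp: not_le)
      then have "Inf (ereal ` {0<..}) \<le> ereal e" by (intro Inf_lower) auto
      then show False using e(2) by simp
    qed
  qed (auto intro: Inf_greatest)
  finally show ?thesis .
qed

section \<open>The involutions of an ideal triangle\<close>

text \<open>\<open>T i\<close> is the involution \<open>x \<mapsto> P i - K i / (x - P i)\<close> exchanging \<open>\<infinity>\<close> and \<open>P i\<close>; it folds the side of the ideal
  triangle with vertices \<open>0\<close>, \<open>p + q\<close>, \<open>\<infinity>\<close> that cuts off \<open>in_arc i\<close>. The residues are the ones for which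
  \<open>T 2 \<circ> T 1 \<circ> T 0\<close> is a translation, namely by \<open>p + q + t\<close>. At the pole \<open>T i (P i) = P i\<close> is a junk value.\<close>

locale tri =
  fixes p q t :: real
  assumes p: "p > 0" and q: "q > 0" and t: "t > 0"
begin

definition P :: "nat \<Rightarrow> real" where
  "P i = (if i = 0 then 0 else if i = 1 then p else p + q)"

definition K :: "nat \<Rightarrow> real" where
  "K i = (if i = 0 then t * p else if i = 1 then p * q else t * q)"

definition T :: "nat \<Rightarrow> real \<Rightarrow> real" where
  "T i x = P i - K i / (x - P i)"

definition in_arc :: "nat \<Rightarrow> real \<Rightarrow> bool" where
  "in_arc i x \<longleftrightarrow> (if i = 0 then x < 0 else if i = 1 then 0 < x \<and> x < p + q else p + q < x)"

lemma PK_simps: "P 0 = 0" "P (Suc 0) = p" "P 2 = p + q" "K 0 = t * p" "K (Suc 0) = p * q" "K 2 = t * q"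
  by (simp_all add: P_def K_def)

lemma in_arc_simps: "in_arc 0 x \<longleftrightarrow> x < 0" "in_arc (Suc 0) x \<longleftrightarrow> 0 < x \<and> x < p + q" "in_arc 2 x \<longleftrightarrow> p + q < x"
  by (simp_all add: in_arc_def)

lemma T_simps: "T 0 x = - (t * p / x)" "T (Suc 0) x = p - p * q / (x - p)" "T 2 x = p + q - t * q / (x - (p + q))"
  by (simp_all add: T_def PK_simps)

lemma letter_cases: "i \<le> 2 \<Longrightarrow> i = 0 \<or> i = Suc 0 \<or> i = (2 :: nat)"
  by linarith

lemma K_pos: "K i > 0"
  using p q t by (simp add: K_def)

lemma P_bounds: "0 \<le> P i" "P i \<le> p + q"
  using p q by (simp_all add: P_def)

lemma T_T: "x \<noteq> P i \<Longrightarrow> T i (T i x) = x"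
  using K_pos[of i] by (simp add: T_def)

lemma T_ne: "x \<noteq> P i \<Longrightarrow> T i x \<noteq> P i"
  using K_pos[of i] by (simp add: T_def)

lemma in_arc_ne_P: "i \<le> 2 \<Longrightarrow> j \<le> 2 \<Longrightarrow> i \<noteq> j \<Longrightarrow> in_arc j x \<Longrightarrow> x \<noteq> P i"
  using p q by (auto simp: in_arc_def P_def split: if_splits)

text \<open>The factored forms show that \<open>T 1\<close> exchanges the vertices 0 and
  \<open>p + q\<close>, and they make the signs visible.\<close>

lemma T1_eq: "x \<noteq> p \<Longrightarrow> T (Suc 0) x = p * (x - (p + q)) / (x - p)"
   "x \<noteq> p \<Longrightarrow> p + q - T (Suc 0) x = q * x / (x - p)"
  by (simp_all add: T_simps field_simps)

lemma T_in:
  assumes "i \<le> 2" "j \<le> 2" "i \<noteq> j" "in_arc j x"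
  shows "in_arc i (T i x)"
proof -
  consider "i = 0" "x > 0" | "i = Suc 0" "x < 0" | "i = Suc 0" "x > p + q" | "i = 2" "x < p + q"
    using letter_cases[OF assms(1)] letter_cases[OF assms(2)] assms(3,4) p q by (auto simp: in_arc_def)
  then show ?thesis
  proof cases
    case 1
    then show ?thesis using p t by (simp add: in_arc_simps T_simps)
  next
    case 2
    have "T (Suc 0) x > 0" using T1_eq(1)[of x] 2 p q by (simp add: divide_neg_neg mult_pos_neg)
    moreover have "p + q - T (Suc 0) x > 0" using T1_eq(2)[of x] 2 p q by (simp add: divide_neg_neg mult_pos_neg)
    ultimately show ?thesis using 2 by (simp add: in_arc_simps)
  next
    case 3
    have "T (Suc 0) x > 0" using T1_eq(1)[of x] 3 p q by simp
    moreover have "p + q - T (Suc 0) x > 0" using T1_eq(2)[of x] 3 p q by simp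
    ultimately show ?thesis using 3 by (simp add: in_arc_simps)
  next
    case 4
    then show ?thesis using q t by (simp add: in_arc_simps T_simps divide_neg_pos divide_pos_neg)
  qed
qed

text \<open>Together with \<open>T_in\<close> this is the ping-pong configuration:
  \<open>T i\<close> exchanges the inside and the outside of its arc, hence consecutive letters of a
  code differ.\<close>

lemma T_notin:
  assumes "i \<le> 2" "in_arc i x" "x \<noteq> P i"
  shows "\<not> in_arc i (T i x)"
proof -
  consider "i = 0" "x < 0" | "i = Suc 0" "0 < x" "x < p + q" "x \<noteq> p" | "i = 2" "x > p + q"
    using letter_cases[OF assms(1)] assms(2,3) by (auto simp: in_arc_simps PK_simps)
  then show ?thesis
  proof cases
    case 1
    then have "t * p / x < 0" using p t by (simp add: divide_pos_neg)
    then show ?thesis using 1 by (simp add: in_arc_simps T_simps)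
  next
    case 2
    show ?thesis
    proof (cases "x > p")
      case True
      then have "T (Suc 0) x < 0" using T1_eq(1)[of x] 2 p by (simp add: divide_neg_pos mult_pos_neg)
      then show ?thesis using 2 by (simp add: in_arc_simps)
    next
      case False
      then have "p + q - T (Suc 0) x < 0" using T1_eq(2)[of x] 2 q by (simp add: divide_pos_neg)
      then show ?thesis using 2 by (simp add: in_arc_simps)
    qed
  next
    case 3
    then have "t * q / (x - (p + q)) > 0" using q t by simp
    then show ?thesis using 3 by (simp add: in_arc_simps T_simps)
  qed
qed

lemma T_diff:
  assumes "x \<noteq> P i" "y \<noteq> P i"
  shows "T i x - T i y = K i * (x - y) / ((x - P i) * (y - P i))"
  using assms by (simp add: T_def field_simps)

lemma T_210: "x \<noteq> 0 \<Longrightarrow> T 0 x \<noteq> p \<Longrightarrow> T (Suc 0) (T 0 x) \<noteq> p + q \<Longrightarrow>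
    T 2 (T (Suc 0) (T 0 x)) = x + (p + q + t)"
proof -
  assume x: "x \<noteq> 0" "T 0 x \<noteq> p" "T (Suc 0) (T 0 x) \<noteq> p + q"
  define y where "y = T 0 x"
  have y: "y = - (t * p / x)" "y \<noteq> 0" using x(1) p t by (simp_all add: y_def T_simps)
  have yp: "y \<noteq> p" using x(2) by (simp add: y_def)
  have "T 2 (T (Suc 0) y) = p + q + t * (y - p) / y"
  proof -
    have e: "T (Suc 0) y - (p + q) = - (q * y / (y - p))" using T1_eq(2)[OF yp] by linarith
    have "t * q / (q * y / (y - p)) = t * (y - p) / y" using q y(2) yp by simp
    then show ?thesis unfolding T_simps(3) e by simp
  qed
  also have "t * (y - p) / y = t - t * p / y" using y(2) by (simp add: field_simps)
  also have "t * p / y = - x" using y x(1) p t by (simp add: field_simps)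
  finally show ?thesis by (simp add: y_def)
qed

lemma T_012: "x \<noteq> p + q \<Longrightarrow> T 2 x \<noteq> p \<Longrightarrow> T (Suc 0) (T 2 x) \<noteq> 0 \<Longrightarrow>
    T 0 (T (Suc 0) (T 2 x)) = x - (p + q + t)"
proof -
  assume x: "x \<noteq> p + q" "T 2 x \<noteq> p" "T (Suc 0) (T 2 x) \<noteq> 0"
  define y where "y = T 2 x"
  have y: "y - (p + q) = - (t * q / (x - (p + q)))" "y - (p + q) \<noteq> 0" using x(1) q t by (simp_all add: y_def T_simps)
  have yp: "y \<noteq> p" using x(2) by (simp add: y_def)
  have "T 0 (T (Suc 0) y) = - (t * (y - p) / (y - (p + q)))"
  proof -
    have "t * p / (p * (y - (p + q)) / (y - p)) = t * (y - p) / (y - (p + q))" using p y(2) yp by simp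
    then show ?thesis unfolding T1_eq(1)[OF yp] T_simps(1) by simp
  qed
  also have "t * (y - p) / (y - (p + q)) = t + t * q / (y - (p + q))" using y(2) by (simp add: field_simps)
  also have "t * q / (y - (p + q)) = - (x - (p + q))" unfolding y(1) using x(1) q t by (simp add: field_simps)
  finally show ?thesis by (simp add: y_def)
qed

text \<open>A lower bound for the difference quotient of every \<open>T i\<close> between points of
  \<open>[-M, M]\<close> on the same side of the pole: the least residue divided by the square of
  the largest possible distance to a pole.\<close>

definition lower_const :: "real \<Rightarrow> real" where
  "lower_const M = min (min (t * p) (p * q)) (t * q) / (M + p + q)\<^sup>2"

lemma lower_const_pos: "M > 0 \<Longrightarrow> lower_const M > 0"
  using p q t by (auto simp: lower_const_def)

lemma T_lower:
  assumes "(x - P i) * (y - P i) > 0" "\<bar>x\<bar> \<le> M" "\<bar>y\<bar> \<le> M" "M > 0" "y - x \<ge> g" "g \<ge> 0"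
  shows "T i y - T i x \<ge> lower_const M * g"
proof -
  have "\<bar>x - P i\<bar> \<le> M + p + q" "\<bar>y - P i\<bar> \<le> M + p + q" using assms(2,3) P_bounds[of i] by linarith+
  then have le: "(x - P i) * (y - P i) \<le> (M + p + q)\<^sup>2"
    using mult_mono[of "\<bar>x - P i\<bar>" "M + p + q" "\<bar>y - P i\<bar>" "M + p + q"] assms(1)
    by (simp add: power2_eq_square abs_mult[symmetric])
  have pos: "M + p + q > 0" using assms(4) p q by simp
  have k: "min (min (t * p) (p * q)) (t * q) \<le> K i" by (auto simp: K_def)
  have "lower_const M * g \<le> K i / (M + p + q)\<^sup>2 * g"
    unfolding lower_const_def using k assms(6) by (intro mult_right_mono divide_right_mono) auto
  also have "\<dots> \<le> K i / ((x - P i) * (y - P i)) * (y - x)"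
    using le assms(1,5,6) K_pos[of i] pos by (intro mult_mono divide_left_mono) (auto intro!: divide_nonneg_pos mult_pos_pos zero_less_power)
  also have "\<dots> = T i y - T i x"
  proof -
    have ne: "y \<noteq> P i" "x \<noteq> P i" using assms(1) by auto
    show ?thesis unfolding T_diff[OF ne] by (simp add: mult.commute)
  qed
  finally show ?thesis .
qed

lemma same_side: "i \<le> 2 \<Longrightarrow> j \<le> 2 \<Longrightarrow> i \<noteq> j \<Longrightarrow> in_arc j x \<Longrightarrow> in_arc j y \<Longrightarrow> (x - P i) * (y - P i) > 0"
  using p q by (auto dest!: letter_cases simp: in_arc_simps PK_simps mult_pos_pos mult_neg_neg)

text \<open>For the letters 0 and 2 the pole is itself a vertex, so a bounded image keeps the point
  away from it. The pole of \<open>T 1\<close> is not a vertex, and there the second image is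
  needed.\<close>

lemma away:
  assumes M: "M > 0"
  shows "\<exists>\<delta>>0. \<forall>i j x. i \<le> 2 \<longrightarrow> j \<le> 2 \<longrightarrow> i \<noteq> j \<longrightarrow> in_arc i x \<longrightarrow> x \<noteq> P i \<longrightarrow> in_arc j (T i x) \<longrightarrow>
     \<bar>T i x\<bar> \<le> M \<longrightarrow> \<bar>T j (T i x)\<bar> \<le> M \<longrightarrow> \<delta> \<le> \<bar>x\<bar> \<and> \<delta> \<le> \<bar>x - (p + q)\<bar>"
proof -
  define e where "e = min (min (t * p / M) (t * q / (M + p + q))) (p + q)"
  have e: "e > 0" using M p q t by (auto simp: e_def)
  have step: "e \<le> \<bar>x\<bar> \<and> e \<le> \<bar>x - (p + q)\<bar>" if i: "i = 0 \<or> i = 2" and "in_arc i x" "\<bar>T i x\<bar> \<le> M" for i x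
  proof -
    consider "i = 0" | "i = 2" using i by blast
    then show ?thesis
    proof cases
      case 1
      then have x: "x < 0" "t * p / \<bar>x\<bar> \<le> M" using that p t by (auto simp: in_arc_simps T_simps abs_mult)
      then have "t * p / M \<le> \<bar>x\<bar>" using M by (simp add: field_simps)
      then show ?thesis using x(1) p q by (auto simp: e_def min_def)
    next
      case 2
      then have x: "x > p + q" "\<bar>p + q - t * q / (x - (p + q))\<bar> \<le> M" using that by (auto simp: in_arc_simps T_simps)
      then have "t * q / (x - (p + q)) \<le> M + p + q" by linarith
      then have "t * q / (M + p + q) \<le> x - (p + q)" using x(1) M p q by (simp add: field_simps)
      then show ?thesis using x(1) p q by (auto simp: e_def min_def)
    qed
  qed
  define \<delta> where "\<delta> = min e (min (p * e / (M + p)) (q * e / (M + p)))"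
  have \<delta>: "\<delta> > 0" using e p q M by (auto simp: \<delta>_def)
  have "\<delta> \<le> \<bar>x\<bar> \<and> \<delta> \<le> \<bar>x - (p + q)\<bar>" if a: "i \<le> 2" "j \<le> 2" "i \<noteq> j" "in_arc i x" "x \<noteq> P i" "in_arc j (T i x)"
     "\<bar>T i x\<bar> \<le> M" "\<bar>T j (T i x)\<bar> \<le> M" for i j x
  proof (cases "i = Suc 0")
    case False
    then show ?thesis using step[of i x] a letter_cases[of i] by (auto simp: \<delta>_def)
  next
    case True
    \<comment> \<open>\<open>T 1\<close> maps a neighbourhood of one vertex to a neighbourhood of
      the other, so the estimate for the image, known from its own bounded next image, is carried
      back to \<open>x\<close>.\<close>
    then have "j = 0 \<or> j = 2" using a letter_cases[of j] by auto
    from step[OF this a(6,8)] have y: "e \<le> \<bar>T i x\<bar>" "e \<le> \<bar>T i x - (p + q)\<bar>" by auto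
    define y where "y = T i x"
    have xy: "x = T (Suc 0) y" using T_T[OF a(5)] True by (simp add: y_def)
    have yp: "y \<noteq> p" using T_ne[OF a(5)] True by (simp add: y_def PK_simps)
    have b: "\<bar>y - p\<bar> \<le> M + p" using a(7) p by (auto simp: y_def)
    have pos: "\<bar>y - p\<bar> > 0" using yp by simp
    have "\<bar>x\<bar> = p * \<bar>y - (p + q)\<bar> / \<bar>y - p\<bar>" unfolding xy T1_eq(1)[OF yp] using p by (simp add: abs_mult)
    moreover have "p * e / (M + p) \<le> p * \<bar>y - (p + q)\<bar> / \<bar>y - p\<bar>"
      using b y p e pos M by (intro frac_le) (auto simp: y_def intro: mult_left_mono)
    moreover have "\<bar>x - (p + q)\<bar> = \<bar>p + q - T (Suc 0) y\<bar>" unfolding xy by (rule abs_minus_commute)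
    then have "\<bar>x - (p + q)\<bar> = q * \<bar>y\<bar> / \<bar>y - p\<bar>" unfolding T1_eq(2)[OF yp] using q by (simp add: abs_mult)
    moreover have "q * e / (M + p) \<le> q * \<bar>y\<bar> / \<bar>y - p\<bar>"
      using b y q e pos M by (intro frac_le) (auto simp: y_def intro: mult_left_mono)
    ultimately show ?thesis by (auto simp: \<delta>_def min_le_iff_disj)
  qed
  then show ?thesis using \<delta> by blast
qed

end

section \<open>Geodesics of bounded height\<close>

text \<open>The three sides are in cyclic order and a geodesic leaves a triangle through one of the
  two sides it did not enter by; the next letter is thus \<open>w n + 1\<close> or
  \<open>w n + 2\<close> modulo 3, one value for each direction of turning.\<close>

definition turn :: "(nat \<Rightarrow> nat) \<Rightarrow> nat \<Rightarrow> bool" where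
  "turn w n \<longleftrightarrow> w (Suc n) = (w n + 1) mod 3"

context tri
begin

text \<open>Index 0 is the point to be compared and larger indices lie deeper in its code;
  \<open>k\<close> is the last common letter. The distance \<open>\<delta>\<close> to the vertices
  is required of \<open>X\<close> only, which already separates the two points when their last arcs
  meet at a finite vertex.\<close>

definition codes_diverge ::
    "real \<Rightarrow> real \<Rightarrow> nat \<Rightarrow> (nat \<Rightarrow> real) \<Rightarrow> (nat \<Rightarrow> real) \<Rightarrow> (nat \<Rightarrow> nat) \<Rightarrow> (nat \<Rightarrow> nat) \<Rightarrow> bool" where
  "codes_diverge M \<delta> k X Y u v \<longleftrightarrow>
    (\<forall>j\<le>Suc k. u j \<le> 2 \<and> v j \<le> 2 \<and> in_arc (u j) (X j) \<and> in_arc (v j) (Y j) \<and> \<bar>X j\<bar> \<le> M \<and> \<bar>Y j\<bar> \<le> M) \<and>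
    (\<forall>j\<le>k. X j = T (u j) (X (Suc j)) \<and> Y j = T (v j) (Y (Suc j)) \<and> u j = v j \<and>
       u (Suc j) \<noteq> u j \<and> v (Suc j) \<noteq> v j) \<and>
    u (Suc k) = (u k + 1) mod 3 \<and> v (Suc k) \<noteq> (v k + 1) mod 3 \<and>
    \<delta> \<le> \<bar>X (Suc k)\<bar> \<and> \<delta> \<le> \<bar>X (Suc k) - (p + q)\<bar>"

text \<open>Within the arc \<open>i\<close> the points with next letter \<open>i + 1\<close> (mod 3) lie to the left of those with next letter
  \<open>i + 2\<close>, and the generators are increasing on the arcs of the other letters.\<close>

lemma compare_codes:
  assumes M: "M > 0" and \<delta>: "\<delta> > 0"
  shows "\<exists>\<epsilon>>0. \<forall>X Y u v. codes_diverge M \<delta> k X Y u v \<longrightarrow> \<epsilon> \<le> Y 0 - X 0"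
proof (induction k)
  case 0
  define \<epsilon> where "\<epsilon> = min (lower_const M * \<delta>) (p * q / (M + p))"
  have e: "\<epsilon> > 0" using lower_const_pos[OF M] \<delta> p q M by (auto simp: \<epsilon>_def)
  have "\<epsilon> \<le> Y0 - X0"
    if a: "u0 \<le> 2" "u1 \<le> 2" "v1 \<le> 2" "in_arc u1 X1" "in_arc v1 Y1" "\<bar>X1\<bar> \<le> M" "\<bar>Y1\<bar> \<le> M"
      "X0 = T u0 X1" "Y0 = T u0 Y1" "u1 \<noteq> u0" "v1 \<noteq> u0" "u1 = (u0 + 1) mod 3" "v1 \<noteq> (u0 + 1) mod 3"
      "\<delta> \<le> \<bar>X1\<bar>" "\<delta> \<le> \<bar>X1 - (p + q)\<bar>" for u0 u1 v1 X0 X1 Y0 Y1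
  proof -
    have nd: "\<not> (3 :: nat) dvd Suc (Suc 0)" by presburger
    \<comment> \<open>For \<open>u0 = 0\<close> and \<open>u0 = 2\<close> the two arcs meet at a
      finite vertex, and \<open>\<delta>\<close> separates the points. For \<open>u0 = 1\<close>
      they meet at infinity, on opposite sides of the pole \<open>p\<close>; there
      \<open>T_lower\<close> does not apply and the bound \<open>M\<close> gives the gap.\<close>
    consider "u0 = 0" "u1 = Suc 0" "v1 = 2" | "u0 = Suc 0" "u1 = 2" "v1 = 0" | "u0 = 2" "u1 = 0" "v1 = Suc 0"
      using letter_cases[OF a(1)] letter_cases[OF a(2)] letter_cases[OF a(3)] a(10-13) nd by auto
    then show ?thesis
    proof cases
      case 1
      then have "T 0 Y1 - T 0 X1 \<ge> lower_const M * \<delta>"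
        using a M \<delta> p q by (intro T_lower) (auto simp: in_arc_simps PK_simps)
      then show ?thesis unfolding a(8,9) 1(1) by (simp add: \<epsilon>_def min_le_iff_disj)
    next
      case 3
      then have "T 2 Y1 - T 2 X1 \<ge> lower_const M * \<delta>"
        using a M \<delta> p q by (intro T_lower) (auto simp: in_arc_simps PK_simps intro!: mult_neg_neg)
      then show ?thesis unfolding a(8,9) 3(1) by (simp add: \<epsilon>_def min_le_iff_disj)
    next
      case 2
      have x: "X1 > p + q" "Y1 < 0" using 2 a by (auto simp: in_arc_simps)
      have "p * q / (X1 - p) > 0" using x p q by simp
      moreover have "p * q / (M + p) \<le> p * q / (p - Y1)"
        using x a(7) p q by (intro divide_left_mono) auto
      moreover have "p * q / (p - Y1) = - (p * q / (Y1 - p))"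
        by (metis minus_diff_eq minus_divide_right)
      ultimately have "p * q / (M + p) \<le> Y0 - X0" unfolding a(8,9) 2 T_simps by linarith
      then show ?thesis by (simp add: \<epsilon>_def)
    qed
  qed
  note main = this
  show ?case
  proof (intro exI[of _ \<epsilon>] conjI e allI impI)
    fix X Y :: "nat \<Rightarrow> real" and u v :: "nat \<Rightarrow> nat"
    assume "codes_diverge M \<delta> 0 X Y u v"
    note c = this[unfolded codes_diverge_def]
    note a = c[THEN conjunct1, rule_format] and b = c[THEN conjunct2, THEN conjunct1, rule_format]
    show "\<epsilon> \<le> Y 0 - X 0"
      by (rule main[of "u 0" "u (Suc 0)" "v (Suc 0)" "X (Suc 0)" "Y (Suc 0)"])
        (use a[of 0] a[of "Suc 0"] b[of 0] c in auto)
  qed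
next
  case (Suc k)
  then obtain \<epsilon> where e: "\<epsilon> > 0" and IH: "\<And>X Y u v. codes_diverge M \<delta> k X Y u v \<Longrightarrow> \<epsilon> \<le> Y 0 - X 0" by blast
  show ?case
  proof (intro exI[of _ "lower_const M * \<epsilon>"] conjI allI impI)
    show "lower_const M * \<epsilon> > 0" using e lower_const_pos[OF M] by simp
    fix X Y :: "nat \<Rightarrow> real" and u v :: "nat \<Rightarrow> nat"
    assume "codes_diverge M \<delta> (Suc k) X Y u v"
    note c = this[unfolded codes_diverge_def]
    note a = c[THEN conjunct1, rule_format] and b = c[THEN conjunct2, THEN conjunct1, rule_format]
    have "codes_diverge M \<delta> k (\<lambda>j. X (Suc j)) (\<lambda>j. Y (Suc j)) (\<lambda>j. u (Suc j)) (\<lambda>j. v (Suc j))"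
      unfolding codes_diverge_def using c by auto
    then have g: "\<epsilon> \<le> Y (Suc 0) - X (Suc 0)" by (rule IH)
    have i: "in_arc (u (Suc 0)) (X (Suc 0))" "in_arc (u (Suc 0)) (Y (Suc 0))" "u 0 \<noteq> u (Suc 0)" "u 0 \<le> 2" "u (Suc 0) \<le> 2"
      "\<bar>X (Suc 0)\<bar> \<le> M" "\<bar>Y (Suc 0)\<bar> \<le> M" "X 0 = T (u 0) (X (Suc 0))" "Y 0 = T (u 0) (Y (Suc 0))"
      using a[of "Suc 0"] a[of 0] b[of 0] b[of "Suc 0"] by auto
    show "lower_const M * \<epsilon> \<le> Y 0 - X 0"
      unfolding i(8,9) by (rule T_lower[OF same_side[OF i(4,5,3,1,2)] i(6,7) M g]) (use e in simp)
  qed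
qed

end

text \<open>\<open>\<eta> n\<close> and \<open>\<xi> n\<close> are the initial and the terminal end
  point of the \<open>n\<close>-th lift. The terminal one lies behind the side to be crossed next,
  the initial one behind the side just crossed, both named by \<open>w\<close>. The bound
  \<open>p + q + t\<close> is the cusp width.\<close>

locale orbit = tri +
  fixes \<xi> \<eta> :: "nat \<Rightarrow> real" and w :: "nat \<Rightarrow> nat"
  assumes w_le: "w n \<le> 2" and w_ne: "w (Suc n) \<noteq> w n"
    and \<xi>_in: "in_arc (w n) (\<xi> n)" and \<xi>_P: "\<xi> n \<noteq> P (w n)" and \<xi>_Suc: "\<xi> (Suc n) = T (w n) (\<xi> n)"
    and \<eta>_in: "in_arc (w n) (\<eta> (Suc n))" and \<eta>_P: "\<eta> n \<noteq> P (w n)" and \<eta>_Suc: "\<eta> (Suc n) = T (w n) (\<eta> n)"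
    and height: "h > p + q + t \<Longrightarrow> eventually (\<lambda>n. \<bar>\<eta> n - \<xi> n\<bar> \<le> h) sequentially"
begin

abbreviation "M \<equiv> 2 * (p + q) + t + 1"

lemma M_pos: "M > 0"
  using p q t by simp

text \<open>The two end points lie in different arcs and at distance at most
  \<open>p + q + t + 1\<close>, so neither can be far from the interval from 0 to
  \<open>p + q\<close>; this is the origin of \<open>M\<close>.\<close>

lemma eventually_bounded: "eventually (\<lambda>n. \<bar>\<xi> n\<bar> \<le> M \<and> \<bar>\<eta> n\<bar> \<le> M) sequentially"
proof -
  have "eventually (\<lambda>n. \<bar>\<eta> n - \<xi> n\<bar> \<le> p + q + t + 1) sequentially" by (rule height) simp
  moreover have "eventually (\<lambda>n. n \<ge> Suc 0) sequentially" by (rule eventually_ge_at_top)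
  ultimately show ?thesis
  proof eventually_elim
    case (elim n)
    then obtain m where n: "n = Suc m" by (cases n) auto
    have "in_arc (w n) (\<xi> n)" "in_arc (w m) (\<eta> n)" "w n \<noteq> w m" using \<xi>_in \<eta>_in w_ne n by auto
    then show ?case using letter_cases[OF w_le[of n]] letter_cases[OF w_le[of m]] elim p q t
      by (auto simp: in_arc_simps abs_if split: if_splits)
  qed
qed

lemma \<xi>_back: "\<xi> n = T (w n) (\<xi> (Suc n))"
  unfolding \<xi>_Suc using T_T[OF \<xi>_P] by simp

lemma \<eta>_back: "\<eta> n = T (w n) (\<eta> (Suc n))"
  unfolding \<eta>_Suc using T_T[OF \<eta>_P] by simp

lemma \<eta>_ne: "\<eta> (Suc n) \<noteq> P (w n)"
  using T_ne[OF \<eta>_P] by (simp add: \<eta>_Suc)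

text \<open>\<open>away\<close> looks two images ahead: for \<open>\<xi>\<close> these are the next
  lifts, for \<open>\<eta>\<close> the previous ones, with the letters read backwards.\<close>

lemma eventually_away: "\<exists>\<delta>>0. eventually (\<lambda>n. \<delta> \<le> \<bar>\<xi> n\<bar> \<and> \<delta> \<le> \<bar>\<xi> n - (p + q)\<bar> \<and>
    \<delta> \<le> \<bar>\<eta> n\<bar> \<and> \<delta> \<le> \<bar>\<eta> n - (p + q)\<bar>) sequentially"
proof -
  obtain \<delta> where \<delta>: "\<delta> > 0" and aw: "\<And>i j x. i \<le> 2 \<Longrightarrow> j \<le> 2 \<Longrightarrow> i \<noteq> j \<Longrightarrow> in_arc i x \<Longrightarrow> x \<noteq> P i \<Longrightarrow> in_arc j (T i x) \<Longrightarrow>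
     \<bar>T i x\<bar> \<le> M \<Longrightarrow> \<bar>T j (T i x)\<bar> \<le> M \<Longrightarrow> \<delta> \<le> \<bar>x\<bar> \<and> \<delta> \<le> \<bar>x - (p + q)\<bar>"
    using away[OF M_pos] by blast
  obtain N where N: "\<And>n. n \<ge> N \<Longrightarrow> \<bar>\<xi> n\<bar> \<le> M \<and> \<bar>\<eta> n\<bar> \<le> M"
    using eventually_bounded unfolding eventually_sequentially by blast
  have "\<delta> \<le> \<bar>\<xi> n\<bar> \<and> \<delta> \<le> \<bar>\<xi> n - (p + q)\<bar> \<and> \<delta> \<le> \<bar>\<eta> n\<bar> \<and> \<delta> \<le> \<bar>\<eta> n - (p + q)\<bar>" if n: "n \<ge> N + 2" for n
  proof -
    obtain m where m: "n = Suc (Suc m)" "m \<ge> N" using n by (cases n; cases "n - 1") auto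
    have "\<delta> \<le> \<bar>\<xi> n\<bar> \<and> \<delta> \<le> \<bar>\<xi> n - (p + q)\<bar>"
    proof (rule aw)
      show "w (Suc n) \<le> 2" "w n \<le> 2" "w n \<noteq> w (Suc n)" using w_le w_ne by metis+
      show "in_arc (w (Suc n)) (T (w n) (\<xi> n))" "\<bar>T (w n) (\<xi> n)\<bar> \<le> M" "\<bar>T (w (Suc n)) (T (w n) (\<xi> n))\<bar> \<le> M"
        using \<xi>_in N[of "Suc n"] N[of "Suc (Suc n)"] n by (auto simp: \<xi>_Suc[symmetric])
    qed (rule \<xi>_in \<xi>_P)+
    moreover have "\<delta> \<le> \<bar>\<eta> n\<bar> \<and> \<delta> \<le> \<bar>\<eta> n - (p + q)\<bar>"
    proof (rule aw)
      show "w (Suc m) \<le> 2" "w m \<le> 2" "w (Suc m) \<noteq> w m" using w_le w_ne by metis+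
      show "in_arc (w (Suc m)) (\<eta> n)" "\<eta> n \<noteq> P (w (Suc m))" using \<eta>_in \<eta>_ne m by auto
      show "in_arc (w m) (T (w (Suc m)) (\<eta> n))" "\<bar>T (w (Suc m)) (\<eta> n)\<bar> \<le> M" "\<bar>T (w m) (T (w (Suc m)) (\<eta> n))\<bar> \<le> M"
        using \<eta>_in[of m] N[of m] N[of "Suc m"] m unfolding m(1) \<eta>_back[symmetric] by auto
    qed
    ultimately show ?thesis by blast
  qed
  then show ?thesis using \<delta> unfolding eventually_sequentially by blast
qed

lemma turn_down: "\<not> turn w n \<Longrightarrow> w n = (w (Suc n) + 1) mod 3"
  using letter_cases[OF w_le[of n]] letter_cases[OF w_le[of "Suc n"]] w_ne[of n] by (auto simp: turn_def)

lemma turn_up: "turn w n \<Longrightarrow> w (Suc n) = (w n + 1) mod 3"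
  by (simp add: turn_def)

lemma in_arc_gt_0: "i \<le> 2 \<Longrightarrow> i \<noteq> 0 \<Longrightarrow> in_arc i x \<Longrightarrow> x > 0"
  using p q by (auto simp: in_arc_def split: if_splits)

lemma in_arc_lt_pq: "i \<noteq> 2 \<Longrightarrow> i \<le> 2 \<Longrightarrow> in_arc i x \<Longrightarrow> x < p + q"
  using p q by (auto simp: in_arc_def split: if_splits)

lemma in_arc_ne_0: "in_arc i x \<Longrightarrow> x \<noteq> 0"
  using p q by (auto simp: in_arc_def split: if_splits)

lemma shift_down:
  assumes "w n = 2" "T (Suc 0) (\<xi> (Suc n)) \<noteq> 0" "\<xi> (Suc n) \<noteq> p"
  shows "T 0 (T (Suc 0) (\<xi> (Suc n))) = \<xi> n - (p + q + t)"
  using T_012[of "\<xi> n"] \<xi>_P[of n] assms by (simp add: PK_simps \<xi>_Suc)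

lemma shift_down':
  assumes "w n = 2" "w (Suc n) = Suc 0"
  shows "T 0 (\<xi> (Suc (Suc n))) = \<xi> n - (p + q + t)"
proof -
  have e: "\<xi> (Suc (Suc n)) = T (Suc 0) (\<xi> (Suc n))" using assms by (simp add: \<xi>_Suc[of "Suc n"])
  have "\<xi> (Suc n) \<noteq> p" using \<xi>_P[of "Suc n"] assms by (simp add: PK_simps)
  moreover have "\<xi> (Suc (Suc n)) \<noteq> 0" using \<xi>_in in_arc_ne_0 by blast
  ultimately show ?thesis using shift_down[OF assms(1)] unfolding e by simp
qed

text \<open>A third equal turn makes the geodesic cross a full period of edges at a cusp.\<close>

lemma no_down_run: "eventually (\<lambda>n. turn w n \<or> turn w (Suc n) \<or> turn w (Suc (Suc n))) sequentially"
proof -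
  obtain \<delta> where \<delta>: "\<delta> > 0" and aw: "eventually (\<lambda>n. \<delta> \<le> \<bar>\<xi> n\<bar> \<and> \<delta> \<le> \<bar>\<xi> n - (p + q)\<bar> \<and>
    \<delta> \<le> \<bar>\<eta> n\<bar> \<and> \<delta> \<le> \<bar>\<eta> n - (p + q)\<bar>) sequentially" using eventually_away by blast
  define \<epsilon> where "\<epsilon> = min \<delta> (lower_const M * \<delta>)"
  have \<epsilon>: "\<epsilon> > 0" using \<delta> lower_const_pos[OF M_pos] by (simp add: \<epsilon>_def)
  have \<epsilon>\<delta>: "\<epsilon> \<le> \<delta>" by (simp add: \<epsilon>_def)
  have "eventually (\<lambda>n. \<bar>\<eta> n - \<xi> n\<bar> \<le> p + q + t + \<epsilon> / 2) sequentially"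
    by (rule height) (use \<epsilon> in simp)
  with aw eventually_bounded have "eventually (\<lambda>n. (\<bar>\<eta> n - \<xi> n\<bar> \<le> p + q + t + \<epsilon> / 2) \<and>
    \<delta> \<le> \<bar>\<xi> n\<bar> \<and> \<delta> \<le> \<bar>\<xi> n - (p + q)\<bar> \<and> \<delta> \<le> \<bar>\<eta> n\<bar> \<and> \<bar>\<xi> n\<bar> \<le> M \<and> \<bar>\<eta> n\<bar> \<le> M) sequentially"
    by eventually_elim blast
  then obtain N where N: "\<And>n. n \<ge> N \<Longrightarrow> \<bar>\<eta> n - \<xi> n\<bar> \<le> p + q + t + \<epsilon> / 2 \<and>
    \<delta> \<le> \<bar>\<xi> n\<bar> \<and> \<delta> \<le> \<bar>\<xi> n - (p + q)\<bar> \<and> \<delta> \<le> \<bar>\<eta> n\<bar> \<and> \<bar>\<xi> n\<bar> \<le> M \<and> \<bar>\<eta> n\<bar> \<le> M"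
    unfolding eventually_sequentially by blast
  have "turn w r \<or> turn w (Suc r) \<or> turn w (Suc (Suc r))" if r: "r \<ge> N + 1" for r
  proof (rule ccontr)
    assume a: "\<not> ?thesis"
    let ?r2 = "Suc (Suc r)" and ?r3 = "Suc (Suc (Suc r))" and ?r4 = "Suc (Suc (Suc (Suc r)))"
    obtain m where m: "r = Suc m" using r by (cases r) auto
    have l: "w r = (w (Suc r) + 1) mod 3" "w (Suc r) = (w ?r2 + 1) mod 3"
      "w ?r2 = (w ?r3 + 1) mod 3" using a turn_down by auto
    have nd: "\<not> (3 :: nat) dvd Suc (Suc 0)" by presburger
    \<comment> \<open>The comparison is made where the letter 2 occurs, at \<open>r\<close>,
      \<open>Suc r\<close> or \<open>?r2\<close>: from there \<open>shift_down'\<close> applies, and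
      the two end points turn out to differ by more than \<open>p + q + t\<close>.\<close>
    consider "w r = 2" "w (Suc r) = Suc 0" "w ?r2 = 0" "w ?r3 = 2"
      | "w r = 0" "w (Suc r) = 2" "w ?r2 = Suc 0" "w ?r3 = 0"
      | "w r = Suc 0" "w (Suc r) = 0" "w ?r2 = 2" "w ?r3 = Suc 0"
      using letter_cases[OF w_le[of ?r3]] l nd by (elim disjE) auto
    then show False
    proof cases
      case 1
      have "\<xi> ?r3 = \<xi> r - (p + q + t)"
        using shift_down'[OF 1(1,2)] 1(3) by (simp add: \<xi>_Suc[of ?r2])
      moreover have "\<xi> ?r3 \<ge> p + q + \<delta>"
        using \<xi>_in[of ?r3] 1(4) N[of ?r3] r by (auto simp: in_arc_simps)
      moreover have "\<eta> r < p + q"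
        by (rule in_arc_lt_pq[of "w m"]) (use \<eta>_in[of m] w_ne[of m] w_le 1 m in auto)
      ultimately show False using N[of r] r \<epsilon> \<epsilon>\<delta> by (simp add: abs_le_iff)
    next
      case 2
      have "\<xi> ?r4 = \<xi> (Suc r) - (p + q + t)"
        using shift_down'[OF 2(2,3)] 2(4) by (simp add: \<xi>_Suc[of ?r3])
      moreover have "\<xi> ?r4 > 0"
        by (rule in_arc_gt_0[OF w_le _ \<xi>_in]) (use w_ne[of ?r3] 2 in auto)
      moreover have "\<eta> (Suc r) \<le> - \<delta>"
        using \<eta>_in[of r] 2(1) N[of "Suc r"] r by (auto simp: in_arc_simps)
      ultimately show False using N[of "Suc r"] r \<epsilon> \<epsilon>\<delta> by (simp add: abs_le_iff)
    next
      case 3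
      define z where "z = \<xi> ?r4"
      define y where "y = \<eta> (Suc r)"
      have z: "T 0 z = \<xi> ?r2 - (p + q + t)"
        using shift_down'[OF 3(3,4)] by (simp add: z_def)
      have y: "\<eta> ?r2 = T 0 y" using 3(2) by (simp add: \<eta>_Suc[of "Suc r"] y_def)
      have "w ?r4 \<noteq> Suc 0" using w_ne[of ?r3] 3 by simp
      then consider "w ?r4 = 0" | "w ?r4 = 2"
        using letter_cases[OF w_le[of ?r4]] by auto
      then have "T 0 z - T 0 y \<ge> \<epsilon>"
      proof cases
        case 1
        have "z < 0" using \<xi>_in[of ?r4] 1 by (simp add: z_def in_arc_simps)
        then have "T 0 z > 0" using p t by (simp add: T_simps divide_pos_neg)
        moreover have "\<eta> ?r2 \<le> - \<delta>"
          using \<eta>_in[of "Suc r"] 3(2) N[of ?r2] r by (auto simp: in_arc_simps)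
        ultimately show ?thesis unfolding y by (simp add: \<epsilon>_def)
      next
        case 2
        have zz: "z \<ge> p + q + \<delta>"
          using \<xi>_in[of ?r4] 2 N[of ?r4] r by (auto simp: z_def in_arc_simps)
        have yy: "0 < y" "y < p + q" using \<eta>_in[of r] 3 by (auto simp: y_def in_arc_simps)
        have "T 0 z - T 0 y \<ge> lower_const M * \<delta>"
          by (rule T_lower) (use zz yy \<delta> M_pos N[of ?r4] N[of "Suc r"] r p q
              in \<open>auto simp: z_def y_def PK_simps\<close>)
        then show ?thesis by (simp add: \<epsilon>_def)
      qed
      then show False using N[of ?r2] r z y \<epsilon> by (simp add: abs_le_iff)
    qed
  qed
  then show ?thesis unfolding eventually_sequentially by blast
qed

text \<open>The long pattern of \<open>crossing\<close>, read on the infinite turning word: it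
  starts at \<open>i\<close>, and \<open>k\<close> is the length of \<open>d\<close>.\<close>

definition mirror_at :: "nat \<Rightarrow> bool \<Rightarrow> nat \<Rightarrow> bool" where
  "mirror_at k s i \<longleftrightarrow> turn w i = s \<and> turn w (i + k + 1) = (\<not> s) \<and> turn w (i + k + 2) = s \<and>
     turn w (i + k + 3) = s \<and> turn w (i + k + 4) = (\<not> s) \<and> turn w (i + 2 * k + 5) = s \<and>
     (\<forall>j<k. turn w (i + 1 + j) \<noteq> turn w (i + 2 * k + 4 - j))"

text \<open>For a double turn at \<open>r\<close>, the diameter seen from the cusp that the geodesic turns around exceeds
  \<open>p + q + t\<close> by the difference of the images of \<open>\<xi> (r + 3)\<close> and \<open>\<eta> r\<close> under the identity, \<open>T 0\<close> or
  \<open>T 0 \<circ> T 1\<close>, depending on the letter \<open>w r\<close>.\<close>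

lemma no_down_mirror: "eventually (\<lambda>n. \<not> mirror_at k False n) sequentially"
proof -
  obtain \<delta> where \<delta>: "\<delta> > 0" and aw: "eventually (\<lambda>n. \<delta> \<le> \<bar>\<xi> n\<bar> \<and> \<delta> \<le> \<bar>\<xi> n - (p + q)\<bar> \<and>
    \<delta> \<le> \<bar>\<eta> n\<bar> \<and> \<delta> \<le> \<bar>\<eta> n - (p + q)\<bar>) sequentially" using eventually_away by blast
  from compare_codes[OF M_pos \<delta>, of k] obtain \<epsilon> where \<epsilon>: "\<epsilon> > 0"
    and cmp: "\<And>X Y u v. codes_diverge M \<delta> k X Y u v \<Longrightarrow> \<epsilon> \<le> Y 0 - X 0" by blast
  \<comment> \<open>The gap \<open>\<epsilon>\<close> is seen after zero, one or two further
    generators, each costing at most a factor \<open>lower_const M\<close>.\<close>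
  define \<epsilon>' where "\<epsilon>' = min \<epsilon> (min (lower_const M * \<epsilon>) (lower_const M * (lower_const M * \<epsilon>)))"
  have \<epsilon>': "\<epsilon>' > 0" using \<epsilon> lower_const_pos[OF M_pos] by (simp add: \<epsilon>'_def)
  have \<epsilon>'_le: "\<epsilon>' \<le> \<epsilon>" "\<epsilon>' \<le> lower_const M * \<epsilon>" "\<epsilon>' \<le> lower_const M * (lower_const M * \<epsilon>)" by (simp_all add: \<epsilon>'_def)
  have "eventually (\<lambda>n. \<bar>\<eta> n - \<xi> n\<bar> \<le> p + q + t + \<epsilon>' / 2) sequentially"
    by (rule height) (use \<epsilon>' in simp)
  with aw eventually_bounded have "eventually (\<lambda>n. (\<bar>\<eta> n - \<xi> n\<bar> \<le> p + q + t + \<epsilon>' / 2) \<and>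
    \<delta> \<le> \<bar>\<eta> n\<bar> \<and> \<delta> \<le> \<bar>\<eta> n - (p + q)\<bar> \<and> \<bar>\<xi> n\<bar> \<le> M \<and> \<bar>\<eta> n\<bar> \<le> M) sequentially"
    by eventually_elim blast
  then obtain N where N: "\<And>n. n \<ge> N \<Longrightarrow> \<bar>\<eta> n - \<xi> n\<bar> \<le> p + q + t + \<epsilon>' / 2 \<and>
    \<delta> \<le> \<bar>\<eta> n\<bar> \<and> \<delta> \<le> \<bar>\<eta> n - (p + q)\<bar> \<and> \<bar>\<xi> n\<bar> \<le> M \<and> \<bar>\<eta> n\<bar> \<le> M"
    unfolding eventually_sequentially by blast
  have "\<not> mirror_at k False i" if i: "i \<ge> N" for i
  proof
    assume mir: "mirror_at k False i"
    define r where "r = i + k + 2"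
    let ?r2 = "Suc (Suc r)" and ?r3 = "Suc (Suc (Suc r))"
    have ps: "i + k + 3 = Suc r" "i + k + 4 = ?r2" "i + 2 * k + 5 = ?r3 + k" by (simp_all add: r_def)
    have tn: "\<not> turn w i" "turn w (i + k + 1)" "\<not> turn w r" "\<not> turn w (Suc r)" "turn w ?r2"
      "\<not> turn w (?r3 + k)"
      using mir unfolding mirror_at_def ps by (auto simp: r_def)
    have tm: "turn w (i + 1 + j) \<noteq> turn w (i + 2 * k + 4 - j)" if "j < k" for j
      using mir that unfolding mirror_at_def by blast
    \<comment> \<open>From the double turn at \<open>r\<close>, \<open>u\<close> and
      \<open>X\<close> run into the past of the geodesic, \<open>v\<close> and \<open>Y\<close> into
      its future.\<close>
    define u where "u = (\<lambda>j. w (i + (Suc k - j)))"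
    define v where "v = (\<lambda>j. w (?r3 + j))"
    define X where "X = (\<lambda>j. \<eta> (Suc (i + (Suc k - j))))"
    define Y where "Y = (\<lambda>j. \<xi> (?r3 + j))"
    have up_inj: "a = b" if "(a + 1) mod 3 = (b + 1) mod 3" "a \<le> 2" "b \<le> 2" for a b :: nat
      using that by (auto dest!: letter_cases)
    have l: "w r = (w (Suc r) + 1) mod 3" "w (Suc r) = (w ?r2 + 1) mod 3"
       "w ?r3 = (w ?r2 + 1) mod 3" "w r = (w (i + k + 1) + 1) mod 3"
      using turn_down tn turn_up[of "i + k + 1"] turn_up[of ?r2] by (auto simp: r_def)
    \<comment> \<open>The up turns next to the double down turn bring both codes to the letter
      \<open>w (Suc r)\<close>. Afterwards reading backwards negates the turns, so the negated
      mirror image yields equal letters.\<close>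
    have uv: "u j = v j" if "j \<le> k" for j
      using that
    proof (induction j)
      case 0
      have "w (i + k + 1) = w (Suc r)" by (rule up_inj) (use l w_le in auto)
      then show ?case using l by (simp add: u_def v_def)
    next
      case (Suc j)
      define f where "f = ?r3 + j"
      have ind: "w (Suc (i + (k - j))) = w f" using Suc by (simp add: u_def v_def f_def Suc_diff_le)
      have "i + 1 + (k - Suc j) = i + (k - j)" "i + 2 * k + 4 - (k - Suc j) = f"
        using Suc.prems by (simp_all add: f_def r_def)
      then have tt: "turn w (i + (k - j)) \<noteq> turn w f" using tm[of "k - Suc j"] Suc.prems by simp
      have "w (i + (k - j)) = w (Suc f)"
      proof (cases "turn w f")
        case True
        then show ?thesis using turn_up[of f] turn_down[of "i + (k - j)"] tt ind by simp
      next
        case False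
        then have "(w (i + (k - j)) + 1) mod 3 = (w (Suc f) + 1) mod 3"
          using turn_down[of f] turn_up[of "i + (k - j)"] tt ind by simp
        then show ?thesis using up_inj w_le by blast
      qed
      then show ?case by (simp add: u_def v_def f_def)
    qed
    have main: "\<epsilon> \<le> Y 0 - X 0"
    proof (rule cmp[of _ _ u v], unfold codes_diverge_def, intro conjI)
      show "\<forall>j\<le>Suc k. u j \<le> 2 \<and> v j \<le> 2 \<and> in_arc (u j) (X j) \<and> in_arc (v j) (Y j) \<and> \<bar>X j\<bar> \<le> M \<and> \<bar>Y j\<bar> \<le> M"
        using w_le \<xi>_in \<eta>_in N i by (auto simp: u_def v_def X_def Y_def r_def)
      show "\<forall>j\<le>k. X j = T (u j) (X (Suc j)) \<and> Y j = T (v j) (Y (Suc j)) \<and> u j = v j \<and> u (Suc j) \<noteq> u j \<and> v (Suc j) \<noteq> v j"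
      proof (intro allI impI)
        fix j assume j: "j \<le> k"
        have e: "i + (Suc k - j) = Suc (i + (Suc k - Suc j))" using j by simp
        have "X j = T (u j) (X (Suc j))" unfolding X_def u_def e by (rule \<eta>_Suc)
        moreover have "Y j = T (v j) (Y (Suc j))" unfolding Y_def v_def add_Suc_right by (rule \<xi>_back)
        moreover have "u (Suc j) \<noteq> u j" unfolding u_def e by (rule not_sym[OF w_ne])
        moreover have "v (Suc j) \<noteq> v j" unfolding v_def using w_ne by simp
        ultimately show "X j = T (u j) (X (Suc j)) \<and> Y j = T (v j) (Y (Suc j)) \<and> u j = v j \<and> u (Suc j) \<noteq> u j \<and> v (Suc j) \<noteq> v j"
          using uv[OF j] by blast
      qed
      show "u (Suc k) = (u k + 1) mod 3" using turn_down[OF tn(1)] by (simp add: u_def)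
      show "v (Suc k) \<noteq> (v k + 1) mod 3" using tn(6) by (simp add: v_def turn_def)
      show "\<delta> \<le> \<bar>X (Suc k)\<bar>" "\<delta> \<le> \<bar>X (Suc k) - (p + q)\<bar>" using N[of "Suc i"] i by (auto simp: X_def)
    qed
    have g: "\<epsilon> \<le> \<xi> ?r3 - \<eta> r" using main by (simp add: X_def Y_def r_def)
    have c: "in_arc (w (Suc r)) (\<eta> r)" "in_arc (w (Suc r)) (\<xi> ?r3)"
    proof -
      have "w (Suc r) = w ?r3" using l by simp
      moreover have "w (Suc r) = w (i + k + 1)" using uv[of 0] l by (simp add: u_def v_def)
      moreover have "r = Suc (i + k + 1)" by (simp add: r_def)
      ultimately show "in_arc (w (Suc r)) (\<eta> r)" "in_arc (w (Suc r)) (\<xi> ?r3)"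
        using \<xi>_in[of ?r3] \<eta>_in[of "i + k + 1"] by metis+
    qed
    have rN: "r \<ge> N" using i by (simp add: r_def)
    have nd: "\<not> (3 :: nat) dvd Suc (Suc 0)" by presburger
    consider "w r = 2" "w (Suc r) = Suc 0" "w ?r2 = 0"
      | "w r = 0" "w (Suc r) = 2" "w ?r2 = Suc 0"
      | "w r = Suc 0" "w (Suc r) = 0" "w ?r2 = 2"
      using letter_cases[OF w_le[of ?r2]] l(1,2) nd by (elim disjE) auto
    then show False
    proof cases
      case 1
      have "\<xi> ?r3 = \<xi> r - (p + q + t)"
        using shift_down'[OF 1(1,2)] 1(3) by (simp add: \<xi>_Suc[of ?r2])
      then show False using g N[OF rN] \<epsilon>' \<epsilon>'_le by (simp add: abs_le_iff)
    next
      case 2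
      have x: "T 0 (\<xi> ?r3) = \<xi> (Suc r) - (p + q + t)" by (rule shift_down'[OF 2(2,3)])
      have y: "\<eta> (Suc r) = T 0 (\<eta> r)" using 2(1) by (simp add: \<eta>_Suc[of r])
      have "T 0 (\<xi> ?r3) - T 0 (\<eta> r) \<ge> lower_const M * \<epsilon>"
        by (rule T_lower[OF same_side[OF _ w_le _ c]]) (use g \<epsilon> M_pos N[OF rN] N[of ?r3] rN 2 in auto)
      then show False using x y N[of "Suc r"] rN \<epsilon>' \<epsilon>'_le by (simp add: abs_le_iff)
    next
      case 3
      define z where "z = \<xi> ?r3"
      have c': "\<eta> r < 0" "z < 0" using c 3 by (auto simp: in_arc_simps z_def)
      have I1: "in_arc (Suc 0) (T (Suc 0) (\<eta> r))" "in_arc (Suc 0) (T (Suc 0) z)"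
        using T_in[of "Suc 0" 0] c' by (auto simp: in_arc_simps)
      have x: "T 0 (T (Suc 0) z) = \<xi> ?r2 - (p + q + t)"
        unfolding z_def by (rule shift_down[OF 3(3)]) (use in_arc_ne_0[OF I1(2)] c' p in \<open>auto simp: z_def\<close>)
      have y: "\<eta> ?r2 = T 0 (T (Suc 0) (\<eta> r))" using 3 by (simp add: \<eta>_Suc)
      have g1: "T (Suc 0) z - T (Suc 0) (\<eta> r) \<ge> lower_const M * \<epsilon>"
        by (rule T_lower[OF same_side[OF _ w_le _ c, folded z_def]])
          (use g \<epsilon> M_pos N[OF rN] N[of ?r3] rN 3 in \<open>auto simp: z_def\<close>)
      have "T 0 (T (Suc 0) z) - T 0 (T (Suc 0) (\<eta> r)) \<ge> lower_const M * (lower_const M * \<epsilon>)"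
        by (rule T_lower[OF same_side[OF _ _ _ I1]])
          (use g1 \<epsilon> M_pos lower_const_pos[OF M_pos] I1 p q t in \<open>auto simp: in_arc_simps\<close>)
      then show False using x y N[of ?r2] rN \<epsilon>' \<epsilon>'_le by (simp add: abs_le_iff)
    qed
  qed
  then show ?thesis unfolding eventually_sequentially by blast
qed

end

text \<open>The reflection of the line at \<open>(p + q) / 2\<close> exchanges \<open>p\<close> with
  \<open>q\<close> and the letters 0 and 2, hence up with down turns. The statements for the other
  orientation follow from it.\<close>

lemma (in tri) tri_swap: "tri q p t"
  using p q t by unfold_locales

lemma (in tri) T_swap:
  assumes "i \<le> 2"
  shows "tri.T q p t (2 - i) (p + q - x) = p + q - T i x"
proof -
  interpret r: tri q p t by (rule tri_swap)
  have e: "p + q - x - (q + p) = - x" by simp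
  show ?thesis using letter_cases[OF assms]
  proof (elim disjE)
    assume "i = 0"
    then show ?thesis unfolding T_def r.T_def by (simp add: PK_simps r.PK_simps e)
  next
    assume "i = Suc 0"
    moreover have "p * q / (x - p) = - (p * q / (p - x))" by (metis minus_diff_eq minus_divide_right)
    ultimately show ?thesis unfolding T_def r.T_def
      by (simp add: PK_simps r.PK_simps mult.commute)
  next
    assume "i = 2"
    moreover have "t * q / (x - (p + q)) = - (t * q / (p + q - x))" by (metis minus_diff_eq minus_divide_right)
    ultimately show ?thesis unfolding T_def r.T_def by (simp add: PK_simps r.PK_simps)
  qed
qed

lemma (in tri) in_arc_swap: "i \<le> 2 \<Longrightarrow> tri.in_arc q p (2 - i) (p + q - x) \<longleftrightarrow> in_arc i x"
proof -
  assume i: "i \<le> 2"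
  interpret r: tri q p t by (rule tri_swap)
  show ?thesis using letter_cases[OF i] by (auto simp: in_arc_simps r.in_arc_simps)
qed

lemma (in tri) P_swap: "i \<le> 2 \<Longrightarrow> tri.P q p (2 - i) = p + q - P i"
proof -
  assume i: "i \<le> 2"
  interpret r: tri q p t by (rule tri_swap)
  show ?thesis using letter_cases[OF i] by (auto simp: PK_simps r.PK_simps)
qed

context orbit
begin

lemma orbit_swap: "orbit q p t (\<lambda>n. p + q - \<xi> n) (\<lambda>n. p + q - \<eta> n) (\<lambda>n. 2 - w n)"
proof -
  interpret r: tri q p t by (rule tri_swap)
  show ?thesis
  proof
    fix n
    show "2 - w n \<le> 2" by simp
    show "2 - w (Suc n) \<noteq> 2 - w n" using w_le[of n] w_le[of "Suc n"] w_ne[of n] by linarith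
    show "r.in_arc (2 - w n) (p + q - \<xi> n)" "r.in_arc (2 - w n) (p + q - \<eta> (Suc n))"
      using \<xi>_in \<eta>_in in_arc_swap[OF w_le] by auto
    show "p + q - \<xi> n \<noteq> r.P (2 - w n)" "p + q - \<eta> n \<noteq> r.P (2 - w n)"
      using \<xi>_P \<eta>_P P_swap[OF w_le] by auto
    show "p + q - \<xi> (Suc n) = r.T (2 - w n) (p + q - \<xi> n)" "p + q - \<eta> (Suc n) = r.T (2 - w n) (p + q - \<eta> n)"
      using \<xi>_Suc \<eta>_Suc T_swap[OF w_le] by auto
  next
    fix h assume "q + p + t < h"
    then have "eventually (\<lambda>n. \<bar>\<eta> n - \<xi> n\<bar> \<le> h) sequentially" by (intro height) simp
    moreover have "\<bar>p + q - \<eta> n - (p + q - \<xi> n)\<bar> = \<bar>\<eta> n - \<xi> n\<bar>" for n by linarith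
    ultimately show "eventually (\<lambda>n. \<bar>p + q - \<eta> n - (p + q - \<xi> n)\<bar> \<le> h) sequentially" by simp
  qed
qed

lemma turn_swap: "turn (\<lambda>n. 2 - w n) n \<longleftrightarrow> \<not> turn w n"
proof -
  have nd: "\<not> (3 :: nat) dvd Suc (Suc 0)" by presburger
  show ?thesis
    using letter_cases[OF w_le[of n]] letter_cases[OF w_le[of "Suc n"]] w_ne[of n] nd
    unfolding turn_def by (elim disjE) auto
qed

lemma no_run: "eventually (\<lambda>n. \<not> (turn w n = s \<and> turn w (Suc n) = s \<and> turn w (Suc (Suc n)) = s)) sequentially"
proof (cases s)
  case False
  show ?thesis using no_down_run by (rule eventually_mono) (use False in auto)
next
  case True
  interpret r: orbit q p t "\<lambda>n. p + q - \<xi> n" "\<lambda>n. p + q - \<eta> n" "\<lambda>n. 2 - w n" by (rule orbit_swap)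
  show ?thesis using r.no_down_run by (rule eventually_mono) (use True turn_swap in auto)
qed

lemma no_mirror: "eventually (\<lambda>n. \<not> mirror_at k s n) sequentially"
proof (cases s)
  case False
  show ?thesis using no_down_mirror by (rule eventually_mono) (use False in auto)
next
  case True
  interpret r: orbit q p t "\<lambda>n. p + q - \<xi> n" "\<lambda>n. p + q - \<eta> n" "\<lambda>n. 2 - w n" by (rule orbit_swap)
  show ?thesis using r.no_down_mirror[of k]
    by (rule eventually_mono) (use True turn_swap in \<open>auto simp: mirror_at_def r.mirror_at_def\<close>)
qed

text \<open>A window of length \<open>L\<close> has room only for patterns with
  \<open>k \<le> L\<close>, so finitely many eventual statements can be combined.\<close>

lemma eventually_not_crossing: "eventually (\<lambda>n. \<not> crossing (map (turn w) [n..<n + L])) sequentially"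
proof -
  have "eventually (\<lambda>n. \<forall>s k. k \<le> L \<longrightarrow> \<not> mirror_at k s n) sequentially"
  proof -
    have "eventually (\<lambda>n. \<forall>z\<in>{..L} \<times> (UNIV :: bool set). \<not> mirror_at (fst z) (snd z) n) sequentially"
      by (rule eventually_ball_finite) (use no_mirror in auto)
    then show ?thesis by (rule eventually_mono) auto
  qed
  moreover have "eventually (\<lambda>n. \<forall>s. \<not> (turn w n = s \<and> turn w (Suc n) = s \<and> turn w (Suc (Suc n)) = s)) sequentially"
    using eventually_conj[OF no_run[of True] no_run[of False]] by (rule eventually_mono) auto
  ultimately have "eventually (\<lambda>n. (\<forall>s k. k \<le> L \<longrightarrow> \<not> mirror_at k s n) \<and>
      (\<forall>s. \<not> (turn w n = s \<and> turn w (Suc n) = s \<and> turn w (Suc (Suc n)) = s))) sequentially"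
    by (rule eventually_conj)
  then obtain N where N': "\<forall>n\<ge>N. (\<forall>s k. k \<le> L \<longrightarrow> \<not> mirror_at k s n) \<and>
      (\<forall>s. \<not> (turn w n = s \<and> turn w (Suc n) = s \<and> turn w (Suc (Suc n)) = s))"
    unfolding eventually_sequentially ..
  have N: "\<not> mirror_at k s n" "\<not> (turn w n = s \<and> turn w (Suc n) = s \<and> turn w (Suc (Suc n)) = s)"
    if "n \<ge> N" "k \<le> L" for n s k
    using N'[rule_format, OF that(1)] that(2) by auto
  have "\<not> crossing (map (turn w) [n..<n + L])" if n: "n \<ge> N" for n
  proof
    assume "crossing (map (turn w) [n..<n + L])"
    then obtain u s d v where b: "map (turn w) [n..<n + L] = u @ [s, s, s] @ v \<or>
       map (turn w) [n..<n + L] = u @ [s] @ rev (map Not d) @ [\<not> s, s, s, \<not> s] @ d @ [s] @ v" (is "?a \<or> ?b")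
      unfolding crossing_def by blast
    have nth: "map (turn w) [n..<n + L] ! i = turn w (n + i)" if "i < L" for i using that by simp
    from b show False
    proof
      assume a: ?a
      have "length (map (turn w) [n..<n + L]) = length (u @ [s, s, s] @ v)" by (rule arg_cong[OF a])
      then have len: "L = length u + 3 + length v" by simp
      have "turn w (n + (length u + i)) = s" if "i < 3" for i
      proof -
        have "turn w (n + (length u + i)) = (u @ [s, s, s] @ v) ! (length u + i)"
          unfolding a[symmetric] by (rule nth[symmetric]) (use that len in simp)
        also have "\<dots> = s" using that by (auto simp: nth_append numeral_3_eq_3 less_Suc_eq)
        finally show ?thesis .
      qed
      from this[of 0] this[of 1] this[of 2] show False using N(2)[of "n + length u" 0 s] n by simp
    next
      assume a: ?b
      define k where "k = length d"
      define W where "W = [s] @ rev (map Not d) @ [\<not> s, s, s, \<not> s] @ d @ [s]"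
      have "length (map (turn w) [n..<n + L]) = length (u @ W @ v)" unfolding a W_def by simp
      then have len: "L = length u + (2 * k + 6) + length v" by (simp add: W_def k_def)
      define i where "i = n + length u"
      have lW: "length W = 2 * k + 6" by (simp add: W_def k_def)
      have tW: "turn w (i + m) = W ! m" if "m < 2 * k + 6" for m
      proof -
        have "turn w (n + (length u + m)) = map (turn w) [n..<n + L] ! (length u + m)"
          by (rule nth[symmetric]) (use that len in simp)
        also have "map (turn w) [n..<n + L] = u @ W @ v" unfolding a W_def by simp
        also have "\<dots> ! (length u + m) = W ! m" using that lW by (simp add: nth_append)
        finally show ?thesis by (simp add: i_def add.assoc)
      qed
      have W1: "W ! (k + 1 + m) = ([\<not> s, s, s, \<not> s] @ d @ [s]) ! m" for m
        using nth_append_length_plus[of "[s] @ rev (map Not d)" "[\<not> s, s, s, \<not> s] @ d @ [s]" m]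
        by (simp add: W_def k_def)
      have W2: "W ! (k + 1 + (4 + m)) = (d @ [s]) ! m" for m
        unfolding W1 using nth_append_length_plus[of "[\<not> s, s, s, \<not> s]" "d @ [s]" m] by simp
      have tn: "turn w n' = b" if "n' = i + m" "m < 2 * k + 6" "W ! m = b" for m b n'
        using tW[OF that(2)] that(1,3) by simp
      have "mirror_at k s i"
        unfolding mirror_at_def
      proof (intro conjI allI impI)
        show "turn w i = s" using tW[of 0] by (simp add: W_def)
        show "turn w (i + k + 1) = (\<not> s)" by (rule tn[of _ "k + 1 + 0"]) (simp, simp, subst W1, simp)
        show "turn w (i + k + 2) = s" by (rule tn[of _ "k + 1 + 1"]) (simp, simp, subst W1, simp)
        show "turn w (i + k + 3) = s" by (rule tn[of _ "k + 1 + 2"]) (simp, simp, subst W1, simp)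
        show "turn w (i + k + 4) = (\<not> s)" by (rule tn[of _ "k + 1 + 3"]) (simp, simp, subst W1, simp)
        show "turn w (i + 2 * k + 5) = s"
          by (rule tn[of _ "k + 1 + (4 + k)"]) (simp, simp, subst W2, simp add: k_def)
        fix j assume j: "j < k"
        have "W ! (1 + j) = (\<not> d ! (k - 1 - j))" using j by (simp add: W_def nth_append k_def rev_nth)
        then have 1: "turn w (i + 1 + j) = (\<not> d ! (k - 1 - j))"
          by (intro tn[of _ "1 + j"]) (use j in auto)
        have "W ! (k + 1 + (4 + (k - 1 - j))) = d ! (k - 1 - j)"
        proof -
          have "k - 1 - j < length d" using j by (simp add: k_def)
          then show ?thesis unfolding W2 by (simp only: nth_append if_True)
        qed
        then have 2: "turn w (i + 2 * k + 4 - j) = d ! (k - 1 - j)"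
          by (intro tn[of _ "k + 1 + (4 + (k - 1 - j))"]) (use j in auto)
        show "turn w (i + 1 + j) \<noteq> turn w (i + 2 * k + 4 - j)" unfolding 1 2 by simp
      qed
      then show False using N(1)[of i k s] n len by (simp add: i_def)
    qed
  qed
  then show ?thesis unfolding eventually_sequentially by blast
qed

end

section \<open>Coding and contraction\<close>

context tri
begin

definition code :: "real \<Rightarrow> nat" where
  "code x = (if x < 0 then 0 else if x < p + q then Suc 0 else 2)"

definition step :: "real \<Rightarrow> real" where
  "step x = T (code x) x"

definition pt :: "real \<Rightarrow> nat \<Rightarrow> real" where
  "pt x n = (step ^^ n) x"

definition letters :: "real \<Rightarrow> nat \<Rightarrow> nat" where
  "letters x n = code (pt x n)"

text \<open>All poles, among them the vertices 0 and \<open>p + q\<close>, are avoided at every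
  time, so that the code is unambiguous and no junk value of \<open>T\<close> is met.\<close>

definition good :: "real \<Rightarrow> bool" where
  "good x \<longleftrightarrow> (\<forall>n. pt x n \<notin> {0, p, p + q})"

lemma pt_0 [simp]: "pt x 0 = x"
  by (simp add: pt_def)

lemma pt_Suc: "pt x (Suc n) = T (letters x n) (pt x n)"
  by (simp add: pt_def letters_def step_def)

lemma pt_Suc_step: "pt x (Suc n) = pt (step x) n"
  by (simp add: pt_def funpow_Suc_right del: funpow.simps)

lemma letters_Suc_step: "letters x (Suc n) = letters (step x) n"
  by (simp add: letters_def pt_Suc_step)

lemma good_step: "good x \<Longrightarrow> good (step x)"
  unfolding good_def pt_Suc_step[symmetric] by blast

lemma letters_le: "letters x n \<le> 2"
  by (simp add: letters_def code_def)

lemma in_arc_code: "x \<noteq> 0 \<Longrightarrow> x \<noteq> p + q \<Longrightarrow> in_arc (code x) x"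
  using p q by (auto simp: code_def in_arc_def)

lemma good_in: "good x \<Longrightarrow> in_arc (letters x n) (pt x n)"
  unfolding letters_def good_def by (intro in_arc_code) blast+

lemma good_ne_P: "good x \<Longrightarrow> pt x n \<noteq> P i"
  unfolding good_def P_def by auto

lemma letters_ne: "good x \<Longrightarrow> letters x (Suc n) \<noteq> letters x n"
  using T_notin[OF letters_le good_in good_ne_P] good_in[of x "Suc n"] unfolding pt_Suc by metis

text \<open>Contraction degenerates only at the common end points of the arcs, which are 0,
  \<open>p + q\<close> and infinity.\<close>

definition in_core :: "real \<Rightarrow> real \<Rightarrow> real \<Rightarrow> bool" where
  "in_core M \<delta> x \<longleftrightarrow> \<bar>x\<bar> \<le> M \<and> \<delta> \<le> \<bar>x\<bar> \<and> \<delta> \<le> \<bar>x - (p + q)\<bar>"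

text \<open>Density of the Hilbert metric of the interval with label \<open>i\<close>.\<close>

definition density :: "nat \<Rightarrow> real \<Rightarrow> real" where
  "density i x = (if i = 0 then 1 / (- x) else if i = 1 then (p + q) / (x * (p + q - x)) else 1 / (x - (p + q)))"

text \<open>Each ratio of densities below has the form \<open>1 - a / b\<close> with
  \<open>a\<close> at least \<open>\<delta>\<close> or equal to \<open>p + q\<close>, and
  \<open>b\<close> at most \<open>p + q + M\<close>.\<close>

definition rate :: "real \<Rightarrow> real \<Rightarrow> real" where
  "rate M \<delta> = 1 - min \<delta> (p + q) / (p + q + M)"

lemma rate_bounds: "M > 0 \<Longrightarrow> \<delta> > 0 \<Longrightarrow> 0 < rate M \<delta>" "M > 0 \<Longrightarrow> \<delta> > 0 \<Longrightarrow> rate M \<delta> < 1"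
  using p q by (auto simp: rate_def min_def divide_simps)

lemma density_pos: "in_arc i x \<Longrightarrow> i \<le> 2 \<Longrightarrow> density i x > 0"
  using p q by (auto dest!: letter_cases simp: density_def in_arc_simps divide_pos_neg intro!: divide_pos_pos mult_pos_pos)

text \<open>\<open>T i\<close> carries the outside of arc \<open>i\<close> onto arc
  \<open>i\<close>. The pulled back density is therefore the Hilbert density of that outside, which
  passes through infinity for \<open>i = 1\<close>.\<close>

lemma density_T:
  assumes "i \<le> 2" "j \<le> 2" "i \<noteq> j" "in_arc j x"
  shows "density i (T i x) * (K i / (x - P i)\<^sup>2) =
    (if i = 0 then 1 / x else if i = 1 then (p + q) / (x * (x - (p + q))) else 1 / (p + q - x))"
proof -
  consider "i = 0" "x > 0" | "i = 1" "x < 0 \<or> x > p + q" | "i = 2" "x < p + q"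
    using letter_cases[OF assms(1)] letter_cases[OF assms(2)] assms(3,4) p q by (auto simp: in_arc_def)
  then show ?thesis
  proof cases
    case 1
    then show ?thesis using p t by (simp add: density_def T_simps PK_simps power2_eq_square)
  next
    case 3
    have "density 2 (T 2 x) = (p + q - x) / (t * q)" unfolding density_def T_simps
      using 3 t q by (simp add: field_simps)
    moreover have "(x - (p + q))\<^sup>2 = (p + q - x) * (p + q - x)" by (simp add: power2_eq_square algebra_simps)
    ultimately show ?thesis using 3 t q by (simp add: PK_simps)
  next
    case 2
    define y where "y = x - p"
    define z where "z = x - (p + q)"
    have nz: "y \<noteq> 0" "z \<noteq> 0" "x \<noteq> 0" "x \<noteq> p" using 2 p q by (auto simp: y_def z_def)
    have "density (Suc 0) (T (Suc 0) x) = (p + q) / ((p * z / y) * (q * x / y))"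
      unfolding density_def T1_eq(2)[OF nz(4)] unfolding T1_eq(1)[OF nz(4)] by (simp add: y_def z_def)
    also have "\<dots> = (p + q) * y\<^sup>2 / (p * q * x * z)" by (simp add: power2_eq_square)
    finally have "density (Suc 0) (T (Suc 0) x) * (p * q / y\<^sup>2) = (p + q) / (x * z)"
      using nz p q by simp
    then show ?thesis using 2 by (simp add: PK_simps y_def z_def)
  qed
qed

text \<open>Arc \<open>j\<close> is a proper part of the outside of arc \<open>i\<close>, and a
  smaller interval has a larger Hilbert density. The ratio tends to 1 only at the end point that
  both intervals share.\<close>

lemma density_contract:
  assumes "i \<le> 2" "j \<le> 2" "i \<noteq> j" "in_arc j x" "in_core M \<delta> x" "M > 0" "\<delta> > 0"
  shows "density i (T i x) * (K i / (x - P i)\<^sup>2) \<le> rate M \<delta> * density j x"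
proof -
  define D where "D = p + q"
  have D: "D > 0" using p q by (simp add: D_def)
  have fr: "1 - a / b \<le> rate M \<delta>" if "a \<ge> min \<delta> D" "0 < b" "b \<le> D + M" for a b
  proof -
    have "min \<delta> D / (D + M) \<le> a / b" using that assms(7) D by (intro frac_le) (auto simp: min_def split: if_splits)
    then show ?thesis by (simp add: rate_def D_def)
  qed
  have k: "\<bar>x\<bar> \<le> M" "\<delta> \<le> \<bar>x\<bar>" "\<delta> \<le> \<bar>x - D\<bar>" using assms(5) by (auto simp: in_core_def D_def)
  have "\<exists>r. (if i = 0 then 1 / x else if i = 1 then D / (x * (x - D)) else 1 / (D - x)) = r * density j x \<and> r \<le> rate M \<delta>"
  proof -
    consider "j = Suc 0" "i = 0" "0 < x" "x < D" | "j = 2" "i = 0" "x > D" | "j = 0" "i = 2" "x < 0"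
      | "j = Suc 0" "i = 2" "0 < x" "x < D" | "j = 0" "i = Suc 0" "x < 0" | "j = 2" "i = Suc 0" "x > D"
      using letter_cases[OF assms(1)] letter_cases[OF assms(2)] assms(3,4) by (auto simp: in_arc_def D_def)
    then show ?thesis
    proof cases
      case 1
      then show ?thesis using D k by (intro exI[of _ "1 - x / D"] conjI fr) (auto simp: density_def D_def[symmetric] field_simps)
    next
      case 2
      then show ?thesis using D k by (intro exI[of _ "1 - D / x"] conjI fr) (auto simp: density_def D_def[symmetric] field_simps)
    next
      case 3
      then show ?thesis using D k by (intro exI[of _ "1 - D / (D - x)"] conjI fr) (auto simp: density_def D_def[symmetric] field_simps)
    next
      case 4
      then show ?thesis using D k by (intro exI[of _ "1 - (D - x) / D"] conjI fr) (auto simp: density_def D_def[symmetric] field_simps)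
    next
      case 5
      then show ?thesis using D k by (intro exI[of _ "1 - (- x) / (D - x)"] conjI fr) (auto simp: density_def D_def[symmetric] field_simps)
    next
      case 6
      then show ?thesis using D k by (intro exI[of _ "1 - (x - D) / x"] conjI fr) (auto simp: density_def D_def[symmetric] field_simps)
    qed
  qed
  then obtain r where r: "(if i = 0 then 1 / x else if i = 1 then D / (x * (x - D)) else 1 / (D - x)) = r * density j x"
    "r \<le> rate M \<delta>" by blast
  show ?thesis unfolding density_T[OF assms(1-4)] unfolding D_def[symmetric] r(1)
    using r(2) density_pos[OF assms(4,2)] by (intro mult_right_mono) auto
qed

text \<open>Not a metric: if \<open>d\<close> is the Hilbert distance, this equals
  \<open>4 * (sinh (d / 2))\<^sup>2\<close>. It needs neither logarithms nor integrals.\<close>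

definition hilbert_dist :: "nat \<Rightarrow> real \<Rightarrow> real \<Rightarrow> real" where
  "hilbert_dist i x y = (x - y)\<^sup>2 * density i x * density i y"

text \<open>For a Moebius map the squared difference of two images is exactly the squared difference
  times both derivatives, so the infinitesimal contraction at the two points is enough.\<close>

lemma hilbert_dist_contract:
  assumes "i \<le> 2" "j \<le> 2" "i \<noteq> j" "in_arc j x" "in_arc j y" "in_core M \<delta> x" "in_core M \<delta> y" "M > 0" "\<delta> > 0"
  shows "hilbert_dist i (T i x) (T i y) \<le> (rate M \<delta>)\<^sup>2 * hilbert_dist j x y"
proof -
  have ne: "x \<noteq> P i" "y \<noteq> P i" using in_arc_ne_P assms by blast+
  have "hilbert_dist i (T i x) (T i y) = (x - y)\<^sup>2 * ((density i (T i x) * (K i / (x - P i)\<^sup>2)) * (density i (T i y) * (K i / (y - P i)\<^sup>2)))"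
    unfolding hilbert_dist_def T_diff[OF ne] by (simp add: power_divide power_mult_distrib power2_eq_square mult_ac)
  also have "\<dots> \<le> (x - y)\<^sup>2 * ((rate M \<delta> * density j x) * (rate M \<delta> * density j y))"
  proof (rule mult_left_mono[OF mult_mono])
    show "density i (T i x) * (K i / (x - P i)\<^sup>2) \<le> rate M \<delta> * density j x"
      "density i (T i y) * (K i / (y - P i)\<^sup>2) \<le> rate M \<delta> * density j y"
      by (rule density_contract; fact)+
    show "0 \<le> rate M \<delta> * density j x" using rate_bounds(1)[OF assms(8,9)] density_pos[OF assms(4,2)] by simp
    have "density i (T i y) > 0" by (rule density_pos[OF T_in[OF assms(1-3,5)] assms(1)])
    then show "0 \<le> density i (T i y) * (K i / (y - P i)\<^sup>2)" using K_pos[of i] by simp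
  qed simp
  also have "\<dots> = (rate M \<delta>)\<^sup>2 * hilbert_dist j x y" by (simp add: hilbert_dist_def power2_eq_square)
  finally show ?thesis .
qed

lemma hilbert_dist_iterate:
  assumes "M > 0" "\<delta> > 0" "good x" "good y" "\<And>n. in_core M \<delta> (pt x n)" "\<And>n. in_core M \<delta> (pt y n)"
    "\<And>m. m \<le> n \<Longrightarrow> letters x m = letters y m"
  shows "hilbert_dist (letters x 0) x y \<le> (rate M \<delta>) ^ (2 * n) * hilbert_dist (letters x n) (pt x n) (pt y n)"
  using assms(3-7)
proof (induction n arbitrary: x y)
  case (Suc n)
  have l: "letters x 0 = letters y 0" "letters x (Suc 0) = letters y (Suc 0)" using Suc.prems(5) by auto
  have s: "step x = pt x (Suc 0)" "step y = pt y (Suc 0)" by (simp_all add: pt_def)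
  have b: "x = T (letters x 0) (step x)" "y = T (letters x 0) (step y)"
    using T_T[OF good_ne_P[OF Suc.prems(1), of 0 "letters x 0"]] T_T[OF good_ne_P[OF Suc.prems(2), of 0 "letters x 0"]]
    by (simp_all add: s pt_Suc l[symmetric])
  have "hilbert_dist (letters x 0) (T (letters x 0) (step x)) (T (letters x 0) (step y)) \<le> (rate M \<delta>)\<^sup>2 * hilbert_dist (letters x (Suc 0)) (step x) (step y)"
  proof (rule hilbert_dist_contract[OF letters_le letters_le _ _ _ _ _ assms(1,2)])
    show "letters x 0 \<noteq> letters x (Suc 0)" using letters_ne[OF Suc.prems(1), of 0] by simp
    show "in_arc (letters x (Suc 0)) (step x)" unfolding s by (rule good_in[OF Suc.prems(1)])
    show "in_arc (letters x (Suc 0)) (step y)" unfolding s l by (rule good_in[OF Suc.prems(2)])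
    show "in_core M \<delta> (step x)" "in_core M \<delta> (step y)" unfolding s by (rule Suc.prems)+
  qed
  also have "\<dots> = (rate M \<delta>)\<^sup>2 * hilbert_dist (letters (step x) 0) (step x) (step y)" by (simp add: letters_Suc_step)
  also have "\<dots> \<le> (rate M \<delta>)\<^sup>2 * ((rate M \<delta>) ^ (2 * n) * hilbert_dist (letters (step x) n) (pt (step x) n) (pt (step y) n))"
  proof (rule mult_left_mono[OF Suc.IH])
    fix m show "in_core M \<delta> (pt (step x) m)" "in_core M \<delta> (pt (step y) m)" unfolding pt_Suc_step[symmetric] by (rule Suc.prems)+
  next
    fix m assume "m \<le> n"
    then show "letters (step x) m = letters (step y) m" unfolding letters_Suc_step[symmetric] by (intro Suc.prems) simp
  qed (use Suc.prems good_step in auto)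
  also have "\<dots> = (rate M \<delta>) ^ (2 * Suc n) * hilbert_dist (letters x (Suc n)) (pt x (Suc n)) (pt y (Suc n))"
    by (simp add: pt_Suc_step letters_Suc_step power2_eq_square)
  finally show ?case using b by simp
qed simp

text \<open>On the core the density lies between positive constants, so the exponential contraction
  of \<open>hilbert_dist\<close> becomes one of Euclidean distance.\<close>

lemma cylinder_diameter:
  assumes M: "M > 0" "\<delta> > 0"
  shows "\<exists>C>0. \<forall>x y n. good x \<longrightarrow> good y \<longrightarrow> (\<forall>n. in_core M \<delta> (pt x n)) \<longrightarrow> (\<forall>n. in_core M \<delta> (pt y n)) \<longrightarrow>
    (\<forall>m\<le>n. letters x m = letters y m) \<longrightarrow> \<bar>x - y\<bar> \<le> C * rate M \<delta> ^ n"
proof -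
  define D where "D = p + q"
  have D: "D > 0" using p q by (simp add: D_def)
  define R where "R = 1 / \<delta> + D / \<delta>\<^sup>2"
  have R: "R > 0" using M D by (auto simp: R_def intro!: add_pos_pos divide_pos_pos)
  have up: "density i x \<le> R" if asm: "i \<le> 2" "in_arc i x" "in_core M \<delta> x" for i x
  proof -
    consider "i = 0" "x < 0" | "i = Suc 0" "0 < x" "x < D" | "i = 2" "D < x"
      using letter_cases[OF asm(1)] asm(2) by (auto simp: in_arc_simps D_def)
    then show ?thesis
    proof cases
      case 2
      then have "\<delta> \<le> x" "\<delta> \<le> D - x" using asm(3) by (auto simp: in_core_def D_def)
      then have "\<delta>\<^sup>2 \<le> x * (D - x)" unfolding power2_eq_square using M by (intro mult_mono) auto
      then have "D / (x * (D - x)) \<le> D / \<delta>\<^sup>2" using D M by (intro frac_le) auto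
      then show ?thesis using 2 M by (simp add: density_def R_def D_def add_increasing)
    next
      case 1
      then have "1 / (- x) \<le> 1 / \<delta>" using asm(3) M by (intro divide_left_mono) (auto simp: in_core_def intro: mult_neg_pos)
      then show ?thesis using 1 M D by (simp add: density_def R_def add_increasing2)
    next
      case 3
      then have "1 / (x - D) \<le> 1 / \<delta>" using asm(3) M by (intro divide_left_mono) (auto simp: in_core_def D_def)
      then show ?thesis using 3 M D by (simp add: density_def R_def D_def add_increasing2)
    qed
  qed
  have low: "1 / (M + D) \<le> density i x" if asm: "i \<le> 2" "in_arc i x" "in_core M \<delta> x" for i x
  proof -
    consider "i = 0" "x < 0" | "i = Suc 0" "0 < x" "x < D" | "i = 2" "D < x"
      using letter_cases[OF asm(1)] asm(2) by (auto simp: in_arc_simps D_def)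
    then show ?thesis
    proof cases
      case 2
      have "1 / (M + D) \<le> 1 / (D - x)" using 2 M by (intro divide_left_mono) auto
      also have "\<dots> = x / (x * (D - x))" using 2 by simp
      also have "\<dots> \<le> D / (x * (D - x))" using 2 by (intro divide_right_mono) auto
      finally show ?thesis using 2 by (simp add: density_def D_def)
    next
      case 1
      then have "1 / (M + D) \<le> 1 / (- x)" using asm(3) M D by (intro frac_le) (auto simp: in_core_def)
      then show ?thesis using 1 by (simp add: density_def)
    next
      case 3
      then show ?thesis using asm(3) M D by (auto simp: density_def in_core_def D_def intro!: frac_le)
    qed
  qed
  \<comment> \<open>Square root of the constants that arise: \<open>M + D\<close> from the lower
    bound of the density at time 0, \<open>2 * M\<close> from the distance and \<open>R\<close> from
    the density at time \<open>n\<close>.\<close>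
  define C where "C = (M + D) * (2 * M * R)"
  have C: "C > 0" using M D R by (simp add: C_def)
  have "\<bar>x - y\<bar> \<le> C * rate M \<delta> ^ n" if a: "good x" "good y" "\<And>n. in_core M \<delta> (pt x n)" "\<And>n. in_core M \<delta> (pt y n)"
    "\<And>m. m \<le> n \<Longrightarrow> letters x m = letters y m" for x y n
  proof -
    have ix: "in_arc (letters x m) (pt x m)" "in_arc (letters x m) (pt y m)" if "m \<le> n" for m
      using good_in a that by metis+
    have "(x - y)\<^sup>2 * (1 / (M + D) * (1 / (M + D))) \<le> hilbert_dist (letters x 0) x y"
      unfolding hilbert_dist_def mult.assoc
      using ix[of 0] a(3)[of 0] a(4)[of 0] M D
      by (intro mult_left_mono mult_mono low letters_le) (auto intro!: less_imp_le[OF density_pos] letters_le)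
    also have "\<dots> \<le> (rate M \<delta>) ^ (2 * n) * hilbert_dist (letters x n) (pt x n) (pt y n)"
      by (rule hilbert_dist_iterate[OF M a])
    also have "\<dots> \<le> (rate M \<delta>) ^ (2 * n) * ((2 * M)\<^sup>2 * (R * R))"
    proof (rule mult_left_mono)
      have "\<bar>pt x n - pt y n\<bar> \<le> 2 * M" using a(3)[of n] a(4)[of n] by (auto simp: in_core_def)
      then have "(pt x n - pt y n)\<^sup>2 \<le> (2 * M)\<^sup>2" by (metis abs_le_square_iff abs_of_pos M(1) mult_pos_pos zero_less_numeral)
      then show "hilbert_dist (letters x n) (pt x n) (pt y n) \<le> (2 * M)\<^sup>2 * (R * R)"
        unfolding hilbert_dist_def mult.assoc using ix[of n] a(3)[of n] a(4)[of n] R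
        by (intro mult_mono up letters_le) (auto intro!: less_imp_le[OF density_pos] letters_le mult_nonneg_nonneg)
      show "0 \<le> rate M \<delta> ^ (2 * n)" using rate_bounds(1)[OF M] by simp
    qed
    finally have "(x - y)\<^sup>2 / (M + D)\<^sup>2 \<le> (rate M \<delta>) ^ (2 * n) * ((2 * M)\<^sup>2 * R\<^sup>2)"
      by (simp add: power2_eq_square)
    then have "(x - y)\<^sup>2 \<le> (M + D)\<^sup>2 * ((rate M \<delta>) ^ (2 * n) * ((2 * M)\<^sup>2 * R\<^sup>2))"
      using M D by (simp add: field_simps)
    also have "\<dots> = (C * rate M \<delta> ^ n)\<^sup>2" by (simp add: C_def power_mult_distrib power_mult[symmetric] mult.commute)
    finally have "\<bar>x - y\<bar> \<le> \<bar>C * rate M \<delta> ^ n\<bar>" by (simp add: abs_le_square_iff)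
    then show ?thesis using C rate_bounds(1)[OF M] by simp
  qed
  then show ?thesis using C by blast
qed

lemma letters_eq:
  assumes "good x" "good y" "code x = code y" "\<And>n. n < m \<Longrightarrow> turn (letters x) n = turn (letters y) n"
  shows "letters x m = letters y m"
  using assms(4)
proof (induction m)
  case 0
  then show ?case using assms(3) by (simp add: letters_def)
next
  case (Suc m)
  have down: "letters z (Suc m) = (letters z m + 2) mod 3" if "good z" "\<not> turn (letters z) m" for z
  proof -
    have n: "(0 + 1) mod 3 = Suc 0" "(Suc 0 + 1) mod 3 = 2" "(2 + 1) mod 3 = (0 :: nat)"
      "(0 + 2) mod 3 = (2 :: nat)" "(Suc 0 + 2) mod 3 = 0" "(2 + 2) mod 3 = Suc 0" by simp_all
    have "letters z (Suc m) \<noteq> letters z m" "letters z (Suc m) \<noteq> (letters z m + 1) mod 3"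
      using letters_ne[OF that(1), of m] that(2) by (auto simp: turn_def)
    then show ?thesis
      using letter_cases[OF letters_le[of z m]] letter_cases[OF letters_le[of z "Suc m"]] n by metis
  qed
  have IH: "letters x m = letters y m" using Suc by simp
  show ?case
  proof (cases "turn (letters x) m")
    case True
    then have "turn (letters y) m" using Suc.prems[of m] by simp
    with True show ?thesis using IH by (simp add: turn_def)
  next
    case False
    then have "\<not> turn (letters y) m" using Suc.prems[of m] by simp
    with False show ?thesis using IH down assms(1,2) by simp
  qed
qed

text \<open>All constants are uniform here, which makes finite covers by cylinders of one common
  size possible.\<close>

definition tail_set :: "real \<Rightarrow> real \<Rightarrow> nat \<Rightarrow> nat \<Rightarrow> real set" where
  "tail_set M \<delta> N L = {x. good x \<and> (\<forall>n. in_core M \<delta> (pt x n)) \<and>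
     (\<forall>n\<ge>N. \<not> crossing (map (turn (letters x)) [n..<n + L]))}"

text \<open>The code after time \<open>N\<close> is cut into windows of length \<open>L\<close>. If
  \<open>L\<close> is large, the number of admissible windows times the contracted size to the power
  \<open>s\<close> is at most 1/2, and every further window halves the covering sum.\<close>

lemma tail_set_null:
  assumes s: "s > 0" and M: "M > 0" "\<delta> > 0"
  shows "\<exists>L. \<forall>N. hausdorff_measure s (tail_set M \<delta> N L) = 0"
proof -
  define l where "l = rate M \<delta>"
  have l: "0 < l" "l < 1" using rate_bounds[OF M] by (simp_all add: l_def)
  obtain C where C: "C > 0" and diam: "\<And>x y n. good x \<Longrightarrow> good y \<Longrightarrow> (\<And>n. in_core M \<delta> (pt x n)) \<Longrightarrow> (\<And>n. in_core M \<delta> (pt y n)) \<Longrightarrow>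
    (\<And>m. m \<le> n \<Longrightarrow> letters x m = letters y m) \<Longrightarrow> \<bar>x - y\<bar> \<le> C * l ^ n"
    using cylinder_diameter[OF M] unfolding l_def by metis
  \<comment> \<open>Half of the exponent \<open>s\<close> absorbs the number of words, the other
    half provides the decay in \<open>L\<close>.\<close>
  define r where "r = l powr (s / 2)"
  have r: "0 < r" "r < 1" using l s powr_less_mono2[of "s / 2" l 1] by (auto simp: r_def)
  have rr: "(l ^ n) powr s = r ^ n * r ^ n" for n
  proof -
    have "(l ^ n) powr s = (l powr s) ^ n" using l(1) by (simp add: powr_realpow[symmetric] powr_powr mult.commute)
    also have "l powr s = r * r" using l(1) by (simp add: r_def powr_add[symmetric])
    finally show ?thesis by (simp add: power_mult_distrib)
  qed
  define m where "m L = card {w. \<not> crossing w \<and> length w = L}" for L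
  obtain C0 where C0: "\<And>L. real (m L) * r ^ L \<le> C0" using card_noncrossing[OF r] unfolding m_def by blast
  have "(\<lambda>L. C0 * r ^ L) \<longlonglongrightarrow> C0 * 0" using r by (intro tendsto_mult tendsto_const LIMSEQ_realpow_zero) auto
  then have "eventually (\<lambda>L. C0 * r ^ L < 1 / 2) sequentially" by (rule order_tendstoD(2)) simp
  then obtain L where L: "C0 * r ^ L < 1 / 2" "L \<ge> 1"
    using eventually_conj[OF _ eventually_ge_at_top[of 1]] by (metis (mono_tags, lifting) eventually_sequentially order_refl)
  have mL: "real (m L) * (l ^ L) powr s \<le> 1 / 2"
  proof -
    have "real (m L) * (l ^ L) powr s = real (m L) * r ^ L * r ^ L" by (simp add: rr)
    also have "\<dots> \<le> C0 * r ^ L" using C0[of L] r by (intro mult_right_mono) auto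
    finally show ?thesis using L by simp
  qed
  have "hausdorff_measure s (tail_set M \<delta> N L) = 0" for N
  proof (rule hausdorff_measure_0_if_finite_covers[OF s])
    fix \<epsilon> :: real assume \<epsilon>: "\<epsilon> > 0"
    define B where "B = 3 * 2 ^ N * C powr s"
    have lL: "0 < l ^ L" "l ^ L < 1" using l L(2) by (auto simp: power_Suc_less_one intro: power_less_one_iff[THEN iffD2])
    have "(\<lambda>k. C * (l ^ L) ^ k) \<longlonglongrightarrow> C * 0" using lL by (intro tendsto_mult tendsto_const LIMSEQ_realpow_zero) auto
    then have 1: "eventually (\<lambda>k. C * (l ^ L) ^ k < \<epsilon>) sequentially" by (rule order_tendstoD(2)) (use \<epsilon> in simp)
    have "(\<lambda>k. B * (1 / 2) ^ k) \<longlonglongrightarrow> B * 0" by (intro tendsto_mult tendsto_const LIMSEQ_realpow_zero) auto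
    then have 2: "eventually (\<lambda>k. B * (1 / 2) ^ k < \<epsilon>) sequentially" by (rule order_tendstoD(2)) (use \<epsilon> in simp)
    obtain k where k: "C * (l ^ L) ^ k < \<epsilon>" "B * (1 / 2) ^ k < \<epsilon>"
      using eventually_conj[OF 1 2] unfolding eventually_sequentially by blast
    \<comment> \<open>The label fixes the first letter, the \<open>N\<close> unrestricted turns and
      \<open>k\<close> admissible windows, which determines the cylinder; there are at most
      \<open>3 * 2 ^ N * m L ^ k\<close> labels.\<close>
    define lab where "lab x = (code x, map (turn (letters x)) [0..<N],
        map (\<lambda>i. map (turn (letters x)) [N + i * L..<N + i * L + L]) [0..<k])" for x
    define S where "S = {0..2 :: nat} \<times> {w :: bool list. set w \<subseteq> UNIV \<and> length w = N} \<times>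
        {ws. set ws \<subseteq> {w. \<not> crossing w \<and> length w = L} \<and> length ws = k}"
    define Z where "Z = tail_set M \<delta> N L"
    have fin: "finite {w. \<not> crossing w \<and> length w = L}"
      by (rule finite_subset[OF _ finite_short_words[of L]]) (auto simp: short_words_def)
    have finS: "finite S" unfolding S_def using fin by (intro finite_cartesian_product finite_lists_length_eq) auto
    have cardS: "card S = 3 * (2 ^ N * m L ^ k)"
      unfolding S_def card_cartesian_product using fin
      by (subst card_lists_length_eq, simp)+ (simp add: m_def)
    have labS: "lab ` Z \<subseteq> S"
    proof
      fix z assume "z \<in> lab ` Z"
      then obtain x where x: "x \<in> Z" "z = lab x" by blast
      have "\<not> crossing (map (turn (letters x)) [N + i * L..<N + i * L + L])" for i
        using x(1) by (simp add: Z_def tail_set_def)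
      then show "z \<in> S" unfolding x(2) lab_def S_def by (auto simp: code_def)
    qed
    have lab_eq: "letters x n = letters y n" if xy: "x \<in> Z" "y \<in> Z" "lab x = lab y" "n \<le> N + k * L" for x y n
    proof (rule letters_eq)
      show "good x" "good y" using xy(1,2) by (simp_all add: Z_def tail_set_def)
      show "code x = code y" using xy(3) by (simp add: lab_def)
      fix j assume "j < n"
      then have j: "j < N + k * L" using xy(4) by simp
      show "turn (letters x) j = turn (letters y) j"
      proof (cases "j < N")
        case True
        have "map (turn (letters x)) [0..<N] = map (turn (letters y)) [0..<N]" using xy(3) by (simp add: lab_def)
        then show ?thesis using True by (simp add: map_eq_conv)
      next
        case False
        define i where "i = (j - N) div L"
        have i: "i < k" using j False L(2) by (simp add: i_def less_mult_imp_div_less)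
        have jj: "N + i * L \<le> j" "j < N + i * L + L"
        proof -
          have "j - N = i * L + (j - N) mod L" by (simp add: i_def)
          moreover have "(j - N) mod L < L" using L(2) by simp
          ultimately show "N + i * L \<le> j" "j < N + i * L + L" using False by linarith+
        qed
        have "\<forall>i\<in>set [0..<k]. map (turn (letters x)) [N + i * L..<N + i * L + L] = map (turn (letters y)) [N + i * L..<N + i * L + L]"
          using xy(3) unfolding lab_def prod.inject map_eq_conv by blast
        then have "map (turn (letters x)) [N + i * L..<N + i * L + L] = map (turn (letters y)) [N + i * L..<N + i * L + L]"
          using i by simp
        then show ?thesis using jj by (simp add: map_eq_conv)
      qed
    qed
    define \<U> where "\<U> = (\<lambda>z. {x \<in> Z. lab x = z}) ` S"
    define d where "d = C * (l ^ L) ^ k"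
    have d: "d > 0" using C lL by (simp add: d_def)
    have dist: "\<bar>x - y\<bar> \<le> d" if "x \<in> Z" "y \<in> Z" "lab x = lab y" for x y
    proof -
      have "\<bar>x - y\<bar> \<le> C * l ^ (N + k * L)"
      proof (rule diam)
        show "good x" "good y" "in_core M \<delta> (pt x n)" "in_core M \<delta> (pt y n)" for n
          using that(1,2) by (simp_all add: Z_def tail_set_def)
        show "letters x i = letters y i" if "i \<le> N + k * L" for i
          by (rule lab_eq) fact+
      qed
      also have "\<dots> \<le> C * l ^ (L * k)" using l C by (intro mult_left_mono power_decreasing) auto
      finally show ?thesis by (simp add: d_def power_mult)
    qed
    have bd: "bounded U \<and> diameter U \<le> d" if mem: "U \<in> \<U>" for U
    proof
      obtain z where U: "U = {x \<in> Z. lab x = z}" using mem unfolding \<U>_def by blast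
      have "\<bar>pt x 0\<bar> \<le> M" if "x \<in> Z" for x
        using that unfolding Z_def tail_set_def in_core_def by blast
      then have "U \<subseteq> cball 0 M" unfolding U by auto
      then show "bounded U" by (rule bounded_subset[OF bounded_cball])
      show "diameter U \<le> d" by (rule diameter_le) (use dist d U in auto)
    qed
    have "card \<U> \<le> card S" unfolding \<U>_def by (rule card_image_le[OF finS])
    then have "real (card \<U>) * d powr s \<le> real (card S) * d powr s" by (intro mult_right_mono) auto
    also have "\<dots> = 3 * 2 ^ N * m L ^ k * (C powr s * ((l ^ L) powr s) ^ k)"
    proof -
      have "d powr s = C powr s * ((l ^ L) ^ k) powr s" unfolding d_def by (rule powr_mult)
      also have "((l ^ L) ^ k) powr s = ((l ^ L) powr s) ^ k"
        by (induction k) (simp_all add: powr_mult)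
      finally show ?thesis by (simp add: cardS)
    qed
    also have "\<dots> = B * (real (m L) * (l ^ L) powr s) ^ k" by (simp add: B_def power_mult_distrib)
    also have "\<dots> \<le> B * (1 / 2) ^ k"
      using mL C by (intro mult_left_mono power_mono) (auto simp: B_def)
    finally have "real (card \<U>) * d powr s \<le> \<epsilon>" using k by simp
    moreover have "Z \<subseteq> \<Union>\<U>" using labS unfolding \<U>_def by blast
    moreover have "finite \<U>" using finS by (simp add: \<U>_def)
    moreover have "d \<le> \<epsilon>" using k by (simp add: d_def)
    ultimately show "\<exists>\<U> d. finite \<U> \<and> tail_set M \<delta> N L \<subseteq> \<Union>\<U> \<and>
      (\<forall>U\<in>\<U>. bounded U \<and> diameter U \<le> d) \<and> d \<le> \<epsilon> \<and> real (card \<U>) * d powr s \<le> \<epsilon>"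
      using bd unfolding Z_def by blast
  qed
  then show ?thesis by blast
qed

text \<open>The second end point is prescribed only from some index on, because the images of
  infinity may return to infinity before they settle in the arcs.\<close>

definition low_set :: "real set" where
  "low_set = {x. good x \<and> (\<exists>\<eta> N. (\<forall>n\<ge>N. in_arc (letters x n) (\<eta> (Suc n)) \<and> \<eta> n \<noteq> P (letters x n) \<and>
       \<eta> (Suc n) = T (letters x n) (\<eta> n)) \<and>
     (\<forall>h>p + q + t. eventually (\<lambda>n. \<bar>\<eta> n - pt x n\<bar> \<le> h) sequentially))}"

lemma low_set_orbit:
  assumes "x \<in> low_set"
  obtains \<eta> N where "orbit p q t (\<lambda>n. pt x (n + N)) \<eta> (\<lambda>n. letters x (n + N))"
proof -
  obtain \<eta> N where x: "good x" "\<And>n. n \<ge> N \<Longrightarrow> in_arc (letters x n) (\<eta> (Suc n)) \<and> \<eta> n \<noteq> P (letters x n) \<and>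
       \<eta> (Suc n) = T (letters x n) (\<eta> n)"
     "\<And>h. h > p + q + t \<Longrightarrow> eventually (\<lambda>n. \<bar>\<eta> n - pt x n\<bar> \<le> h) sequentially"
    using assms unfolding low_set_def by blast
  have "orbit p q t (\<lambda>n. pt x (n + N)) (\<lambda>n. \<eta> (n + N)) (\<lambda>n. letters x (n + N))"
  proof
    fix n
    show "letters x (n + N) \<le> 2" by (rule letters_le)
    show "letters x (Suc n + N) \<noteq> letters x (n + N)" using letters_ne[OF x(1)] by simp
    show "in_arc (letters x (n + N)) (pt x (n + N))" by (rule good_in[OF x(1)])
    show "pt x (n + N) \<noteq> P (letters x (n + N))" by (rule good_ne_P[OF x(1)])
    show "pt x (Suc n + N) = T (letters x (n + N)) (pt x (n + N))" by (simp add: pt_Suc)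
    show "in_arc (letters x (n + N)) (\<eta> (Suc n + N))" "\<eta> (n + N) \<noteq> P (letters x (n + N))"
      "\<eta> (Suc n + N) = T (letters x (n + N)) (\<eta> (n + N))" using x(2)[of "n + N"] by auto
  next
    fix h assume "p + q + t < h"
    from x(3)[OF this] show "eventually (\<lambda>n. \<bar>\<eta> (n + N) - pt x (n + N)\<bar> \<le> h) sequentially"
      by (rule sequentially_offset)
  qed
  then show ?thesis by (rule that)
qed

lemma eventually_shift: "eventually (\<lambda>n. A (n + N)) sequentially \<Longrightarrow> eventually A sequentially"
  by (simp add: eventually_sequentially_seg)

lemma low_set_in_core:
  assumes "x \<in> low_set"
  shows "\<exists>m::nat. \<forall>n. in_core (real (Suc m)) (1 / real (Suc m)) (pt x n)"
proof -
  obtain \<eta> N where "orbit p q t (\<lambda>n. pt x (n + N)) \<eta> (\<lambda>n. letters x (n + N))" using low_set_orbit[OF assms] .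
  then interpret o: orbit p q t "\<lambda>n. pt x (n + N)" \<eta> "\<lambda>n. letters x (n + N)" .
  have g: "pt x n \<noteq> 0" "pt x n \<noteq> p + q" for n using assms unfolding low_set_def good_def by auto
  obtain \<delta> where \<delta>: "\<delta> > 0" and aw: "eventually (\<lambda>n. \<delta> \<le> \<bar>pt x (n + N)\<bar> \<and> \<delta> \<le> \<bar>pt x (n + N) - (p + q)\<bar>) sequentially"
  proof -
    obtain \<delta> where "\<delta> > 0" and aw: "eventually (\<lambda>n. \<delta> \<le> \<bar>pt x (n + N)\<bar> \<and> \<delta> \<le> \<bar>pt x (n + N) - (p + q)\<bar> \<and>
      \<delta> \<le> \<bar>\<eta> n\<bar> \<and> \<delta> \<le> \<bar>\<eta> n - (p + q)\<bar>) sequentially" using o.eventually_away by blast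
    moreover from aw have "eventually (\<lambda>n. \<delta> \<le> \<bar>pt x (n + N)\<bar> \<and> \<delta> \<le> \<bar>pt x (n + N) - (p + q)\<bar>) sequentially"
      by (rule eventually_mono) blast
    ultimately show ?thesis using that by blast
  qed
  \<comment> \<open>One quantity controls all three core conditions. It is eventually bounded, and
    the finitely many earlier values are finite because the orbit avoids the vertices.\<close>
  define f where "f n = \<bar>pt x n\<bar> + 1 / \<bar>pt x n\<bar> + 1 / \<bar>pt x n - (p + q)\<bar>" for n
  define B where "B = 2 * (p + q) + t + 1 + 1 / \<delta> + 1 / \<delta>"
  have "eventually (\<lambda>n. f (n + N) \<le> B) sequentially"
    using aw o.eventually_bounded
  proof eventually_elim
    case (elim n)
    have "1 / \<bar>pt x (n + N)\<bar> \<le> 1 / \<delta>" "1 / \<bar>pt x (n + N) - (p + q)\<bar> \<le> 1 / \<delta>"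
      using elim \<delta> by (auto intro!: frac_le)
    then show ?case using elim unfolding f_def B_def by linarith
  qed
  then have "eventually (\<lambda>n. f n \<le> B) sequentially" by (rule eventually_shift)
  then obtain n0 where n0: "\<And>n. n \<ge> n0 \<Longrightarrow> f n \<le> B" unfolding eventually_sequentially by blast
  define B' where "B' = Max (insert B (f ` {..<n0}))"
  have B': "f n \<le> B'" for n
  proof (cases "n < n0")
    case True
    then show ?thesis unfolding B'_def by (intro Max_ge) auto
  next
    case False
    then have "f n \<le> B" using n0 by simp
    also have "B \<le> B'" unfolding B'_def by (intro Max_ge) auto
    finally show ?thesis .
  qed
  obtain m :: nat where m: "B' \<le> real m" using real_arch_simple by blast
  have "in_core (real (Suc m)) (1 / real (Suc m)) (pt x n)" for n
  proof -
    have pos: "\<bar>pt x n\<bar> > 0" "\<bar>pt x n - (p + q)\<bar> > 0" using g[of n] by auto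
    have "f n \<le> real (Suc m)" using B'[of n] m by simp
    moreover have "1 / \<bar>pt x n\<bar> > 0" "1 / \<bar>pt x n - (p + q)\<bar> > 0" using pos by auto
    ultimately have "\<bar>pt x n\<bar> \<le> real (Suc m)" "1 / \<bar>pt x n\<bar> \<le> real (Suc m)" "1 / \<bar>pt x n - (p + q)\<bar> \<le> real (Suc m)"
      using pos unfolding f_def by linarith+
    then show ?thesis using pos unfolding in_core_def by (simp add: field_simps del: of_nat_Suc)
  qed
  then show ?thesis by blast
qed

lemma low_set_windows:
  assumes "x \<in> low_set"
  shows "\<exists>N. \<forall>n\<ge>N. \<not> crossing (map (turn (letters x)) [n..<n + L])"
proof -
  obtain \<eta> N where "orbit p q t (\<lambda>n. pt x (n + N)) \<eta> (\<lambda>n. letters x (n + N))" using low_set_orbit[OF assms] .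
  then interpret o: orbit p q t "\<lambda>n. pt x (n + N)" \<eta> "\<lambda>n. letters x (n + N)" .
  have "map (turn (\<lambda>n. letters x (n + N))) [n..<n + L] = map (turn (letters x)) [n + N..<(n + N) + L]" for n
    by (rule nth_equalityI) (auto simp: turn_def add_ac)
  then have "eventually (\<lambda>n. \<not> crossing (map (turn (letters x)) [n + N..<(n + N) + L])) sequentially"
    using o.eventually_not_crossing[of L] by simp
  then have "eventually (\<lambda>n. \<not> crossing (map (turn (letters x)) [n..<n + L])) sequentially" by (rule eventually_shift)
  then show ?thesis unfolding eventually_sequentially .
qed

theorem low_set_null:
  assumes "s > 0"
  shows "hausdorff_measure s low_set = 0"
proof -
  \<comment> \<open>The window length may depend on the core but not on \<open>N\<close>: the index
    from which windows are admissible is known only after \<open>L\<close> has been fixed.\<close>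
  have "\<exists>L. \<forall>m N. hausdorff_measure s (tail_set (real (Suc m)) (1 / real (Suc m)) N (L m)) = 0"
    using tail_set_null[OF assms, of "real (Suc _)" "1 / real (Suc _)"]
    by (intro choice) auto
  then obtain L where L: "\<And>m N. hausdorff_measure s (tail_set (real (Suc m)) (1 / real (Suc m)) N (L m)) = 0"
    by blast
  have "low_set \<subseteq> (\<Union>m. \<Union>N. tail_set (real (Suc m)) (1 / real (Suc m)) N (L m))"
  proof
    fix x assume x: "x \<in> low_set"
    obtain m where m: "\<And>n. in_core (real (Suc m)) (1 / real (Suc m)) (pt x n)" using low_set_in_core[OF x] by blast
    obtain N where N: "\<And>n. n \<ge> N \<Longrightarrow> \<not> crossing (map (turn (letters x)) [n..<n + L m])"
      using low_set_windows[OF x] by blast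
    have "x \<in> tail_set (real (Suc m)) (1 / real (Suc m)) N (L m)"
      unfolding tail_set_def using m N x by (simp add: low_set_def)
    then show "x \<in> (\<Union>m. \<Union>N. tail_set (real (Suc m)) (1 / real (Suc m)) N (L m))" by blast
  qed
  moreover have "hausdorff_measure s (\<Union>m. \<Union>N. tail_set (real (Suc m)) (1 / real (Suc m)) N (L m)) = 0"
    by (intro hausdorff_measure_0_UN L)
  ultimately show ?thesis by (rule hausdorff_measure_0_mono[rotated])
qed

end

section \<open>Fricke groups and the modular group\<close>

definition adj :: "real^2^2 \<Rightarrow> real^2^2" where
  "adj A = mat2 (A$2$2) (- A$1$2) (- A$2$1) (A$1$1)"

lemma mult_nth: "(A ** B)$1$1 = A$1$1 * B$1$1 + A$1$2 * B$2$1" "(A ** B)$1$2 = A$1$1 * B$1$2 + A$1$2 * B$2$2"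
   "(A ** B)$2$1 = A$2$1 * B$1$1 + A$2$2 * B$2$1" "(A ** B)$2$2 = A$2$1 * B$1$2 + A$2$2 * B$2$2"
  for A B :: "real^2^2"
  by (simp_all add: matrix_matrix_mult_def sum_2)

lemma one_nth: "(mat 1 :: real^2^2)$1$1 = 1" "(mat 1 :: real^2^2)$1$2 = 0"
  "(mat 1 :: real^2^2)$2$1 = 0" "(mat 1 :: real^2^2)$2$2 = 1"
  by (simp_all add: mat_def)

lemma det_adj: "det (adj A) = det A"
  by (simp add: adj_def det_2 mult.commute)

lemma adj_mult: "det A = 1 \<Longrightarrow> adj A ** A = mat 1" "det A = 1 \<Longrightarrow> A ** adj A = mat 1"
  by (simp_all add: vec_eq_iff forall_2 mult_nth one_nth adj_def det_2 algebra_simps)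

lemma moebius_one: "moebius (mat 1) z = z"
  by (cases z) (simp_all add: moebius_def one_nth)

lemma moebius_mult:
  assumes "det A = 1" "det B = 1"
  shows "moebius (A ** B) z = moebius A (moebius B z)"
proof -
  define a b c d where "a = A$1$1" "b = A$1$2" "c = A$2$1" "d = A$2$2"
  define a' b' c' d' where "a' = B$1$1" "b' = B$1$2" "c' = B$2$1" "d' = B$2$2"
  note defs = a_b_c_d_def a'_b'_c'_d'_def
  have dA: "a * d - b * c = 1" and dB: "a' * d' - b' * c' = 1" using assms by (simp_all add: defs det_2)
  \<comment> \<open>Action in homogeneous coordinates \<open>[u : v]\<close>; this treats finite
    points and infinity, as arguments and as intermediate values, at once.\<close>
  have main: "(if c * u + d * v = 0 then None else Some ((a * u + b * v) / (c * u + d * v))) =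
     moebius A (if v = 0 then None else Some (u / v))" if uv: "u \<noteq> 0 \<or> v \<noteq> 0" for u v
  proof (cases "v = 0")
    case True
    then show ?thesis using uv by (simp add: moebius_def defs)
  next
    case False
    have e: "c * (u / v) + d = (c * u + d * v) / v" "a * (u / v) + b = (a * u + b * v) / v"
      using False by (simp_all add: field_simps)
    show ?thesis using False unfolding moebius_def defs(1-4)[symmetric] by (simp add: e del: times_divide_eq_right)
  qed
  show ?thesis
  proof (cases z)
    case None
    have "a' \<noteq> 0 \<or> c' \<noteq> 0" using dB by auto
    from main[OF this] show ?thesis
      unfolding None moebius_def[of "A ** B"] moebius_def[of B] option.case mult_nth defs[symmetric] by simp
  next
    case (Some x)
    have "a' * x + b' \<noteq> 0 \<or> c' * x + d' \<noteq> 0"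
    proof (rule ccontr)
      assume "\<not> ?thesis"
      then have "b' = - a' * x" "d' = - c' * x" by auto
      then show False using dB by simp
    qed
    note m = main[OF this]
    have e: "(c * a' + d * c') * x + (c * b' + d * d') = c * (a' * x + b') + d * (c' * x + d')"
      "(a * a' + b * c') * x + (a * b' + b * d') = a * (a' * x + b') + b * (c' * x + d')"
      by (simp_all add: algebra_simps)
    show ?thesis
      unfolding Some moebius_def[of "A ** B"] moebius_def[of B] option.case mult_nth defs[symmetric] e by (rule m)
  qed
qed

lemma psl_mult:
  assumes "det A = 1" "det B = 1"
  shows "psl A \<otimes>\<^bsub>PSL2\<^esub> psl B = psl (A ** B)"
proof -
  have "{mat 1, - mat 1} #>\<^bsub>SL2\<^esub> A <#>\<^bsub>SL2\<^esub> ({mat 1, - mat 1} #>\<^bsub>SL2\<^esub> B) =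
      {mat 1, - mat 1} #>\<^bsub>SL2\<^esub> (A \<otimes>\<^bsub>SL2\<^esub> B)"
    by (rule normal.rcos_sum[OF normal_pm1]) (use assms in \<open>auto simp: SL2_def\<close>)
  then show ?thesis by (simp add: PSL2_def FactGroup_def psl_def SL2_def)
qed

lemma psl_one: "\<one>\<^bsub>PSL2\<^esub> = psl (mat 1)"
  by (simp add: PSL2_def FactGroup_def psl_eq)

lemma psl_inv:
  assumes "det A = 1"
  shows "inv\<^bsub>PSL2\<^esub> (psl A) = psl (adj A)"
proof -
  interpret group PSL2 by (rule group_PSL2)
  show ?thesis
    by (rule inv_equality) (use assms in \<open>simp_all add: psl_mult det_adj adj_mult psl_one psl_in_PSL2\<close>)
qed

text \<open>The real functions \<open>T i\<close> have junk values at their poles; the matrices give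
  the true action on the projective line, as needed to follow infinity.\<close>

locale tri_matrices = tri +
  fixes A :: "nat \<Rightarrow> real^2^2"
  assumes det_A: "i \<le> 2 \<Longrightarrow> det (A i) = 1"
    and A_None: "i \<le> 2 \<Longrightarrow> moebius (A i) None = Some (P i)"
    and A_Some: "i \<le> 2 \<Longrightarrow> moebius (A i) (Some x) = (if x = P i then None else Some (T i x))"
begin

inductive_set words :: "(real^2^2) set" where
  one: "mat 1 \<in> words"
| step: "V \<in> words \<Longrightarrow> i \<le> 2 \<Longrightarrow> A i ** V \<in> words"

lemma det_words: "V \<in> words \<Longrightarrow> det V = 1"
  by (induction rule: words.induct) (auto simp: det_mul det_A)

primrec V :: "real \<Rightarrow> nat \<Rightarrow> real^2^2" where
  "V x 0 = mat 1"
| "V x (Suc n) = A (letters x n) ** V x n"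

lemma V_words: "V x n \<in> words"
  by (induction n) (auto intro: words.intros letters_le)

lemma det_V: "det (V x n) = 1"
  by (rule det_words[OF V_words])

lemma moebius_V_Suc: "moebius (V x (Suc n)) z = moebius (A (letters x n)) (moebius (V x n) z)"
  using moebius_mult[OF det_A[OF letters_le] det_V] by simp

lemma moebius_V_pt: "good x \<Longrightarrow> moebius (V x n) (Some x) = Some (pt x n)"
  by (induction n) (simp_all add: moebius_one moebius_V_Suc[simplified] A_Some[OF letters_le] good_ne_P pt_Suc)

text \<open>If the coded orbit met a pole, the word read so far followed by the generator with that
  pole would send \<open>x\<close> to infinity.\<close>

lemma good_if_not_None:
  assumes "\<And>W. W \<in> words \<Longrightarrow> moebius W (Some x) \<noteq> None"
  shows "good x"
proof -
  have ne: "pt x n \<noteq> P i" if "moebius (V x n) (Some x) = Some (pt x n)" "i \<le> 2" for n i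
  proof
    assume "pt x n = P i"
    then have "moebius (A i ** V x n) (Some x) = None"
      using that by (simp add: moebius_mult[OF det_A det_V] A_Some)
    then show False using assms[OF words.step[OF V_words that(2)]] by blast
  qed
  have "moebius (V x n) (Some x) = Some (pt x n)" for n
  proof (induction n)
    case (Suc n)
    then show ?case using ne[OF Suc letters_le]
      by (simp add: moebius_V_Suc A_Some[OF letters_le] pt_Suc del: V.simps)
  qed (simp add: moebius_one)
  then have "pt x n \<noteq> P i" if "i \<le> 2" for n i using ne that by blast
  from this[of 0] this[of "Suc 0"] this[of 2] show ?thesis by (auto simp: good_def PK_simps)
qed

text \<open>The orbit of \<open>\<infinity>\<close> comes back to \<open>\<infinity>\<close> only along the blocks 012 and 210, and infinitely many such
  blocks would translate the coded point out of its interval.\<close>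

lemma orbit_of_infinity:
  assumes x: "good x" and o0: "orb n0 = None"
    and o: "\<And>n. n \<ge> n0 \<Longrightarrow> orb (Suc n) = moebius (A (letters x n)) (orb n)"
  shows "\<exists>N\<ge>n0. \<forall>n\<ge>N. \<exists>y. orb (Suc n) = Some y \<and> in_arc (letters x n) y"
proof -
  \<comment> \<open>Ping-pong: once the image lies in the arc of the letter just applied, the next
    letter is different and throws it into its own arc.\<close>
  have inv: "\<exists>y. orb (Suc n) = Some y \<and> in_arc (letters x n) y"
    if "n \<ge> N" "orb (Suc N) = Some y" "in_arc (letters x N) y" "N \<ge> n0" for n N y
    using that(1)
  proof (induction n rule: dec_induct)
    case (step n)
    then obtain y where y: "orb (Suc n) = Some y" "in_arc (letters x n) y" by blast
    have ne: "letters x (Suc n) \<noteq> letters x n" by (rule letters_ne[OF x])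
    have "y \<noteq> P (letters x (Suc n))" by (rule in_arc_ne_P[OF letters_le letters_le ne y(2)])
    then have "orb (Suc (Suc n)) = Some (T (letters x (Suc n)) y)"
      using o[of "Suc n"] step(1) that(4) y(1) by (simp add: A_Some[OF letters_le])
    then show ?case using T_in[OF letters_le letters_le ne y(2)] by blast
  qed (use that in blast)
  show ?thesis
  proof (rule ccontr)
    assume "\<not> ?thesis"
    then have never: "\<not> in_arc (letters x n) y" if "n \<ge> n0" "orb (Suc n) = Some y" for n y
      using inv[OF _ that(2) _ that(1)] that by blast
    have TP: "in_arc 2 (T 2 0)" "in_arc 0 (T 0 (p + q))" "T (Suc 0) 0 = p + q" "T (Suc 0) (p + q) = 0"
    proof -
      have "- p - q = - (p + q)" by simp
      then have "t * q / (- p - q) = - (t * q / (p + q))" by (simp only: minus_divide_right)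
      then show "in_arc 2 (T 2 0)" using p q t by (simp add: T_simps in_arc_simps)
    qed (use p q t in \<open>simp_all add: T_simps in_arc_simps\<close>)
    have act: "orb (Suc n) = Some (T (letters x n) y)" if "n \<ge> n0" "orb n = Some y" "y \<noteq> P (letters x n)" for n y
      using o[OF that(1)] that letters_le[of x n] by (simp add: A_Some)
    have actP: "orb (Suc n) = None" if "n \<ge> n0" "orb n = Some (P (letters x n))" for n
      using o[OF that(1)] that letters_le[of x n] by (simp add: A_Some)
    have act_None: "orb (Suc n) = Some (P (letters x n))" if "n \<ge> n0" "orb n = None" for n
      using o[OF that(1)] that by (simp add: A_None[OF letters_le])
    have ne1: "letters x n \<noteq> Suc 0" if "n \<ge> n0" "orb n = None" for n
      using act_None[OF that] never[OF that(1)] p q by (auto simp: PK_simps in_arc_simps)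
    \<comment> \<open>Starting from infinity, the first letter leads to a vertex; letter 1 then
      moves it to the other vertex and \<open>j\<close> back to infinity. Any other letter on the
      way would enter the arc of that letter.\<close>
    have block: "letters x (Suc n) = Suc 0 \<and> letters x (Suc (Suc n)) = j \<and> orb (n + 3) = None \<and> letters x (n + 3) = i"
      if n: "n \<ge> n0" "orb n = None" "letters x n = i" and ij: "i = 0 \<and> j = 2 \<or> i = 2 \<and> j = 0" for n i j
    proof -
      have Pi: "P i \<noteq> P j" "P i \<noteq> p" "P j \<noteq> p" "in_arc j (T j (P i))" "in_arc i (T i (P j))" "T (Suc 0) (P i) = P j"
        using ij TP p q by (auto simp: PK_simps)
      have other: "m = Suc 0 \<or> m = i \<or> m = j" if "m \<le> 2" for m using letter_cases[OF that] ij by auto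
      have o1: "orb (Suc n) = Some (P i)" using act_None[OF n(1,2)] n(3) by simp
      have "letters x (Suc n) \<noteq> j"
        using act[OF _ o1] never[of "Suc n" "T j (P i)"] n(1) Pi by auto
      then have l1: "letters x (Suc n) = Suc 0" using letters_ne[OF x, of n] other[OF letters_le[of x "Suc n"]] n(3) by auto
      have o2: "orb (Suc (Suc n)) = Some (P j)"
        using act[OF _ o1] n(1) l1 Pi by (simp add: PK_simps)
      have "letters x (Suc (Suc n)) \<noteq> i"
        using act[OF _ o2] never[of "Suc (Suc n)" "T i (P j)"] n(1) Pi by auto
      then have l2: "letters x (Suc (Suc n)) = j"
        using letters_ne[OF x, of "Suc n"] other[OF letters_le[of x "Suc (Suc n)"]] l1 by auto
      have o3: "orb (Suc (Suc (Suc n))) = None" by (rule actP) (use n o2 l2 in auto)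
      have "letters x (Suc (Suc (Suc n))) = i"
        using letters_ne[OF x, of "Suc (Suc n)"] other[OF letters_le[of x "Suc (Suc (Suc n))"]] l2
          ne1[OF _ o3] n(1) by auto
      then show ?thesis using l1 l2 o3 by (simp add: numeral_3_eq_3)
    qed
    define i j where "i = letters x n0" and "j = 2 - i"
    have ij: "i = 0 \<and> j = 2 \<or> i = 2 \<and> j = 0"
      using ne1[OF order_refl o0] letter_cases[OF letters_le[of x n0]] by (auto simp: i_def j_def)
    have blocks: "orb (n0 + 3 * k) = None \<and> letters x (n0 + 3 * k) = i" for k
    proof (induction k)
      case (Suc k)
      then have "letters x (n0 + 3 * k + 3) = i" "orb (n0 + 3 * k + 3) = None"
        using block[of "n0 + 3 * k" i j] ij by auto
      then show ?case by (simp add: add.commute add.left_commute)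
    qed (use o0 i_def in auto)
    have neP: "pt x n \<noteq> 0" "pt x n \<noteq> p" "pt x n \<noteq> p + q" for n using x unfolding good_def by auto
    \<comment> \<open>Each block acts on the coded point as a translation by the cusp width,
      directed away from the arc \<open>i\<close> in which it has to stay.\<close>
    have shift: "pt x (n0 + 3 * k) = pt x n0 + (if i = 0 then real k * (p + q + t) else - (real k * (p + q + t)))" for k
    proof (induction k)
      case (Suc k)
      define m where "m = n0 + 3 * k"
      have l: "letters x m = i" "letters x (Suc m) = Suc 0" "letters x (Suc (Suc m)) = j"
        using block[of m i j] blocks[of k] ij by (auto simp: m_def)
      have e: "T i (pt x m) = pt x (Suc m)" "T (Suc 0) (pt x (Suc m)) = pt x (Suc (Suc m))"
        "T j (pt x (Suc (Suc m))) = pt x (m + 3)" using l by (simp_all add: pt_Suc numeral_3_eq_3)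
      have "pt x (m + 3) = pt x m + (if i = 0 then p + q + t else - (p + q + t))"
        using ij T_210[of "pt x m"] T_012[of "pt x m"] e neP[of m] neP[of "Suc m"] neP[of "Suc (Suc m)"] by auto
      then show ?case using Suc by (auto simp: m_def algebra_simps)
    qed simp
    have "p + q + t > 0" using p q t by simp
    then obtain k :: nat where k: "\<bar>pt x n0\<bar> < real k * (p + q + t)" using ex_less_of_nat_mult by blast
    have "in_arc i (pt x (n0 + 3 * k))" using good_in[OF x, of "n0 + 3 * k"] blocks[of k] by simp
    then show False using ij shift[of k] k p q by (auto simp: in_arc_simps abs_less_iff)
  qed
qed

lemma moebius_adj: "moebius (V x n) (moebius (adj (V x n)) z) = z"
  using moebius_mult[OF det_V, of "adj (V x n)" x n z] by (simp add: det_adj det_V adj_mult moebius_one)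

text \<open>If the same cusp \<open>z\<close> were seen infinitely often, its orbit would return to
  infinity infinitely often, contrary to \<open>orbit_of_infinity\<close>.\<close>

lemma finite_fibre:
  assumes "good x"
  shows "finite {n. moebius (adj (V x n)) None = z}"
proof (rule ccontr)
  assume inf: "infinite {n. moebius (adj (V x n)) None = z}"
  then have "{n. moebius (adj (V x n)) None = z} \<noteq> {}" by (intro notI) simp
  then obtain n0 where n0: "moebius (adj (V x n0)) None = z" by blast
  define orb where "orb n = moebius (V x n) z" for n
  have None: "orb n = None" if "moebius (adj (V x n)) None = z" for n
    using moebius_adj[of x n None] that by (simp add: orb_def)
  obtain N where N: "\<And>n. n \<ge> N \<Longrightarrow> \<exists>y. orb (Suc n) = Some y"
    using orbit_of_infinity[of x orb n0] assms None[OF n0] moebius_V_Suc unfolding orb_def by blast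
  obtain n where n: "n > N" "moebius (adj (V x n)) None = z"
    using inf unfolding infinite_nat_iff_unbounded by blast
  then obtain m where "n = Suc m" "m \<ge> N" by (cases n) auto
  then show False using N[of m] None[OF n(2)] by auto
qed

text \<open>Lagrange values count distinct cusps, whereas \<open>low_set\<close> speaks of almost
  all times; since each cusp occurs only finitely often, finiteness passes from the former to the
  latter.\<close>

lemma low_set_if_finite:
  assumes x: "good x"
    and fin: "\<And>h. h > p + q + t \<Longrightarrow> finite {z. \<exists>n. z = moebius (adj (V x n)) None \<and>
        ext_dist (moebius (V x n) None) (Some (pt x n)) > ereal h}"
  shows "x \<in> low_set"
proof -
  define orb where "orb n = moebius (V x n) None" for n
  have orb_Suc: "orb (Suc n) = moebius (A (letters x n)) (orb n)" for n
    unfolding orb_def by (rule moebius_V_Suc)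
  obtain N where N: "\<And>n. n \<ge> N \<Longrightarrow> \<exists>y. orb (Suc n) = Some y \<and> in_arc (letters x n) y"
    using orbit_of_infinity[OF x, of orb 0] orb_Suc by (auto simp: orb_def moebius_one)
  define \<eta> where "\<eta> n = the (orb n)" for n
  have \<eta>: "orb (Suc n) = Some (\<eta> (Suc n)) \<and> in_arc (letters x n) (\<eta> (Suc n))" if "n \<ge> N" for n
    using N[OF that] by (auto simp: \<eta>_def)
  have rec: "in_arc (letters x n) (\<eta> (Suc n)) \<and> \<eta> n \<noteq> P (letters x n) \<and> \<eta> (Suc n) = T (letters x n) (\<eta> n)"
    if n: "n \<ge> Suc N" for n
  proof -
    obtain m where m: "n = Suc m" "m \<ge> N" using n by (cases n) auto
    have ne: "\<eta> n \<noteq> P (letters x n)"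
      by (rule in_arc_ne_P[OF letters_le letters_le, of x n x m]) (use letters_ne[OF x, of m] \<eta>[OF m(2)] m in auto)
    moreover have "orb (Suc n) = Some (T (letters x n) (\<eta> n))"
      using orb_Suc[of n] \<eta>[OF m(2)] ne m(1) by (simp add: A_Some[OF letters_le])
    ultimately show ?thesis using \<eta>[of n] n by simp
  qed
  have "eventually (\<lambda>n. \<bar>\<eta> n - pt x n\<bar> \<le> h) sequentially" if h: "h > p + q + t" for h
  proof -
    define B where "B = {n. ext_dist (orb n) (Some (pt x n)) > ereal h}"
    define R where "R n = moebius (adj (V x n)) None" for n
    have finR: "finite (R ` B)"
      by (rule finite_subset[OF _ fin[OF h]]) (auto simp: B_def R_def orb_def)
    have fib: "finite {n \<in> B. R n = z}" for z
      by (rule finite_subset[OF _ finite_fibre[OF x, of z]]) (auto simp: R_def)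
    have "finite B"
    proof (rule ccontr)
      assume "infinite B"
      from pigeonhole_infinite[OF this finR] show False using fib by blast
    qed
    then obtain n1 where n1: "\<forall>n\<in>B. n \<le> n1" unfolding finite_nat_set_iff_bounded_le ..
    have "\<bar>\<eta> n - pt x n\<bar> \<le> h" if n: "n \<ge> Suc (max N n1)" for n
    proof -
      obtain m where m: "n = Suc m" "m \<ge> N" using n by (cases n) auto
      have "n \<notin> B" using n n1 by force
      then show ?thesis using \<eta>[OF m(2)] m(1) by (simp add: B_def)
    qed
    then show ?thesis unfolding eventually_sequentially by blast
  qed
  then show ?thesis unfolding low_set_def using x rec by blast
qed

end

text \<open>The trace-free matrix of the involution exchanging infinity and \<open>P\<close>,
  normalized to determinant 1; its residue is the square of \<open>r\<close>.\<close>

definition inv_mat :: "real \<Rightarrow> real \<Rightarrow> real^2^2" where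
  "inv_mat P r = mat2 (P / r) (- (P\<^sup>2 + r\<^sup>2) / r) (1 / r) (- P / r)"

lemma det_inv_mat: "r \<noteq> 0 \<Longrightarrow> det (inv_mat P r) = 1"
  by (simp add: inv_mat_def det_mat2 power2_eq_square field_simps)

lemma moebius_inv_mat:
  assumes "r \<noteq> 0"
  shows "moebius (inv_mat P r) None = Some P"
    "moebius (inv_mat P r) (Some x) = (if x = P then None else Some (P - r\<^sup>2 / (x - P)))"
proof -
  show "moebius (inv_mat P r) None = Some P" using assms by (simp add: moebius_def inv_mat_def)
  have e: "1 / r * x + - P / r = (x - P) / r" using assms by (simp add: field_simps)
  have e': "P / r * x + - (P\<^sup>2 + r\<^sup>2) / r = (P * (x - P) - r\<^sup>2) / r"
    using assms by (simp add: field_simps power2_eq_square)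
  have "(P * (x - P) - r\<^sup>2) / (x - P) = P - r\<^sup>2 / (x - P)" if "x \<noteq> P"
    using that by (simp add: field_simps)
  then show "moebius (inv_mat P r) (Some x) = (if x = P then None else Some (P - r\<^sup>2 / (x - P)))"
    unfolding moebius_def inv_mat_def option.case mat2_nth e e' using assms by simp
qed

definition fricke_gen :: "real \<Rightarrow> real \<Rightarrow> real \<Rightarrow> nat \<Rightarrow> real^2^2" where
  "fricke_gen a b c i = (if i = 0 then T0 a b c else if i = 1 then T1 a b c else T2 a b c)"

text \<open>\<open>p\<close> is the pole of \<open>T1\<close>, \<open>p + q\<close> that of
  \<open>T2\<close>, and \<open>t\<close> is read off from the residues. The equation for
  \<open>a\<close>, \<open>b\<close>, \<open>c\<close> says precisely that
  \<open>p + q + t = a\<close>.\<close>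

lemma fricke_tri_matrices:
  assumes "a > 0" "b > 0" "c > 0" "a\<^sup>2 + b\<^sup>2 + c\<^sup>2 = a * b * c"
  shows "tri_matrices (a\<^sup>2 / (b * c)) (c / b) (b / c) (fricke_gen a b c)"
    and "a\<^sup>2 / (b * c) + c / b + b / c = a"
proof -
  define p q t where "p = a\<^sup>2 / (b * c)" "q = c / b" "t = b / c"
  note pqt = p_q_t_def
  interpret tri p q t using assms by unfold_locales (auto simp: pqt)
  have "p + q + t = (a\<^sup>2 + b\<^sup>2 + c\<^sup>2) / (b * c)"
    using assms(1-3) by (simp add: pqt field_simps power2_eq_square)
  also have "\<dots> = a" unfolding assms(4) using assms(1-3) by simp
  finally have sum: "p + q + t = a" .
  then have pq: "p + q = a - b / c" by (simp add: pqt)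
  define r where "r i = (if i = 0 then a / c else if i = 1 then a / b else (1 :: real))" for i :: nat
  have r: "r i \<noteq> 0" for i using assms by (simp add: r_def)
  have "t * p = (a / c)\<^sup>2" "p * q = (a / b)\<^sup>2" "t * q = 1"
    using assms(1-3) by (simp_all add: pqt power2_eq_square)
  then have K: "K i = (r i)\<^sup>2" for i
    by (simp add: K_def r_def)
  have gen: "fricke_gen a b c i = inv_mat (P i) (r i)" if "i \<le> 2" for i
    using letter_cases[OF that]
  proof (elim disjE)
    assume "i = 0"
    then show ?thesis using assms(1-3)
      by (simp add: fricke_gen_def T0_def inv_mat_def r_def PK_simps power2_eq_square)
  next
    assume i: "i = Suc 0"
    have "p / (a / b) = a / c" "- p / (a / b) = - a / c" using assms(1-3) by (simp_all add: pqt power2_eq_square)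
    moreover have "- (p\<^sup>2 + (a / b)\<^sup>2) / (a / b) = - (1 + (a / c)\<^sup>2) * a / b"
      using assms(1-3) by (simp add: pqt power2_eq_square field_simps)
    ultimately show ?thesis using assms(1-3) i
      by (simp add: fricke_gen_def T1_def inv_mat_def r_def PK_simps)
  next
    assume "i = 2"
    then show ?thesis using assms(1-3)
      by (simp add: fricke_gen_def T2_def inv_mat_def r_def PK_simps pq add.commute)
  qed
  have "tri_matrices p q t (fricke_gen a b c)"
  proof
    fix i x assume i: "i \<le> (2 :: nat)"
    show "det (fricke_gen a b c i) = 1" "moebius (fricke_gen a b c i) None = Some (P i)"
      "moebius (fricke_gen a b c i) (Some x) = (if x = P i then None else Some (T i x))"
      by (simp_all add: gen[OF i] det_inv_mat[OF r] moebius_inv_mat[OF r] T_def K)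
  qed
  then show "tri_matrices (a\<^sup>2 / (b * c)) (c / b) (b / c) (fricke_gen a b c)" by (simp add: pqt)
  show "a\<^sup>2 / (b * c) + c / b + b / c = a" using sum by (simp add: pqt)
qed

text \<open>Infinitely many cusps with height above \<open>h > a\<close> would contain a sequence
  whose heights converge to a limit of at least \<open>h\<close>, contradicting the Lagrange
  value.\<close>

lemma fricke_subset:
  assumes abc: "a > 0" "b > 0" "c > 0" "a\<^sup>2 + b\<^sup>2 + c\<^sup>2 = a * b * c"
    and np: "\<not> parabolic_fixed_point (fricke_group a b c) (Some x)"
    and lag: "lagrange_value_wrt (fricke_group a b c) x = ereal a"
  shows "x \<in> tri.low_set (a\<^sup>2 / (b * c)) (c / b) (b / c)"
proof -
  interpret tri_matrices "a\<^sup>2 / (b * c)" "c / b" "b / c" "fricke_gen a b c" by (rule fricke_tri_matrices[OF abc])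
  interpret G: group PSL2 by (rule group_PSL2)
  let ?\<Gamma> = "fricke_group a b c"
  have gens: "{psl (T0 a b c), psl (T1 a b c), psl (T2 a b c)} \<subseteq> carrier PSL2"
    using det_T[OF abc(1-3)] psl_in_PSL2 by auto
  have gen: "psl (fricke_gen a b c i) \<in> ?\<Gamma>" for i
    unfolding fricke_group_def by (rule generate.incl) (auto simp: fricke_gen_def)
  have mult: "psl (X ** Y) \<in> ?\<Gamma>" if "psl X \<in> ?\<Gamma>" "psl Y \<in> ?\<Gamma>" "det X = 1" "det Y = 1" for X Y
    using generate.eng[of "psl X" PSL2 _ "psl Y"] that unfolding fricke_group_def by (simp add: psl_mult)
  have words: "psl W \<in> ?\<Gamma>" if "W \<in> words" for W
    using that
  proof (induction rule: words.induct)
    case one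
    show ?case unfolding psl_one[symmetric] fricke_group_def by (rule generate.one)
  next
    case (step W i)
    then show ?case by (intro mult gen det_A det_words)
  qed
  have adj: "psl (adj W) \<in> ?\<Gamma>" if "psl W \<in> ?\<Gamma>" "det W = 1" for W
    using G.generate_m_inv_closed[OF gens, of "psl W"] that unfolding fricke_group_def by (simp add: psl_inv)
  have "good x"
  proof (rule good_if_not_None)
    fix W assume W: "W \<in> words"
    show "moebius W (Some x) \<noteq> None"
    proof
      assume N: "moebius W (Some x) = None"
      define S where "S = mat2 1 a 0 1"
      have S: "S = T2 a b c ** T1 a b c ** T0 a b c" unfolding S_def by (rule T2_T1_T0[OF abc, symmetric])
      have dS: "det S = 1" by (simp add: S_def det_mat2)
      have dW: "det W = 1" by (rule det_words[OF W])
      have SG: "psl S \<in> ?\<Gamma>" unfolding S using gen[of 0] gen[of 1] gen[of 2] det_T[OF abc(1-3)]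
        by (intro mult) (auto simp: fricke_gen_def det_mul)
      \<comment> \<open>If \<open>W\<close> sends \<open>x\<close> to infinity, conjugating the
        translation \<open>S\<close> by \<open>W\<close> gives a parabolic element of the group that
        fixes \<open>x\<close>.\<close>
      define U where "U = adj W ** (S ** W)"
      have dU: "det U = 1" by (simp add: U_def det_mul det_adj dW dS)
      have UG: "psl U \<in> ?\<Gamma>" unfolding U_def
        by (intro mult adj SG words[OF W]) (simp_all add: det_mul det_adj dW dS)
      have "trace U = 2"
      proof -
        have "W$1$1 * W$2$2 - W$1$2 * W$2$1 = 1" using dW by (simp add: det_2)
        then show ?thesis by (simp add: U_def trace_def sum_2 mult_nth adj_def S_def algebra_simps)
      qed
      have eqS: "S = W ** U ** adj W"
        unfolding U_def using adj_mult[OF dW] by (metis matrix_mul_assoc matrix_mul_lid matrix_mul_rid)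
      have "psl U \<noteq> \<one>\<^bsub>PSL2\<^esub>"
      proof
        assume "psl U = \<one>\<^bsub>PSL2\<^esub>"
        then have "U = mat 1 \<or> U = - mat 1" unfolding psl_one psl_eq by (auto simp: doubleton_eq_iff)
        then have "S = mat 1 \<or> S = - mat 1" unfolding eqS using adj_mult[OF dW] by (auto simp: neg_mat_mult)
        then have "S$1$2 = 0" by (auto simp: one_nth)
        then show False using abc(1) by (simp add: S_def)
      qed
      then have "parabolic (psl U)" unfolding parabolic_def using psl_in_PSL2[OF dU] \<open>trace U = 2\<close>
        by (auto simp: psl_eq)
      moreover have "psl_act (psl U) (Some x) = Some x"
      proof -
        have "moebius U (Some x) = moebius (adj W) (moebius S (moebius W (Some x)))"
          unfolding U_def by (simp add: moebius_mult det_mul det_adj dW dS)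
        also have "moebius S (moebius W (Some x)) = moebius W (Some x)" unfolding N by (simp add: S_def moebius_def)
        also have "moebius (adj W) (moebius W (Some x)) = Some x"
          using moebius_mult[of "adj W" W "Some x"] by (simp add: det_adj dW adj_mult moebius_one)
        finally show ?thesis by (simp add: psl_act_psl)
      qed
      ultimately show False using np UG unfolding parabolic_fixed_point_def by blast
    qed
  qed
  then show ?thesis
  proof (rule low_set_if_finite)
    fix h assume "h > a\<^sup>2 / (b * c) + c / b + b / c"
    then have h: "h > a" using fricke_tri_matrices(2)[OF abc] by simp
    define Z where "Z = {z. \<exists>n. z = moebius (adj (V x n)) None \<and>
        ext_dist (moebius (V x n) None) (Some (pt x n)) > ereal h}"
    show "finite Z"
    proof (rule ccontr)
      assume "infinite Z"
      then obtain f :: "nat \<Rightarrow> real option" where f: "inj f" "range f \<subseteq> Z"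
        using infinite_countable_subset by blast
      have "\<forall>j. \<exists>n. f j = moebius (adj (V x n)) None \<and>
        ext_dist (moebius (V x n) None) (Some (pt x n)) > ereal h"
        using f(2) unfolding Z_def by blast
      then obtain g where g: "\<And>j. f j = moebius (adj (V x (g j))) None"
        "\<And>j. ext_dist (moebius (V x (g j)) None) (Some (pt x (g j))) > ereal h" by metis
      define D where "D j = ext_dist (moebius (V x (g j)) None) (Some (pt x (g j)))" for j
      \<comment> \<open>Extended reals are sequentially compact, so the heights have a convergent
        subsequence even if they are unbounded or infinite.\<close>
      obtain l k where lk: "strict_mono k" "(D \<circ> k) \<longlonglongrightarrow> l"
        using compact_complete_linorder[of D] by blast
      have "ereal h \<le> l" by (rule LIMSEQ_le_const[OF lk(2)]) (use g(2) in \<open>auto simp: D_def intro: less_imp_le\<close>)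
      moreover have "l \<le> lagrange_value_wrt ?\<Gamma> x"
        unfolding lagrange_value_wrt_def
      proof (rule Sup_upper, rule CollectI, intro exI conjI)
        show "range (\<lambda>j. psl (V x (g (k j)))) \<subseteq> ?\<Gamma>" using words[OF V_words] by blast
        have "psl_act (inv\<^bsub>PSL2\<^esub> (psl (V x (g (k j))))) None = f (k j)" for j
          by (simp add: psl_inv[OF det_V] psl_act_psl g(1))
        then show "inj (\<lambda>j. psl_act (inv\<^bsub>PSL2\<^esub> (psl (V x (g (k j))))) None)"
          by (simp add: inj_def inj_eq[OF f(1)] strict_mono_eq[OF lk(1)])
        show "(\<lambda>j. ext_dist (psl_act (psl (V x (g (k j)))) None) (psl_act (psl (V x (g (k j)))) (Some x))) \<longlonglongrightarrow> l"
          using lk(2) by (simp add: psl_act_psl moebius_V_pt[OF \<open>good x\<close>] D_def o_def)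
      qed
      ultimately have "ereal h \<le> ereal a" unfolding lag by (rule order_trans)
      then show False using h by simp
    qed
  qed
qed

text \<open>For \<open>a = b = c = 3\<close> the generators are integral and
  \<open>p = q = t = 1\<close>. A cusp seen with height above \<open>h\<close> is then a fraction
  approximating \<open>x\<close> better than \<open>1 / (h * q\<^sup>2)\<close>, or
  infinity.\<close>

lemma classical_subset:
  assumes irr: "x \<notin> \<rat>" and lag: "lagrange_value x = 3"
  shows "x \<in> tri.low_set 1 1 1"
proof -
  have abc: "(3::real) > 0" "(3::real)\<^sup>2 + 3\<^sup>2 + 3\<^sup>2 = 3 * 3 * 3" by simp_all
  interpret tri_matrices 1 1 1 "fricke_gen 3 3 3"
    using fricke_tri_matrices(1)[OF abc(1) abc(1) abc(1) abc(2)] by simp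
  have gen: "fricke_gen 3 3 3 i $ j $ k \<in> \<int>" for i j k
    using exhaust_2[of j] exhaust_2[of k] by (auto simp: fricke_gen_def T0_def T1_def T2_def)
  have words: "W $ j $ k \<in> \<int>" if "W \<in> words" for W j k
    using that
  proof (induction arbitrary: j k rule: words.induct)
    case one
    then show ?case by (simp add: mat_def)
  next
    case (step W i)
    then show ?case by (simp add: matrix_matrix_mult_def sum_2 gen Ints_mult Ints_add)
  qed
  have den: "W$2$1 * x + W$2$2 \<noteq> 0" if W: "W \<in> words" for W
  proof
    assume e: "W$2$1 * x + W$2$2 = 0"
    show False
    proof (cases "W$2$1 = 0")
      case True
      then show False using e det_words[OF W] by (simp add: det_2)
    next
      case False
      then have "x = - W$2$2 / W$2$1" using e by (simp add: field_simps)
      also have "\<dots> \<in> \<rat>" using words[OF W] Ints_subset_Rats by (intro Rats_divide) auto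
      finally show False using irr by simp
    qed
  qed
  have "good x" by (rule good_if_not_None) (use den in \<open>simp add: moebius_def\<close>)
  then show ?thesis
  proof (rule low_set_if_finite)
    fix h :: real assume "h > 1 + 1 + 1"
    then have h: "h > 3" by simp
    define X where "X = {y. \<exists>p q :: int. q > 0 \<and> y = real_of_int p / real_of_int q \<and>
                                   \<bar>x - y\<bar> < 1 / (h * (real_of_int q)\<^sup>2)}"
    have finX: "finite X"
    proof (rule ccontr)
      assume "infinite X"
      then have "ereal h \<le> lagrange_value x" unfolding lagrange_value_def X_def by (intro Sup_upper) blast
      then show False using h unfolding lag by simp
    qed
    have mem: "moebius (adj (V x n)) None \<in> insert None (Some ` X)"
      if d: "ext_dist (moebius (V x n) None) (Some (pt x n)) > ereal h" for n
    proof (cases "V x n $2$1 = 0")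
      case True
      then show ?thesis by (simp add: moebius_def adj_def)
    next
      case False
      define A' B' C' D' where "A' = V x n $1$1" "B' = V x n $1$2" "C' = V x n $2$1" "D' = V x n $2$2"
      note defs = A'_B'_C'_D'_def
      have C: "C' \<noteq> 0" using False by (simp add: defs)
      have dn: "C' * x + D' \<noteq> 0" using den[OF V_words[of x n]] by (simp add: defs)
      have det: "A' * D' - B' * C' = 1" using det_V[of x n] by (simp add: defs det_2)
      have "Some (pt x n) = Some ((A' * x + B') / (C' * x + D'))"
        using moebius_V_pt[OF \<open>good x\<close>, of n] dn by (simp add: moebius_def defs)
      then have "\<bar>A' / C' - (A' * x + B') / (C' * x + D')\<bar> > h"
        using d C by (simp add: moebius_def defs)
      \<comment> \<open>With determinant 1 the height is the reciprocal of \<open>C'\<^sup>2\<close>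
        times the distance from \<open>x\<close> to the cusp \<open>- D' / C'\<close>.\<close>
      also have "A' / C' - (A' * x + B') / (C' * x + D') = (A' * D' - B' * C') / (C' * (C' * x + D'))"
        using C dn by (simp add: field_simps)
      also have "C' * (C' * x + D') = C'\<^sup>2 * (x + D' / C')" using C by (simp add: field_simps power2_eq_square)
      finally have "h < 1 / (C'\<^sup>2 * \<bar>x + D' / C'\<bar>)" by (simp add: det abs_mult)
      moreover have "x + D' / C' \<noteq> 0" using dn C by (simp add: field_simps)
      ultimately have lt: "\<bar>x - (- D' / C')\<bar> < 1 / (h * C'\<^sup>2)"
        using C h by (simp add: field_simps)
      obtain c d where cd: "C' = of_int c" "D' = of_int d"
        using words[OF V_words[of x n]] unfolding defs by (metis Ints_cases)
      have "- D' / C' \<in> X"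
        unfolding X_def
      proof (rule CollectI, intro exI conjI)
        \<comment> \<open>The lower left entry may be negative, so its sign is moved to the
          numerator to obtain a positive denominator.\<close>
        show "\<bar>c\<bar> > 0" using C cd by simp
        show "- D' / C' = real_of_int (- d * sgn c) / real_of_int \<bar>c\<bar>"
          using C unfolding cd by (cases "c > 0") auto
        show "\<bar>x - - D' / C'\<bar> < 1 / (h * (real_of_int \<bar>c\<bar>)\<^sup>2)" using lt unfolding cd by simp
      qed
      then show ?thesis using C by (simp add: moebius_def adj_def defs)
    qed
    have "{z. \<exists>n. z = moebius (adj (V x n)) None \<and>
        ext_dist (moebius (V x n) None) (Some (pt x n)) > ereal h} \<subseteq> insert None (Some ` X)"
      by (rule subsetI, elim CollectE exE conjE, simp only: mem)
    then show "finite {z. \<exists>n. z = moebius (adj (V x n)) None \<and>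
        ext_dist (moebius (V x n) None) (Some (pt x n)) > ereal h}" by (rule finite_subset) (use finX in simp)
  qed
qed

theorem theorem1:
  "hausdorff_dim {\<xi> :: real. \<xi> \<notin> \<rat> \<and> lagrange_value \<xi> = 3} = 0 \<and>
   (\<forall>a b c :: real.
      0 < a \<longrightarrow> 0 < b \<longrightarrow> 0 < c \<longrightarrow> a\<^sup>2 + b\<^sup>2 + c\<^sup>2 = a * b * c \<longrightarrow>
      2 < a \<longrightarrow> a \<le> b \<longrightarrow> b \<le> c \<longrightarrow> c < a * b / 2 \<longrightarrow>
      hausdorff_dim {\<xi> :: real. \<not> parabolic_fixed_point (fricke_group a b c) (Some \<xi>) \<and>
                                lagrange_value_wrt (fricke_group a b c) \<xi> = ereal a} = 0)"
proof (intro conjI allI impI)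
  interpret tri 1 1 1 by unfold_locales simp_all
  show "hausdorff_dim {\<xi> :: real. \<xi> \<notin> \<rat> \<and> lagrange_value \<xi> = 3} = 0"
    by (rule hausdorff_dim_eq_0, rule hausdorff_measure_0_mono[OF low_set_null])
      (use classical_subset in auto)
next
  fix a b c :: real
  assume abc: "0 < a" "0 < b" "0 < c" "a\<^sup>2 + b\<^sup>2 + c\<^sup>2 = a * b * c"
  interpret tri "a\<^sup>2 / (b * c)" "c / b" "b / c" using abc by unfold_locales simp_all
  show "hausdorff_dim {\<xi> :: real. \<not> parabolic_fixed_point (fricke_group a b c) (Some \<xi>) \<and>
                                lagrange_value_wrt (fricke_group a b c) \<xi> = ereal a} = 0"
    by (rule hausdorff_dim_eq_0, rule hausdorff_measure_0_mono[OF low_set_null])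
      (use fricke_subset[OF abc] in auto)
qed

end
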